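(* Let $\xi(t)$ and $\eta(t)$, $t\in\mathbb{R}$, be uncorrelated stationary processes with spectral densities $f(\lambda)$ and $g(\lambda)$ which satisfy the minimality condition, and assume that the operator $\mathbf{B}$ is invertible. Then the spectral characteristic $h(e^{i\lambda})$ and the mean-square error $\Delta(f,g)$ of the optimal linear estimate $\hat A\xi$ of the functional $A\xi=\int_{R^s}a(t)\xi(-t)\,dt$, which depends on the unknown values of the process $\xi(t)$, based on observations of the process $\xi(t)+\eta(t)$, $t\in\mathbb{R}^-\setminus S$, can be calculated by the formulas $$h(e^{i\lambda})=A(e^{i\lambda})\frac{f(\lambda)}{f(\lambda)+g(\lambda)}-\frac{C(e^{i\lambda})}{f(\lambda)+g(\lambda)},$$ $$C(e^{i\lambda})=\sum_{l=1}^{s}\int_{-M_l-N_l}^{-M_l}(\mathbf{B}^{-1}\mathbf{R}\mathbf{a})(t)e^{it\lambda}dt+\int_0^\infty(\mathbf{B}^{-1}\mathbf{R}\mathbf{a})(t)e^{it\lambda}dt,$$ $$\Delta(f,g)=\Delta(h;f,g)=E|A\xi-\hat A\xi|^2=\frac1{2\pi}\int_{-\infty}^{\infty}\frac{|A(e^{i\lambda})g(\lambda)+C(e^{i\lambda})|^2}{(f(\lambda)+g(\lambda))^2}f(\lambda)\,d\lambda+\frac1{2\pi}\int_{-\infty}^{\infty}\frac{|A(e^{i\lambda})f(\lambda)-C(e^{i\lambda})|^2}{(f(\lambda)+g(\lambda))^2}g(\lambda)\,d\lambda$$ $$=\langle\mathbf{R}\mathbf{a},\mathbf{B}^{-1}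\mathbf{R}\mathbf{a}\rangle+\langle\mathbf{Q}\mathbf{a},\mathbf{a}\rangle.$$
   Context: Sets. $M_l=\sum_{k=0}^l(N_k+K_k)$ with $N_0=K_0=0$; $S=\bigcup_{l=1}^s[-M_l-N_l,-M_l]$, $S^+=\bigcup_{l=1}^s[M_l,M_l+N_l]$, $R^s=[0,\infty)\setminus S^+$, $\mathbb{R}^-=(-\infty,0)$, $T=S\cup[0,\infty)$. The inner product in $L_2(T)$ is $\langle x,y\rangle=\sum_{l=1}^{s}\int_{-M_l-N_l}^{-M_l}x(t)\overline{y(t)}dt+\int_0^\infty x(t)\overline{y(t)}dt$. Functional. The function $a(t)$, $t\in R^s$, satisfies $\int_{R^s}|a(t)|dt<\infty$ and $\int_{R^s}t|a(t)|^2dt<\infty$. $\mathbf{a}$ is the function on $T$ with $\mathbf{a}(t)=a(t)$ for $t\in R^s$ and $\mathbf{a}(t)=0$ for $t\in S$ and for $t\in S^+$. $A(e^{i\lambda})=\int_{R^s}a(t)e^{-it\lambda}dt$. (The notations $A(e^{i\lambda})$, $h(e^{i\lambda})$, $C(e^{i\lambda})$ denote functions of $\lambda\in\mathbb{R}$.) Processes. $\xi,\eta$ have zero mean and absolutely continuous spectral functions with densities $f,g$; $\xi(t)=\int_{-\infty}^\infty e^{it\lambda}Z_\xi(d\lambda)$, $\eta(t)=\int_{-\infty}^\infty e^{it\lambda}Z_\eta(d\lambda)$, with orthogonal stochastic measures satisfying $EZ_\xi(\Delta_1)\overline{Z_\xi(\Delta_2)}=\frac1{2\pi}\int_{\Delta_1\cap\Delta_2}f(\lambda)d\lambda$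 and $EZ_\eta(\Delta_1)\overline{Z_\eta(\Delta_2)}=\frac1{2\pi}\int_{\Delta_1\cap\Delta_2}g(\lambda)d\lambda$. Minimality condition: $\int_{-\infty}^{\infty}\frac{|\gamma(\lambda)|^2}{f(\lambda)+g(\lambda)}d\lambda<\infty$ for some nontrivial function of exponential type $\gamma(\lambda)=\int_0^\infty\alpha(t)e^{it\lambda}dt$. Estimates. $L_2(f+g)$ is the Hilbert space of complex-valued functions square-integrable with respect to the measure with density $f+g$; $L_2^s(f+g)$ is its subspace generated by $\{e^{it\lambda}:t\in\mathbb{R}^-\setminus S\}$. The optimal linear estimate $\hat A\xi$ is the orthogonal projection of $A\xi$ in $L_2(\Omega,\mathcal F,P)$ onto the closed linear subspace generated by $\{\xi(t)+\eta(t):t\in\mathbb{R}^-\setminus S\}$; its spectral characteristic is the function $h\in L_2^s(f+g)$ with $\hat A\xi=\int_{-\infty}^\infty h(e^{i\lambda})(Z_\xi(d\lambda)+Z_\eta(d\lambda))$. Operators in $L_2(T)$, for $x\in L_2(T)$, $t\in T$: $$(\mathbf{B}x)(t)=\frac1{2\pi}\sum_{l=1}^s\int_{-M_l-N_l}^{-M_l}x(u)\int_{-\infty}^\infty e^{i\lambda(u-t)}\frac{1}{f(\lambda)+g(\lambda)}d\lambda\,du+\frac1{2\pi}\int_0^\infty x(u)\int_{-\infty}^\infty e^{i\lambda(u-t)}\frac{1}{f(\lambda)+g(\lambda)}d\lambda\,du,$$ $$(\mathbf{R}x)(t)=\frac1{2\pi}\sum_{l=1}^s\int_{-M_l-N_l}^{-M_l}x(u)\int_{-\infty}^\infty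 e^{-i\lambda(u+t)}\frac{f(\lambda)}{f(\lambda)+g(\lambda)}d\lambda\,du+\frac1{2\pi}\int_0^\infty x(u)\int_{-\infty}^\infty e^{i\lambda(u-t)}\frac{f(\lambda)}{f(\lambda)+g(\lambda)}d\lambda\,du,$$ $$(\mathbf{Q}x)(t)=\frac1{2\pi}\sum_{l=1}^s\int_{-M_l-N_l}^{-M_l}x(u)\int_{-\infty}^\infty e^{i\lambda(u-t)}\frac{f(\lambda)g(\lambda)}{f(\lambda)+g(\lambda)}d\lambda\,du+\frac1{2\pi}\int_0^\infty x(u)\int_{-\infty}^\infty e^{i\lambda(u-t)}\frac{f(\lambda)g(\lambda)}{f(\lambda)+g(\lambda)}d\lambda\,du.$$
   Formalization: R is taken with kernel e^{-iλ(u+t)} on all of T (the printed one fails for f=g); B, whose kernel integral diverges, is the form limit of truncations, R and C are L2 limits; the Q-term uses the conjugate of a, and a itself only if a is real or f,g are even. *)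

theory Defs
  imports "HOL-Probability.Probability"
begin

section \<open>Square-integrable functions\<close>

definition L2 :: "'w measure \<Rightarrow> ('w \<Rightarrow> complex) set" where
  "L2 M = {X \<in> borel_measurable M. integrable M (\<lambda>w. (cmod (X w))\<^sup>2)}"

definition L2_tendsto ::
  "'w measure \<Rightarrow> (nat \<Rightarrow> 'w \<Rightarrow> complex) \<Rightarrow> ('w \<Rightarrow> complex) \<Rightarrow> bool" where
  "L2_tendsto M X Y \<longleftrightarrow>
     (\<lambda>n. \<integral>\<^sup>+w. ennreal ((cmod (X n w - Y w))\<^sup>2) \<partial>M) \<longlonglongrightarrow> 0"

text \<open>The closed linear subspace of \<open>L2 M\<close> generated by the family \<open>X t\<close>, \<open>t \<in> I\<close>.\<close>

definition L2_closed_span ::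
  "'w measure \<Rightarrow> 'i set \<Rightarrow> ('i \<Rightarrow> 'w \<Rightarrow> complex) \<Rightarrow> ('w \<Rightarrow> complex) set" where
  "L2_closed_span M I X =
     {Y \<in> L2 M. \<forall>\<epsilon>>0. \<exists>J b. finite J \<and> J \<subseteq> I \<and>
        (\<integral>\<^sup>+w. ennreal ((cmod (Y w - (\<Sum>t\<in>J. b t * X t w)))\<^sup>2) \<partial>M) < ennreal \<epsilon>}"

definition orthogonal_projection ::
  "'w measure \<Rightarrow> ('w \<Rightarrow> complex) set \<Rightarrow> ('w \<Rightarrow> complex) \<Rightarrow> ('w \<Rightarrow> complex) \<Rightarrow> bool" where
  "orthogonal_projection P H Y Yhat \<longleftrightarrow>
     Yhat \<in> H \<and> (\<forall>V\<in>H. (LINT w|P. (Y w - Yhat w) * cnj (V w)) = 0)"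


section \<open>Stationary processes and orthogonal stochastic measures\<close>

definition stationary_process :: "'w measure \<Rightarrow> (real \<Rightarrow> 'w \<Rightarrow> complex) \<Rightarrow> bool" where
  "stationary_process P X \<longleftrightarrow>
     (\<forall>t. X t \<in> L2 P) \<and> (\<forall>t. (LINT w|P. X t w) = 0) \<and>
     (\<forall>t u. (LINT w|P. X (t + u) w * cnj (X u w)) = (LINT w|P. X t w * cnj (X 0 w)))"

definition uncorrelated_processes ::
  "'w measure \<Rightarrow> (real \<Rightarrow> 'w \<Rightarrow> complex) \<Rightarrow> (real \<Rightarrow> 'w \<Rightarrow> complex) \<Rightarrow> bool" where
  "uncorrelated_processes P X Y \<longleftrightarrow> (\<forall>t u. (LINT w|P. X t w * cnj (Y u w)) = 0)"

definition has_spectral_density ::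
  "'w measure \<Rightarrow> (real \<Rightarrow> 'w \<Rightarrow> complex) \<Rightarrow> (real \<Rightarrow> real) \<Rightarrow> bool" where
  "has_spectral_density P X f \<longleftrightarrow>
     integrable lborel f \<and> (\<forall>l. 0 \<le> f l) \<and>
     (\<forall>t. (LINT w|P. X t w * cnj (X 0 w)) = (LBINT l. cis (t * l) * f l) / (2 * pi))"

definition orthogonal_stochastic_measure ::
  "'w measure \<Rightarrow> (real set \<Rightarrow> 'w \<Rightarrow> complex) \<Rightarrow> (real \<Rightarrow> real) \<Rightarrow> bool" where
  "orthogonal_stochastic_measure P Z f \<longleftrightarrow>
     (\<forall>D\<in>sets borel. Z D \<in> L2 P) \<and>
     (\<forall>D\<in>sets borel. \<forall>D'\<in>sets borel.
        (LINT w|P. Z D w * cnj (Z D' w)) = of_real ((LBINT l:D \<inter> D'. f l) / (2 * pi)))"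

text \<open>\<open>I\<close> is (a version of) the stochastic integral of \<open>\<phi>\<close> with respect to the orthogonal
  stochastic measure \<open>Z\<close> with spectral density \<open>f\<close>: the isometric extension to
  \<open>L\<^sub>2(f)\<close> of the elementary integral of simple functions.\<close>

definition simple_stoch_integral ::
  "(real set \<Rightarrow> 'w \<Rightarrow> complex) \<Rightarrow> (real \<Rightarrow> complex) \<Rightarrow> 'w \<Rightarrow> complex" where
  "simple_stoch_integral Z \<phi> w = (\<Sum>y\<in>range \<phi>. y * Z (\<phi> -` {y}) w)"

definition has_stoch_integral ::
  "'w measure \<Rightarrow> (real set \<Rightarrow> 'w \<Rightarrow> complex) \<Rightarrow> (real \<Rightarrow> real) \<Rightarrow> (real \<Rightarrow> complex) \<Rightarrow>
     ('w \<Rightarrow> complex) \<Rightarrow> bool" where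
  "has_stoch_integral P Z f \<phi> I \<longleftrightarrow>
     \<phi> \<in> L2 (density lborel (\<lambda>l. ennreal (f l))) \<and> I \<in> L2 P \<and>
     (\<exists>\<phi>n. (\<forall>n. simple_function borel (\<phi>n n)) \<and>
        L2_tendsto (density lborel (\<lambda>l. ennreal (f l))) \<phi>n \<phi> \<and>
        L2_tendsto P (\<lambda>n. simple_stoch_integral Z (\<phi>n n)) I)"

definition spectral_representation ::
  "'w measure \<Rightarrow> (real \<Rightarrow> 'w \<Rightarrow> complex) \<Rightarrow> (real set \<Rightarrow> 'w \<Rightarrow> complex) \<Rightarrow> (real \<Rightarrow> real) \<Rightarrow> bool" where
  "spectral_representation P X Z f \<longleftrightarrow>
     orthogonal_stochastic_measure P Z f \<and>
     (\<forall>t. has_stoch_integral P Z f (\<lambda>l. cis (t * l)) (X t))"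

text \<open>\<open>Y\<close> is (a version of) the mean-square integral of \<open>X t\<close> over \<open>t \<in> A\<close>, i.e. the integral
  of an \<open>L\<^sub>2(P)\<close>-valued function, characterised by its inner products (Pettis integral).
  No measurability of the sample paths is needed.\<close>

definition has_mean_square_integral ::
  "'w measure \<Rightarrow> real set \<Rightarrow> (real \<Rightarrow> 'w \<Rightarrow> complex) \<Rightarrow> ('w \<Rightarrow> complex) \<Rightarrow> bool" where
  "has_mean_square_integral P A X Y \<longleftrightarrow>
     Y \<in> L2 P \<and>
     (\<forall>V\<in>L2 P. set_integrable lborel A (\<lambda>t. LINT w|P. X t w * cnj (V w)) \<and>
        (LINT w|P. Y w * cnj (V w)) = (LBINT t:A. LINT w|P. X t w * cnj (V w)))"

text \<open>Minimality: \<open>\<gamma>\<close> is a nontrivial (entire) function of exponential type. The integral is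
  taken in \<open>ennreal\<close>, where \<open>x / 0 = \<infinity>\<close> for \<open>x > 0\<close>, so \<open>f + g\<close> cannot vanish
  where \<open>\<gamma>\<close> does not, up to null sets.\<close>

definition minimality_condition :: "(real \<Rightarrow> real) \<Rightarrow> (real \<Rightarrow> real) \<Rightarrow> bool" where
  "minimality_condition f g \<longleftrightarrow>
     (\<exists>(\<gamma> :: complex \<Rightarrow> complex) (\<alpha> :: real \<Rightarrow> complex).
        \<gamma> holomorphic_on UNIV \<and> (\<exists>z. \<gamma> z \<noteq> 0) \<and>
        (\<exists>c \<sigma>. \<forall>z. cmod (\<gamma> z) \<le> c * exp (\<sigma> * cmod z)) \<and>
        set_integrable lborel {0..} \<alpha> \<and>
        (\<forall>l. \<gamma> (of_real l) = (LBINT t:{0..}. \<alpha> t * cis (t * l))) \<and>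
        (\<integral>\<^sup>+l. ennreal ((cmod (\<gamma> (of_real l)))\<^sup>2) / ennreal (f l + g l) \<partial>lborel) < \<infinity>)"


section \<open>The sets of the observation scheme\<close>

definition Msum :: "(nat \<Rightarrow> real) \<Rightarrow> (nat \<Rightarrow> real) \<Rightarrow> nat \<Rightarrow> real" where
  "Msum N K l = (\<Sum>k=0..l. N k + K k)"

definition gaps :: "nat \<Rightarrow> (nat \<Rightarrow> real) \<Rightarrow> (nat \<Rightarrow> real) \<Rightarrow> real set" where
  "gaps s N K = (\<Union>l\<in>{1..s}. {- Msum N K l - N l .. - Msum N K l})"

definition gaps_plus :: "nat \<Rightarrow> (nat \<Rightarrow> real) \<Rightarrow> (nat \<Rightarrow> real) \<Rightarrow> real set" where
  "gaps_plus s N K = (\<Union>l\<in>{1..s}. {Msum N K l .. Msum N K l + N l})"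

definition Rset :: "nat \<Rightarrow> (nat \<Rightarrow> real) \<Rightarrow> (nat \<Rightarrow> real) \<Rightarrow> real set" where
  "Rset s N K = {0..} - gaps_plus s N K"

definition Tset :: "nat \<Rightarrow> (nat \<Rightarrow> real) \<Rightarrow> (nat \<Rightarrow> real) \<Rightarrow> real set" where
  "Tset s N K = gaps s N K \<union> {0..}"

definition observed :: "nat \<Rightarrow> (nat \<Rightarrow> real) \<Rightarrow> (nat \<Rightarrow> real) \<Rightarrow> real set" where
  "observed s N K = {..<0} - gaps s N K"

text \<open>The sum of integrals that stands for integration over \<open>T\<close>. Overlapping intervals, which
  the definition of \<open>M\<^sub>l\<close> does not exclude, are counted with multiplicity.\<close>

definition T_integral ::
  "nat \<Rightarrow> (nat \<Rightarrow> real) \<Rightarrow> (nat \<Rightarrow> real) \<Rightarrow> (real \<Rightarrow> complex) \<Rightarrow> complex" where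
  "T_integral s N K \<phi> =
     (\<Sum>l=1..s. (LBINT t:{- Msum N K l - N l .. - Msum N K l}. \<phi> t)) + (LBINT t:{0..}. \<phi> t)"

definition L2T :: "nat \<Rightarrow> (nat \<Rightarrow> real) \<Rightarrow> (nat \<Rightarrow> real) \<Rightarrow> (real \<Rightarrow> complex) set" where
  "L2T s N K = L2 (restrict_space lborel (Tset s N K))"

definition T_inner ::
  "nat \<Rightarrow> (nat \<Rightarrow> real) \<Rightarrow> (nat \<Rightarrow> real) \<Rightarrow> (real \<Rightarrow> complex) \<Rightarrow> (real \<Rightarrow> complex) \<Rightarrow> complex" where
  "T_inner s N K x y = T_integral s N K (\<lambda>t. x t * cnj (y t))"

definition extend_zero ::
  "nat \<Rightarrow> (nat \<Rightarrow> real) \<Rightarrow> (nat \<Rightarrow> real) \<Rightarrow> (real \<Rightarrow> complex) \<Rightarrow> real \<Rightarrow> complex" where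
  "extend_zero s N K a t = (if t \<in> Rset s N K then a t else 0)"

definition A_fun ::
  "nat \<Rightarrow> (nat \<Rightarrow> real) \<Rightarrow> (nat \<Rightarrow> real) \<Rightarrow> (real \<Rightarrow> complex) \<Rightarrow> real \<Rightarrow> complex" where
  "A_fun s N K a l = (LBINT t:Rset s N K. a t * cis (- (t * l)))"

text \<open>\<open>C(l)\<close> is the integral of \<open>c(t) e\<^sup>i\<^sup>t\<^sup>l\<close> over \<open>T\<close>. For \<open>c \<in> L\<^sub>2(T)\<close> this need not converge
  absolutely; it is the Fourier-Plancherel transform (limit in mean over \<open>T \<inter> (-\<infinity>, n]\<close>).\<close>

definition T_fourier ::
  "nat \<Rightarrow> (nat \<Rightarrow> real) \<Rightarrow> (nat \<Rightarrow> real) \<Rightarrow> (real \<Rightarrow> complex) \<Rightarrow> (real \<Rightarrow> complex) \<Rightarrow> bool" where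
  "T_fourier s N K c C \<longleftrightarrow>
     C \<in> L2 lborel \<and>
     L2_tendsto lborel
       (\<lambda>n l. T_integral s N K (\<lambda>t. indicator {..real n} t * c t * cis (t * l))) C"


section \<open>The operators\<close>

text \<open>Since \<open>f + g\<close> is integrable over the whole line, \<open>1 / (f + g)\<close> is not, so the inner
  integral in the kernel of \<open>B\<close> never exists as a Lebesgue integral (and the totalised value
  \<open>0\<close> would make \<open>B\<close> the zero operator); the one in the kernel of \<open>R\<close> need not exist either.
  As usual, these integrals over the line are understood as limits of integrals over an increasing
  sequence of sets exhausting the line up to a null set. On the sets chosen here
  \<open>1 / (f + g)\<close> is bounded, so every truncated kernel integral converges absolutely for
  arguments in \<open>L\<^sub>2(T)\<close>.\<close>

definition truncation :: "(real \<Rightarrow> real) \<Rightarrow> (real \<Rightarrow> real) \<Rightarrow> nat \<Rightarrow> real set" where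
  "truncation f g n = {l. \<bar>l\<bar> \<le> real n \<and> 1 / real n \<le> f l + g l}"

definition B_trunc ::
  "nat \<Rightarrow> (nat \<Rightarrow> real) \<Rightarrow> (nat \<Rightarrow> real) \<Rightarrow> (real \<Rightarrow> real) \<Rightarrow> (real \<Rightarrow> real) \<Rightarrow> nat \<Rightarrow>
     (real \<Rightarrow> complex) \<Rightarrow> real \<Rightarrow> complex" where
  "B_trunc s N K f g n x t =
     T_integral s N K (\<lambda>u. x u *
       (LBINT l:truncation f g n. cis (l * (u - t)) * of_real (1 / (f l + g l)))) / (2 * pi)"

definition R_trunc ::
  "nat \<Rightarrow> (nat \<Rightarrow> real) \<Rightarrow> (nat \<Rightarrow> real) \<Rightarrow> (real \<Rightarrow> real) \<Rightarrow> (real \<Rightarrow> real) \<Rightarrow> nat \<Rightarrow>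
     (real \<Rightarrow> complex) \<Rightarrow> real \<Rightarrow> complex" where
  "R_trunc s N K f g n x t =
     T_integral s N K (\<lambda>u. x u *
       (LBINT l:truncation f g n. cis (- (l * (u + t))) * of_real (f l / (f l + g l)))) / (2 * pi)"

text \<open>\<open>R_op s N K f g x r\<close> means \<open>R x = r\<close>, with the limit taken in the norm of \<open>L\<^sub>2(T)\<close>;
  it exists for every \<open>x \<in> L\<^sub>2(T)\<close>. The kernel \<open>e\<^sup>-\<^sup>i\<^sup>l\<^sup>(\<^sup>u\<^sup>+\<^sup>t\<^sup>)\<close> is used on both parts of \<open>T\<close>:
  the functional involves \<open>\<xi>(-u)\<close>, and \<open>e\<^sup>i\<^sup>l\<^sup>(\<^sup>u\<^sup>-\<^sup>t\<^sup>)\<close> on \<open>[0,\<infinity>)\<close> would give a wrong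
  estimate (take \<open>f = g\<close>, where the answer must be \<open>h = A / 2\<close>).\<close>

definition R_op ::
  "nat \<Rightarrow> (nat \<Rightarrow> real) \<Rightarrow> (nat \<Rightarrow> real) \<Rightarrow> (real \<Rightarrow> real) \<Rightarrow> (real \<Rightarrow> real) \<Rightarrow>
     (real \<Rightarrow> complex) \<Rightarrow> (real \<Rightarrow> complex) \<Rightarrow> bool" where
  "R_op s N K f g x r \<longleftrightarrow>
     r \<in> L2T s N K \<and>
     L2_tendsto (restrict_space lborel (Tset s N K)) (\<lambda>n. R_trunc s N K f g n x) r"

text \<open>The truncations of \<open>B\<close> are bounded, nonnegative and increasing, but \<open>B\<close> itself is
  unbounded: \<open>1 / (f + g)\<close> is not essentially bounded. \<open>B\<close> is the operator of the limit of their
  quadratic forms (monotone form limit): its form domain consists of the \<open>x\<close> of finite energy,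
  and \<open>B x = y\<close> means that \<open>\<langle>B\<^sub>n x, z\<rangle>\<close> tends to \<open>\<langle>y, z\<rangle>\<close> for all such \<open>z\<close>. Requiring
  norm convergence of \<open>B\<^sub>n x\<close> instead would give an operator that need not be onto: for
  \<open>f + g = 1 / (1 + l\<^sup>2)\<close> and no gaps, \<open>B\<close> is \<open>1 - d\<^sup>2 / dt\<^sup>2\<close> on \<open>[0,\<infinity>)\<close> with Dirichlet
  condition \<open>x(0) = 0\<close>, whereas norm convergence also forces \<open>x'(0) = 0\<close>.\<close>

definition B_form_domain ::
  "nat \<Rightarrow> (nat \<Rightarrow> real) \<Rightarrow> (nat \<Rightarrow> real) \<Rightarrow> (real \<Rightarrow> real) \<Rightarrow> (real \<Rightarrow> real) \<Rightarrow>
     (real \<Rightarrow> complex) set" where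
  "B_form_domain s N K f g =
     {x \<in> L2T s N K. bounded (range (\<lambda>n. T_inner s N K (B_trunc s N K f g n x) x))}"

definition B_op ::
  "nat \<Rightarrow> (nat \<Rightarrow> real) \<Rightarrow> (nat \<Rightarrow> real) \<Rightarrow> (real \<Rightarrow> real) \<Rightarrow> (real \<Rightarrow> real) \<Rightarrow>
     (real \<Rightarrow> complex) \<Rightarrow> (real \<Rightarrow> complex) \<Rightarrow> bool" where
  "B_op s N K f g x y \<longleftrightarrow>
     x \<in> B_form_domain s N K f g \<and> y \<in> L2T s N K \<and>
     (\<forall>z\<in>B_form_domain s N K f g.
        (\<lambda>n. T_inner s N K (B_trunc s N K f g n x) z) \<longlonglongrightarrow> T_inner s N K y z)"

text \<open>\<open>B\<close> is a bijection of its domain onto \<open>L\<^sub>2(T)\<close> with bounded inverse.\<close>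

definition B_invertible ::
  "nat \<Rightarrow> (nat \<Rightarrow> real) \<Rightarrow> (nat \<Rightarrow> real) \<Rightarrow> (real \<Rightarrow> real) \<Rightarrow> (real \<Rightarrow> real) \<Rightarrow> bool" where
  "B_invertible s N K f g \<longleftrightarrow>
     (\<forall>y\<in>L2T s N K. \<exists>x. B_op s N K f g x y) \<and>
     (\<forall>x x' y. B_op s N K f g x y \<longrightarrow> B_op s N K f g x' y \<longrightarrow>
        (AE t in restrict_space lborel (Tset s N K). x t = x' t)) \<and>
     (\<exists>c. \<forall>x y. B_op s N K f g x y \<longrightarrow>
        Re (T_inner s N K x x) \<le> c * Re (T_inner s N K y y))"

text \<open>The symbol of \<open>Q\<close> is integrable, because \<open>f g / (f + g) \<le> f\<close>: no limit is needed.
  With this kernel \<open>\<langle>Q x, x\<rangle>\<close> involves the transform of \<open>x\<close> with \<open>e\<^sup>i\<^sup>l\<^sup>u\<close>, while \<open>A_fun\<close> uses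
  \<open>e\<^sup>-\<^sup>i\<^sup>l\<^sup>u\<close>. So for complex-valued \<open>a\<close> and densities that are not even, the term of the error
  formula is \<open>\<langle>Q x, x\<rangle>\<close> with \<open>x\<close> the complex conjugate of \<open>a\<close>.\<close>

definition Q_op ::
  "nat \<Rightarrow> (nat \<Rightarrow> real) \<Rightarrow> (nat \<Rightarrow> real) \<Rightarrow> (real \<Rightarrow> real) \<Rightarrow> (real \<Rightarrow> real) \<Rightarrow>
     (real \<Rightarrow> complex) \<Rightarrow> real \<Rightarrow> complex" where
  "Q_op s N K f g x t =
     T_integral s N K (\<lambda>u. x u *
       (LBINT l. cis (l * (u - t)) * of_real (f l * g l / (f l + g l)))) / (2 * pi)"


section \<open>Optimal estimate and spectral characteristic\<close>

definition optimal_estimate ::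
  "'w measure \<Rightarrow> nat \<Rightarrow> (nat \<Rightarrow> real) \<Rightarrow> (nat \<Rightarrow> real) \<Rightarrow> (real \<Rightarrow> 'w \<Rightarrow> complex) \<Rightarrow>
     (real \<Rightarrow> 'w \<Rightarrow> complex) \<Rightarrow> ('w \<Rightarrow> complex) \<Rightarrow> ('w \<Rightarrow> complex) \<Rightarrow> bool" where
  "optimal_estimate P s N K \<xi> \<eta> Y Yhat \<longleftrightarrow>
     orthogonal_projection P
       (L2_closed_span P (observed s N K) (\<lambda>t w. \<xi> t w + \<eta> t w)) Y Yhat"

definition spectral_characteristic ::
  "'w measure \<Rightarrow> nat \<Rightarrow> (nat \<Rightarrow> real) \<Rightarrow> (nat \<Rightarrow> real) \<Rightarrow> (real \<Rightarrow> real) \<Rightarrow> (real \<Rightarrow> real) \<Rightarrow>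
     (real set \<Rightarrow> 'w \<Rightarrow> complex) \<Rightarrow> (real set \<Rightarrow> 'w \<Rightarrow> complex) \<Rightarrow> ('w \<Rightarrow> complex) \<Rightarrow>
     (real \<Rightarrow> complex) \<Rightarrow> bool" where
  "spectral_characteristic P s N K f g Z\<xi> Z\<eta> Yhat h \<longleftrightarrow>
     h \<in> L2_closed_span (density lborel (\<lambda>l. ennreal (f l + g l))) (observed s N K)
           (\<lambda>t l. cis (t * l)) \<and>
     has_stoch_integral P (\<lambda>D w. Z\<xi> D w + Z\<eta> D w) (\<lambda>l. f l + g l) h Yhat"

end

theory Submission
  imports Defs "HOL-Complex_Analysis.Conformal_Mappings"
begin

text \<open>Write \<open>w(t)\<close> for the multiplicity with which \<open>T\<close> is covered and \<open>X\<close> for the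
  Fourier-Plancherel transform of \<open>w x\<close>. Then \<open>B\<close> is the operator of the form
  \<open>b(x, z) = (1/2\<pi>) \<integral> X cnj Z / (f + g)\<close>. Bounded invertibility makes \<open>b\<close> coercive. Testing
  coercivity on \<open>\<gamma>\<close> times Fejer kernels, where \<open>\<gamma>\<close> comes from the minimality condition and is the
  transform of a function on the half line, yields that \<open>f + g\<close> is essentially bounded.

  The projection \<open>Ahat\<close> is a limit of combinations of \<open>\<xi>(t) + \<eta>(t)\<close> for observed \<open>t\<close>, so by
  isometry it has a spectral characteristic \<open>h\<close>. Orthogonality of the error says that
  \<open>\<Phi> = A f - (f + g) h\<close> has an inverse transform vanishing at the observed times, and by the bound on
  \<open>f + g\<close> it is square integrable. Hence \<open>\<Phi>\<close> is the transform of \<open>w c'\<close> for some \<open>c' \<in> L2(T)\<close>.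
  The form identity gives \<open>B c' = R a\<close>, so \<open>c' = c\<close> and \<open>\<Phi> = C\<close>. The error formulas follow from
  Pythagoras.\<close>

section \<open>The Hilbert space structure of \<open>L2\<close>\<close>

text \<open>The obstacle is that \<Phi> is a priori known only in the space with weight
  \<open>1 / (f + g)\<close>. That space lies in \<open>L1\<close> but not, in general, in
  \<open>L2\<close>, whereas \<open>B_invertible\<close> speaks only of elements of
  \<open>L2_T\<close>. A bound on \<open>f + g\<close> makes the weighted norm dominate the
  \<open>L2\<close> norm, so a candidate for \<open>B\<^sup>-\<^sup>1 R a\<close> can be read off
  from \<Phi>. Coercivity can give such a bound because it compares the \<open>L2\<close> norm with
  the form of \<open>1 / (f + g)\<close>: a test function whose transform concentrates near one
  frequency isolates the value of \<open>f + g\<close> there. It must also have finite energy and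
  live on \<open>T\<close>, which \<gamma> and the half line provide. Orthogonality is handled in
  the single space \<open>L2 lborel\<close>. \<open>U\<close> multiplies by the square root of
  \<open>f + g\<close> and is applied to functions spanned by observed exponentials;
  \<open>V\<close> divides by it and is applied to transforms of finite energy. The pairing of
  \<open>U\<close> of an exponential with \<open>V Z\<close> is a value of the inverse transform of
  \<open>Z\<close>, up to conjugation and \<open>2 * pi\<close>, so the two families are orthogonal
  exactly when inverse transforms vanish at observed times. Functions are not identified modulo null
  sets; different versions are compared almost everywhere.\<close>

lemma eventually_const_tendsto:
  fixes l :: "'a :: topological_space"
  shows "\<forall>\<^sub>F n in F. l = x n \<Longrightarrow> (x \<longlongrightarrow> l) F"
  by (rule Lim_transform_eventually[OF tendsto_const])

definition ip :: "'w measure \<Rightarrow> ('w \<Rightarrow> complex) \<Rightarrow> ('w \<Rightarrow> complex) \<Rightarrow> complex" where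
  "ip M X Y = (LINT w|M. X w * cnj (Y w))"

text \<open>If the squared modulus is not integrable, the Bochner integral takes its default value 0
  and \<open>nrm\<close> carries no information; hence the membership hypotheses in the facts below.
  On \<open>L2 M\<close> it is only a seminorm.\<close>

definition nrm :: "'w measure \<Rightarrow> ('w \<Rightarrow> complex) \<Rightarrow> real" where
  "nrm M X = sqrt (LINT w|M. (cmod (X w))\<^sup>2)"

abbreviation L2_lim :: "'w measure \<Rightarrow> (nat \<Rightarrow> 'w \<Rightarrow> complex) \<Rightarrow> ('w \<Rightarrow> complex) \<Rightarrow> bool" where
  "L2_lim M X Y \<equiv> (\<lambda>n. nrm M (\<lambda>w. X n w - Y w)) \<longlonglongrightarrow> 0"

lemma L2_measurable [measurable_dest]: "X \<in> L2 M \<Longrightarrow> X \<in> borel_measurable M"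
  by (simp add: L2_def)

lemma L2_integrable: "X \<in> L2 M \<Longrightarrow> integrable M (\<lambda>w. (cmod (X w))\<^sup>2)"
  by (simp add: L2_def)

lemma L2I: "X \<in> borel_measurable M \<Longrightarrow> integrable M (\<lambda>w. (cmod (X w))\<^sup>2) \<Longrightarrow> X \<in> L2 M"
  by (simp add: L2_def)

lemma L2_bound:
  assumes "X \<in> L2 M" "Y \<in> borel_measurable M" "AE w in M. cmod (Y w) \<le> c * cmod (X w)"
  shows "Y \<in> L2 M"
proof (rule L2I)
  have [measurable]: "X \<in> borel_measurable M" "Y \<in> borel_measurable M" using assms by (auto simp: L2_def)
  show "integrable M (\<lambda>w. (cmod (Y w))\<^sup>2)"
  proof (rule Bochner_Integration.integrable_bound)
    show "integrable M (\<lambda>w. c\<^sup>2 * (cmod (X w))\<^sup>2)" using L2_integrable[OF assms(1)] by simp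
    show "AE w in M. norm ((cmod (Y w))\<^sup>2) \<le> norm (c\<^sup>2 * (cmod (X w))\<^sup>2)"
      using assms(3)
    proof eventually_elim
      case (elim w)
      have "(cmod (Y w))\<^sup>2 \<le> (c * cmod (X w))\<^sup>2" by (rule power_mono[OF elim]) simp
      then show ?case by (simp add: power_mult_distrib)
    qed
  qed simp
qed (use assms in simp)

lemma L2_cong_AE:
  assumes "X \<in> L2 M" "Y \<in> borel_measurable M" "AE w in M. X w = Y w" shows "Y \<in> L2 M"
  by (rule L2_bound[OF assms(1,2), of 1]) (use assms(3) in auto)

lemma L2_zero: "(\<lambda>w. 0) \<in> L2 M" by (simp add: L2_def)

lemma L2_mult_left: "X \<in> L2 M \<Longrightarrow> (\<lambda>w. b * X w) \<in> L2 M"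
  by (rule L2_bound[of X M _ "cmod b"]) (auto simp: norm_mult L2_measurable)

lemma L2_uminus: "X \<in> L2 M \<Longrightarrow> (\<lambda>w. - X w) \<in> L2 M"
  using L2_mult_left[of X M "-1"] by simp

lemma borel_measurable_cnj [measurable]:
  "X \<in> borel_measurable M \<Longrightarrow> (\<lambda>w. cnj (X w)) \<in> borel_measurable M"
  by (rule borel_measurable_continuous_on[of cnj]) (auto intro: continuous_intros)

lemma L2_cnj: "X \<in> L2 M \<Longrightarrow> (\<lambda>w. cnj (X w)) \<in> L2 M"
  by (rule L2_bound[of X M _ 1]) (auto simp: L2_measurable)

lemma L2_add:
  assumes "X \<in> L2 M" "Y \<in> L2 M" shows "(\<lambda>w. X w + Y w) \<in> L2 M"
proof (rule L2I)
  have [measurable]: "X \<in> borel_measurable M" "Y \<in> borel_measurable M" using assms by (auto simp: L2_def)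
  show "(\<lambda>w. X w + Y w) \<in> borel_measurable M" by simp
  show "integrable M (\<lambda>w. (cmod (X w + Y w))\<^sup>2)"
  proof (rule Bochner_Integration.integrable_bound)
    show "integrable M (\<lambda>w. 2 * (cmod (X w))\<^sup>2 + 2 * (cmod (Y w))\<^sup>2)"
      using assms[THEN L2_integrable] by simp
    have "(cmod (X w + Y w))\<^sup>2 \<le> 2 * (cmod (X w))\<^sup>2 + 2 * (cmod (Y w))\<^sup>2" for w
    proof -
      have "(cmod (X w + Y w))\<^sup>2 \<le> (cmod (X w) + cmod (Y w))\<^sup>2"
        by (rule power_mono[OF norm_triangle_ineq]) simp
      also have "\<dots> \<le> 2 * (cmod (X w))\<^sup>2 + 2 * (cmod (Y w))\<^sup>2"
        using sum_squares_bound[of "cmod (X w)" "cmod (Y w)"] by (simp add: power2_sum)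
      finally show ?thesis .
    qed
    then show "AE w in M. norm ((cmod (X w + Y w))\<^sup>2) \<le> norm (2 * (cmod (X w))\<^sup>2 + 2 * (cmod (Y w))\<^sup>2)"
      by simp
  qed simp
qed

lemma L2_diff: "X \<in> L2 M \<Longrightarrow> Y \<in> L2 M \<Longrightarrow> (\<lambda>w. X w - Y w) \<in> L2 M"
  using L2_add[OF _ L2_uminus, of X M Y] by simp

lemma L2_sum: "(\<And>i. i \<in> J \<Longrightarrow> X i \<in> L2 M) \<Longrightarrow> (\<lambda>w. \<Sum>i\<in>J. X i w) \<in> L2 M"
  by (induction J rule: infinite_finite_induct) (auto intro: L2_zero L2_add)

lemma L2_mult_integrable:
  assumes "X \<in> L2 M" "Y \<in> L2 M" shows "integrable M (\<lambda>w. X w * Y w)"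
proof (rule Bochner_Integration.integrable_bound)
  have [measurable]: "X \<in> borel_measurable M" "Y \<in> borel_measurable M" using assms by (auto simp: L2_def)
  show "integrable M (\<lambda>w. (cmod (X w))\<^sup>2 + (cmod (Y w))\<^sup>2)"
    using assms[THEN L2_integrable] by simp
  have "norm (X w * Y w) \<le> (cmod (X w))\<^sup>2 + (cmod (Y w))\<^sup>2" for w
    using sum_squares_bound[of "cmod (X w)" "cmod (Y w)"]
      mult_nonneg_nonneg[OF norm_ge_zero[of "X w"] norm_ge_zero[of "Y w"]]
    unfolding norm_mult by linarith
  then show "AE w in M. norm (X w * Y w) \<le> norm ((cmod (X w))\<^sup>2 + (cmod (Y w))\<^sup>2)"
    by simp
  show "(\<lambda>w. X w * Y w) \<in> borel_measurable M" by simp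
qed

lemma ip_integrable:
  "X \<in> L2 M \<Longrightarrow> Y \<in> L2 M \<Longrightarrow> integrable M (\<lambda>w. X w * cnj (Y w))"
  by (rule L2_mult_integrable[OF _ L2_cnj])

lemma nrm_nonneg: "0 \<le> nrm M X" by (simp add: nrm_def)

lemma nrm_sq: "(nrm M X)\<^sup>2 = (LINT w|M. (cmod (X w))\<^sup>2)" by (simp add: nrm_def)

lemma ip_self: "ip M X X = of_real ((nrm M X)\<^sup>2)"
  unfolding ip_def nrm_sq by (simp add: complex_norm_square[symmetric] del: of_real_power)

lemma ip_commute: "ip M Y X = cnj (ip M X Y)"
  unfolding ip_def by (subst Bochner_Integration.integral_cnj[symmetric]) (simp add: mult.commute)

lemma ip_add_left: "X \<in> L2 M \<Longrightarrow> X' \<in> L2 M \<Longrightarrow> Y \<in> L2 M \<Longrightarrow>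
    ip M (\<lambda>w. X w + X' w) Y = ip M X Y + ip M X' Y"
  unfolding ip_def by (simp add: distrib_right ip_integrable)

lemma ip_diff_left: "X \<in> L2 M \<Longrightarrow> X' \<in> L2 M \<Longrightarrow> Y \<in> L2 M \<Longrightarrow>
    ip M (\<lambda>w. X w - X' w) Y = ip M X Y - ip M X' Y"
  unfolding ip_def by (simp add: left_diff_distrib ip_integrable)

lemma ip_diff_right: "X \<in> L2 M \<Longrightarrow> X' \<in> L2 M \<Longrightarrow> Y \<in> L2 M \<Longrightarrow>
    ip M Y (\<lambda>w. X w - X' w) = ip M Y X - ip M Y X'"
  unfolding ip_commute[where Y = Y] by (simp add: ip_diff_left)

lemma ip_add_right: "X \<in> L2 M \<Longrightarrow> X' \<in> L2 M \<Longrightarrow> Y \<in> L2 M \<Longrightarrow>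
    ip M Y (\<lambda>w. X w + X' w) = ip M Y X + ip M Y X'"
  unfolding ip_commute[where Y = Y] by (simp add: ip_add_left)

lemma ip_mult_left: "ip M (\<lambda>w. b * X w) Y = b * ip M X Y"
  unfolding ip_def by (simp add: mult.assoc)

lemma ip_mult_right: "ip M Y (\<lambda>w. b * X w) = cnj b * ip M Y X"
  unfolding ip_commute[where Y = Y] by (simp add: ip_mult_left)

lemma ip_sum_left: "(\<And>i. i \<in> J \<Longrightarrow> X i \<in> L2 M) \<Longrightarrow> Y \<in> L2 M \<Longrightarrow>
    ip M (\<lambda>w. \<Sum>i\<in>J. b i * X i w) Y = (\<Sum>i\<in>J. b i * ip M (X i) Y)"
  by (induction J rule: infinite_finite_induct)
     (auto simp: ip_add_left L2_mult_left L2_sum ip_mult_left, simp_all add: ip_def)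

lemma ip_sum_right: "(\<And>i. i \<in> J \<Longrightarrow> X i \<in> L2 M) \<Longrightarrow> Y \<in> L2 M \<Longrightarrow>
    ip M Y (\<lambda>w. \<Sum>i\<in>J. b i * X i w) = (\<Sum>i\<in>J. cnj (b i) * ip M Y (X i))"
  by (subst ip_commute, subst ip_sum_left) (auto simp: ip_commute[of M Y] intro!: sum.cong)

lemma cauchy_schwarz:
  assumes "X \<in> L2 M" "Y \<in> L2 M" shows "cmod (ip M X Y) \<le> nrm M X * nrm M Y"
proof -
  have [measurable]: "X \<in> borel_measurable M" "Y \<in> borel_measurable M" using assms by (auto simp: L2_def)
  have i: "integrable M (\<lambda>w. cmod (X w) * cmod (Y w))"
    using integrable_norm[OF ip_integrable[OF assms]] by (simp add: norm_mult)
  have "cmod (ip M X Y) \<le> (LINT w|M. cmod (X w) * cmod (Y w))"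
    unfolding ip_def by (rule order_trans[OF integral_norm_bound]) (simp add: norm_mult)
  \<comment> \<open>The inequality for nonnegative integrals, applied to the moduli in
    \<open>ennreal\<close> and brought back to Bochner integrals by the three integrability
    facts.\<close>
  moreover have "(LINT w|M. cmod (X w) * cmod (Y w))\<^sup>2 \<le> (nrm M X)\<^sup>2 * (nrm M Y)\<^sup>2"
  proof -
    have "(\<integral>\<^sup>+w. ennreal (cmod (X w)) * ennreal (cmod (Y w)) \<partial>M)\<^sup>2
       \<le> (\<integral>\<^sup>+w. ennreal (cmod (X w))^2 \<partial>M) * (\<integral>\<^sup>+w. ennreal (cmod (Y w))^2 \<partial>M)"
      by (rule Cauchy_Schwarz_nn_integral) auto
    also have "(\<integral>\<^sup>+w. ennreal (cmod (X w)) * ennreal (cmod (Y w)) \<partial>M) = ennreal (LINT w|M. cmod (X w) * cmod (Y w))"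
      using i by (subst nn_integral_eq_integral[symmetric]) (auto simp: ennreal_mult)
    also have "(\<integral>\<^sup>+w. ennreal (cmod (X w))^2 \<partial>M) = ennreal ((nrm M X)\<^sup>2)"
      unfolding nrm_sq using L2_integrable[OF assms(1)]
      by (subst nn_integral_eq_integral[symmetric]) (auto simp: ennreal_power)
    also have "(\<integral>\<^sup>+w. ennreal (cmod (Y w))^2 \<partial>M) = ennreal ((nrm M Y)\<^sup>2)"
      unfolding nrm_sq using L2_integrable[OF assms(2)]
      by (subst nn_integral_eq_integral[symmetric]) (auto simp: ennreal_power)
    finally show ?thesis
      by (simp add: ennreal_mult[symmetric] ennreal_power integral_nonneg_AE)
  qed
  then have "(LINT w|M. cmod (X w) * cmod (Y w)) \<le> nrm M X * nrm M Y"
    by (simp add: power_mult_distrib[symmetric]) (simp add: abs_le_square_iff[symmetric] nrm_nonneg abs_mult)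
  ultimately show ?thesis by linarith
qed

lemma nrm_add_sq:
  assumes "X \<in> L2 M" "Y \<in> L2 M"
  shows "(nrm M (\<lambda>w. X w + Y w))\<^sup>2 = (nrm M X)\<^sup>2 + 2 * Re (ip M X Y) + (nrm M Y)\<^sup>2"
proof -
  have "of_real ((nrm M (\<lambda>w. X w + Y w))\<^sup>2) = ip M X X + ip M X Y + (ip M Y X + ip M Y Y)"
    unfolding ip_self[symmetric] by (simp add: ip_add_left ip_add_right assms L2_add)
  then have "Re (of_real ((nrm M (\<lambda>w. X w + Y w))\<^sup>2)) = Re (ip M X X + ip M X Y + (ip M Y X + ip M Y Y))"
    by simp
  then show ?thesis by (simp add: ip_self ip_commute[of M Y X] del: of_real_power)
qed

lemma nrm_triangle:
  assumes "X \<in> L2 M" "Y \<in> L2 M"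
  shows "nrm M (\<lambda>w. X w + Y w) \<le> nrm M X + nrm M Y"
proof (rule power2_le_imp_le)
  have "Re (ip M X Y) \<le> nrm M X * nrm M Y"
    using cauchy_schwarz[OF assms] complex_Re_le_cmod order_trans by blast
  then show "(nrm M (\<lambda>w. X w + Y w))\<^sup>2 \<le> (nrm M X + nrm M Y)\<^sup>2"
    unfolding nrm_add_sq[OF assms] by (simp add: power2_sum)
qed (simp add: nrm_nonneg)

lemma nrm_mult_left: "nrm M (\<lambda>w. b * X w) = cmod b * nrm M X"
  by (simp add: nrm_def norm_mult power_mult_distrib real_sqrt_mult)

lemma nrm_minus_commute: "nrm M (\<lambda>w. X w - Y w) = nrm M (\<lambda>w. Y w - X w)"
  by (simp add: nrm_def norm_minus_commute)

lemma nrm_triangle_diff: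
  assumes "X \<in> L2 M" "Y \<in> L2 M" "Z \<in> L2 M"
  shows "nrm M (\<lambda>w. X w - Z w) \<le> nrm M (\<lambda>w. X w - Y w) + nrm M (\<lambda>w. Y w - Z w)"
  using nrm_triangle[OF L2_diff[OF assms(1,2)] L2_diff[OF assms(2,3)]] by simp

lemma nrm_diff_le:
  assumes "X \<in> L2 M" "Y \<in> L2 M"
  shows "\<bar>nrm M X - nrm M Y\<bar> \<le> nrm M (\<lambda>w. X w - Y w)"
  using nrm_triangle[OF L2_diff[OF assms] assms(2)] nrm_triangle[OF L2_diff[OF assms(2,1)] assms(1)]
  by (simp add: nrm_minus_commute[of M Y X])

lemma nrm_cong_AE: "X \<in> borel_measurable M \<Longrightarrow> Y \<in> borel_measurable M \<Longrightarrow>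
  AE w in M. X w = Y w \<Longrightarrow> nrm M X = nrm M Y"
  unfolding nrm_def by (auto intro!: integral_cong_AE)

lemma nrm_eq_0:
  assumes "X \<in> L2 M" shows "nrm M X = 0 \<longleftrightarrow> (AE w in M. X w = 0)"
  using integral_nonneg_eq_0_iff_AE[OF L2_integrable[OF assms]] by (simp add: nrm_def)

lemma nn_integral_nrm:
  "X \<in> L2 M \<Longrightarrow> (\<integral>\<^sup>+w. ennreal ((cmod (X w))\<^sup>2) \<partial>M) = ennreal ((nrm M X)\<^sup>2)"
  unfolding nrm_sq by (rule nn_integral_eq_integral) (auto simp: L2_integrable)

lemma L2_tendsto_iff:
  assumes "\<And>n. X n \<in> L2 M" "Y \<in> L2 M"
  shows "L2_tendsto M X Y \<longleftrightarrow> L2_lim M X Y"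
proof -
  have "L2_tendsto M X Y \<longleftrightarrow> (\<lambda>n. ennreal ((nrm M (\<lambda>w. X n w - Y w))\<^sup>2)) \<longlonglongrightarrow> ennreal 0"
    unfolding L2_tendsto_def by (simp add: nn_integral_nrm L2_diff assms)
  also have "\<dots> \<longleftrightarrow> (\<lambda>n. (nrm M (\<lambda>w. X n w - Y w))\<^sup>2) \<longlonglongrightarrow> 0"
    by (rule tendsto_ennreal_iff) auto
  also have "\<dots> \<longleftrightarrow> L2_lim M X Y"
    by simp
  finally show ?thesis .
qed

lemma nrm_tendsto:
  assumes "\<And>n. X n \<in> L2 M" "Y \<in> L2 M" "L2_lim M X Y"
  shows "(\<lambda>n. nrm M (X n)) \<longlonglongrightarrow> nrm M Y"
proof -
  have "(\<lambda>n. nrm M (X n) - nrm M Y) \<longlonglongrightarrow> 0"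
    by (rule Lim_null_comparison[OF _ assms(3)]) (use nrm_diff_le[OF assms(1,2)] in auto)
  then show ?thesis by (simp add: LIM_zero_iff)
qed

lemma ip_tendsto:
  assumes "\<And>n. X n \<in> L2 M" "Y \<in> L2 M" "L2_lim M X Y" "V \<in> L2 M"
  shows "(\<lambda>n. ip M (X n) V) \<longlonglongrightarrow> ip M Y V"
proof -
  have "(\<lambda>n. ip M (X n) V - ip M Y V) \<longlonglongrightarrow> 0"
  proof (rule Lim_null_comparison)
    show "\<forall>\<^sub>F n in sequentially. norm (ip M (X n) V - ip M Y V) \<le> nrm M (\<lambda>w. X n w - Y w) * nrm M V"
      using cauchy_schwarz[OF L2_diff[OF assms(1,2)] assms(4)] by (simp add: ip_diff_left assms)
    show "(\<lambda>n. nrm M (\<lambda>w. X n w - Y w) * nrm M V) \<longlonglongrightarrow> 0"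
      using tendsto_mult_right[OF assms(3), of "nrm M V"] by simp
  qed
  then show ?thesis by (simp add: LIM_zero_iff)
qed

lemma L2_lim_unique:
  assumes "\<And>n. X n \<in> L2 M" "Y \<in> L2 M" "Y' \<in> L2 M" 
    "L2_lim M X Y" "L2_lim M X Y'"
  shows "AE w in M. Y w = Y' w"
proof -
  have "nrm M (\<lambda>w. Y w - Y' w) \<le> 0"
  proof (rule LIMSEQ_le[OF tendsto_const])
    show "(\<lambda>n. nrm M (\<lambda>w. X n w - Y w) + nrm M (\<lambda>w. X n w - Y' w)) \<longlonglongrightarrow> 0"
      using tendsto_add[OF assms(4,5)] by simp
    show "\<exists>N. \<forall>n\<ge>N. nrm M (\<lambda>w. Y w - Y' w) \<le> nrm M (\<lambda>w. X n w - Y w) + nrm M (\<lambda>w. X n w - Y' w)"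
      using nrm_triangle_diff[OF assms(2,1,3)] by (simp add: nrm_minus_commute[of M Y])
  qed
  then have "nrm M (\<lambda>w. Y w - Y' w) = 0" using nrm_nonneg[of M] order.antisym by blast
  then show ?thesis by (simp add: nrm_eq_0 L2_diff assms)
qed

text \<open>Both squared norms are the same quadratic form in the coefficients, up to \<kappa>. With
  \<open>\<kappa> = 1 / (2 * pi)\<close> this transfers norms between random variables and functions
  of frequency when only covariances are known.\<close>

lemma gram_isometry:
  assumes "\<And>i. i \<in> J \<Longrightarrow> u i \<in> L2 P" "\<And>i. i \<in> J \<Longrightarrow> v i \<in> L2 M"
    and "\<And>i j. i \<in> J \<Longrightarrow> j \<in> J \<Longrightarrow> ip P (u i) (u j) = of_real \<kappa> * ip M (v i) (v j)"
  shows "(nrm P (\<lambda>w. \<Sum>i\<in>J. b i * u i w))\<^sup>2 = \<kappa> * (nrm M (\<lambda>w. \<Sum>i\<in>J. b i * v i w))\<^sup>2"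
proof -
  have 1: "(\<lambda>w. \<Sum>i\<in>J. b i * u i w) \<in> L2 P" "(\<lambda>w. \<Sum>i\<in>J. b i * v i w) \<in> L2 M"
    by (auto intro!: L2_sum L2_mult_left assms)
  have "of_real ((nrm P (\<lambda>w. \<Sum>i\<in>J. b i * u i w))\<^sup>2) = (\<Sum>i\<in>J. b i * (\<Sum>j\<in>J. cnj (b j) * ip P (u i) (u j)))"
    unfolding ip_self[symmetric] by (simp add: ip_sum_left ip_sum_right assms 1 cong: sum.cong)
  also have "\<dots> = of_real \<kappa> * (\<Sum>i\<in>J. b i * (\<Sum>j\<in>J. cnj (b j) * ip M (v i) (v j)))"
    by (simp add: assms sum_distrib_left mult_ac cong: sum.cong)
  also have "\<dots> = of_real \<kappa> * of_real ((nrm M (\<lambda>w. \<Sum>i\<in>J. b i * v i w))\<^sup>2)"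
    unfolding ip_self[symmetric] by (simp add: ip_sum_left ip_sum_right assms 1 cong: sum.cong)
  finally have "complex_of_real ((nrm P (\<lambda>w. \<Sum>i\<in>J. b i * u i w))\<^sup>2)
      = of_real (\<kappa> * (nrm M (\<lambda>w. \<Sum>i\<in>J. b i * v i w))\<^sup>2)"
    by (simp only: of_real_mult)
  then show ?thesis by (simp only: of_real_eq_iff)
qed

text \<open>The limit inherits the bound \<open>b * cmod (Z w)\<close>, so the squared differences
  are dominated by \<open>4 * b\<^sup>2 * (cmod (Z w))\<^sup>2\<close>.\<close>

lemma L2_dominated:
  assumes "\<And>n. X n \<in> borel_measurable M" "Y \<in> borel_measurable M" "Z \<in> L2 M"
    "\<And>n. AE w in M. cmod (X n w) \<le> b * cmod (Z w)" "AE w in M. (\<lambda>n. X n w) \<longlonglongrightarrow> Y w"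
  shows "\<And>n. X n \<in> L2 M" "Y \<in> L2 M" "L2_lim M X Y"
proof -
  have [measurable]: "\<And>n. X n \<in> borel_measurable M" "Y \<in> borel_measurable M" "Z \<in> borel_measurable M"
    using assms by (auto simp: L2_def)
  show X: "X n \<in> L2 M" for n by (rule L2_bound[OF assms(3,1,4)])
  have allb: "AE w in M. \<forall>n. cmod (X n w) \<le> b * cmod (Z w)" using assms(4) by (simp add: AE_all_countable)
  have Yb: "AE w in M. cmod (Y w) \<le> b * cmod (Z w)"
    using allb assms(5)
    by eventually_elim (auto intro: LIMSEQ_le_const2 tendsto_norm)
  show Y: "Y \<in> L2 M" by (rule L2_bound[OF assms(3) _ Yb]) simp
  have "(\<lambda>n. LINT w|M. (cmod (X n w - Y w))\<^sup>2) \<longlonglongrightarrow> (LINT w|M. 0)"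
  proof (rule integral_dominated_convergence)
    show "integrable M (\<lambda>w. 4 * b\<^sup>2 * (cmod (Z w))\<^sup>2)" using L2_integrable[OF assms(3)] by simp
    show "AE w in M. (\<lambda>n. (cmod (X n w - Y w))\<^sup>2) \<longlonglongrightarrow> 0"
      using assms(5)
    proof eventually_elim
      case (elim w)
      then have "(\<lambda>n. X n w - Y w) \<longlonglongrightarrow> 0" by (simp add: LIM_zero_iff)
      then show ?case using tendsto_power[OF tendsto_norm_zero, of _ sequentially 2] by simp
    qed
    show "AE w in M. norm ((cmod (X n w - Y w))\<^sup>2) \<le> 4 * b\<^sup>2 * (cmod (Z w))\<^sup>2" for n
      using allb Yb
    proof eventually_elim
      case (elim w)
      have "cmod (X n w - Y w) \<le> 2 * (b * cmod (Z w))"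
        using norm_triangle_ineq4[of "X n w" "Y w"] elim(1)[rule_format, of n] elim(2) by linarith
      then have "(cmod (X n w - Y w))\<^sup>2 \<le> (2 * (b * cmod (Z w)))\<^sup>2" by (rule power_mono) simp
      then show ?case by (simp add: power_mult_distrib)
    qed
  qed simp_all
  then have "(\<lambda>n. (nrm M (\<lambda>w. X n w - Y w))\<^sup>2) \<longlonglongrightarrow> 0" by (simp add: nrm_sq)
  then show "L2_lim M X Y" by simp
qed

lemma L2_simple_approximation:
  assumes "X \<in> L2 M"
  obtains F where "\<And>n. simple_function M (F n)" "\<And>n. F n \<in> L2 M" "L2_lim M F X"
proof -
  have X: "X \<in> borel_measurable M" using assms by (simp add: L2_def)
  from borel_measurable_implies_sequence_metric[OF X, of 0] obtain F where
    F: "\<And>i. simple_function M (F i)" "\<And>x. x \<in> space M \<Longrightarrow> (\<lambda>i. F i x) \<longlonglongrightarrow> X x"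
      "\<And>i x. x \<in> space M \<Longrightarrow> dist (F i x) 0 \<le> 2 * dist (X x) 0" by blast
  have m: "F i \<in> borel_measurable M" for i using F(1) borel_measurable_simple_function by blast
  have "\<And>n. AE w in M. cmod (F n w) \<le> 2 * cmod (X w)" "AE w in M. (\<lambda>n. F n w) \<longlonglongrightarrow> X w"
    using F(2,3) by auto
  from L2_dominated[OF m X assms this] show ?thesis using that F(1) by blast
qed

text \<open>Riesz-Fischer: a subsequence with geometrically small steps converges almost everywhere,
  and Fatou's lemma shows that its pointwise limit is the limit in mean of the whole
  sequence.\<close>

theorem L2_complete:
  assumes X: "\<And>n. X n \<in> L2 M"
    and C: "\<And>e. e > 0 \<Longrightarrow> \<exists>N. \<forall>m\<ge>N. \<forall>n\<ge>N. nrm M (\<lambda>w. X m w - X n w) < e"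
  obtains Y where "Y \<in> L2 M" "L2_lim M X Y"
proof -
  have [measurable]: "\<And>n. X n \<in> borel_measurable M" using X by (auto simp: L2_def)
  have "\<exists>r. strict_mono (r::nat\<Rightarrow>nat) \<and> (\<forall>k. \<forall>m\<ge>r k. \<forall>n\<ge>r k. nrm M (\<lambda>w. X m w - X n w) < (1/2)^k)"
  proof -
    define Q where "Q k n \<longleftrightarrow> (\<forall>m\<ge>n. \<forall>n'\<ge>n. nrm M (\<lambda>w. X m w - X n' w) < (1/2)^k)" for k n
    have ex: "\<exists>n. Q k n" for k unfolding Q_def using C[of "(1/2)^k"] by auto
    have "\<exists>r. \<forall>k. Q k (r k) \<and> r k < r (Suc k)"
    proof (rule dependent_nat_choice)
      show "\<exists>x. Q 0 x" by (rule ex)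
      fix x n assume "Q n x"
      obtain y where "Q (Suc n) y" using ex by blast
      then have "Q (Suc n) (max y (Suc x))" unfolding Q_def by auto
      then show "\<exists>y. Q (Suc n) y \<and> x < y" by (intro exI[of _ "max y (Suc x)"]) auto
    qed
    then show ?thesis unfolding Q_def strict_mono_Suc_iff by blast
  qed
  then obtain r :: "nat \<Rightarrow> nat" where r: "strict_mono r"
    "\<And>k m n. m \<ge> r k \<Longrightarrow> n \<ge> r k \<Longrightarrow> nrm M (\<lambda>w. X m w - X n w) < (1/2)^k" by blast
  define d where "d k w = cmod (X (r (Suc k)) w - X (r k) w)" for k w
  have [measurable]: "d k \<in> borel_measurable M" for k unfolding d_def by simp
  have dk: "(\<integral>\<^sup>+w. ennreal ((d k w)\<^sup>2) \<partial>M) \<le> ennreal ((1/4)^k)" for k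
  proof -
    have "(\<integral>\<^sup>+w. ennreal ((d k w)\<^sup>2) \<partial>M) = ennreal ((nrm M (\<lambda>w. X (r (Suc k)) w - X (r k) w))\<^sup>2)"
      unfolding d_def by (rule nn_integral_nrm[OF L2_diff[OF X X]])
    also have "\<dots> \<le> ennreal (((1/2)^k)\<^sup>2)"
    proof -
      have "nrm M (\<lambda>w. X (r (Suc k)) w - X (r k) w) < (1/2)^k"
        using r(1) by (intro r(2)) (auto simp: strict_mono_less_eq)
      then show ?thesis by (intro ennreal_leI power_mono) (auto simp: nrm_nonneg)
    qed
    also have "((1/2)^k)\<^sup>2 = (1/4::real)^k" by (simp add: power2_eq_square flip: power_mult_distrib)
    finally show ?thesis .
  qed
  \<comment> \<open>The weight \<open>2^k\<close> is a compromise: against \<open>(1/4)^k\<close> it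
    leaves a summable series, and finiteness of the weighted sum at a point forces
    \<open>d k w\<close> below a multiple of \<open>(1 / sqrt 2)^k\<close>. So squares alone give
    pointwise convergence, also when \<open>M\<close> has infinite measure.\<close>
  have "(\<integral>\<^sup>+w. (\<Sum>k. ennreal (2^k * (d k w)\<^sup>2)) \<partial>M) = (\<Sum>k. \<integral>\<^sup>+w. ennreal (2^k * (d k w)\<^sup>2) \<partial>M)"
    by (rule nn_integral_suminf) simp
  also have "\<dots> \<le> (\<Sum>k. ennreal ((1/2)^k))"
  proof (intro suminf_le summableI)
    fix k
    have "(\<integral>\<^sup>+w. ennreal (2^k * (d k w)\<^sup>2) \<partial>M) = ennreal (2^k) * (\<integral>\<^sup>+w. ennreal ((d k w)\<^sup>2) \<partial>M)"
      by (subst nn_integral_cmult[symmetric]) (auto simp: ennreal_mult)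
    also have "\<dots> \<le> ennreal (2^k) * ennreal ((1/4)^k)" by (rule mult_left_mono[OF dk]) simp
    also have "\<dots> = ennreal ((1/2)^k)"
      by (subst ennreal_mult[symmetric]) (auto simp: power_mult_distrib[symmetric])
    finally show "(\<integral>\<^sup>+w. ennreal (2^k * (d k w)\<^sup>2) \<partial>M) \<le> ennreal ((1/2)^k)" .
  qed
  also have "\<dots> = ennreal (\<Sum>k. (1/2)^k)"
    by (rule suminf_ennreal2) (simp, intro summable_geometric, simp)
  also have "\<dots> < \<infinity>" by (simp only: ennreal_less_top infinity_ennreal_def)
  finally have "AE w in M. (\<Sum>k. ennreal (2^k * (d k w)\<^sup>2)) \<noteq> \<infinity>"
    by (intro nn_integral_noteq_infinite) auto
  then have conv: "AE w in M. convergent (\<lambda>k. X (r k) w)"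
  proof eventually_elim
    case (elim w)
    then have s: "summable (\<lambda>k. 2^k * (d k w)\<^sup>2)"
      by (intro summable_suminf_not_top) auto
    then have "(\<lambda>k. 2^k * (d k w)\<^sup>2) \<longlonglongrightarrow> 0" by (rule summable_LIMSEQ_zero)
    then have "Bseq (\<lambda>k. 2^k * (d k w)\<^sup>2)" by (intro convergent_imp_Bseq convergentI)
    then obtain B where B: "B > 0" "\<And>k. norm (2^k * (d k w)\<^sup>2) \<le> B" unfolding Bseq_def by auto
    have dle: "d k w \<le> sqrt B * (1 / sqrt 2)^k" for k
    proof (rule power2_le_imp_le)
      have "2^k * (d k w)\<^sup>2 \<le> B" using B(2)[of k] by simp
      then have "(d k w)\<^sup>2 \<le> B * (1/2)^k" by (simp add: field_simps)
      also have "(1/2)^k = ((1 / sqrt 2)^k)\<^sup>2"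
        by (simp add: power2_eq_square flip: power_mult_distrib)
      also have "B * ((1 / sqrt 2)^k)\<^sup>2 = (sqrt B * (1 / sqrt 2)^k)\<^sup>2"
        using B(1) by (simp add: power_mult_distrib)
      finally show "(d k w)\<^sup>2 \<le> (sqrt B * (1 / sqrt 2)^k)\<^sup>2" .
    qed (use B in simp)
    have "summable (\<lambda>k. X (r (Suc k)) w - X (r k) w)"
    proof (rule summable_comparison_test')
      show "summable (\<lambda>k. sqrt B * (1 / sqrt 2)^k)" by (intro summable_mult summable_geometric) simp
      show "norm (X (r (Suc k)) w - X (r k) w) \<le> sqrt B * (1 / sqrt 2)^k" for k
        using dle[of k] by (simp add: d_def)
    qed
    then have "convergent (\<lambda>n. \<Sum>k<n. X (r (Suc k)) w - X (r k) w)" by (simp add: summable_iff_convergent)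
    then have "convergent (\<lambda>n. X (r n) w - X (r 0) w)" by (subst (asm) sum_lessThan_telescope)
    then have "convergent (\<lambda>n. (X (r n) w - X (r 0) w) + X (r 0) w)"
      by (intro convergent_add convergent_const)
    then show ?case by simp
  qed
  define Y where "Y w = lim (\<lambda>k. X (r k) w)" for w
  have Ym [measurable]: "Y \<in> borel_measurable M" unfolding Y_def by measurable
  have lim: "AE w in M. (\<lambda>k. X (r k) w) \<longlonglongrightarrow> Y w"
    using conv by eventually_elim (simp add: Y_def convergent_LIMSEQ_iff)
  \<comment> \<open>Fatou along the subsequence with \<open>m\<close> fixed. As \<open>m\<close>
    need not belong to the subsequence, this yields both that \<open>Y\<close> is in
    \<open>L2 M\<close> and that the full sequence converges.\<close>
  have fat: "(\<integral>\<^sup>+w. ennreal ((cmod (X m w - Y w))\<^sup>2) \<partial>M) \<le> ennreal (((1/2)^k)\<^sup>2)" if m: "m \<ge> r k" for m k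
  proof -
    have "(\<integral>\<^sup>+w. ennreal ((cmod (X m w - Y w))\<^sup>2) \<partial>M) 
        = (\<integral>\<^sup>+w. liminf (\<lambda>j. ennreal ((cmod (X m w - X (r j) w))\<^sup>2)) \<partial>M)"
    proof (rule nn_integral_cong_AE)
      show "AE w in M. ennreal ((cmod (X m w - Y w))\<^sup>2) = liminf (\<lambda>j. ennreal ((cmod (X m w - X (r j) w))\<^sup>2))"
        using lim
      proof eventually_elim
        case (elim w)
        then have "(\<lambda>j. ennreal ((cmod (X m w - X (r j) w))\<^sup>2)) \<longlonglongrightarrow> ennreal ((cmod (X m w - Y w))\<^sup>2)"
          by (intro tendsto_intros)
        then show ?case by (intro lim_imp_Liminf[symmetric]) auto
      qed
    qed
    also have "\<dots> \<le> liminf (\<lambda>j. (\<integral>\<^sup>+w. ennreal ((cmod (X m w - X (r j) w))\<^sup>2) \<partial>M))"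
      by (rule nn_integral_liminf) simp
    also have "\<dots> \<le> ennreal (((1/2)^k)\<^sup>2)"
    proof (rule Liminf_le)
      show "\<forall>\<^sub>F j in sequentially. (\<integral>\<^sup>+w. ennreal ((cmod (X m w - X (r j) w))\<^sup>2) \<partial>M) \<le> ennreal (((1/2)^k)\<^sup>2)"
        using eventually_ge_at_top[of k]
      proof eventually_elim
        case (elim j)
        have "nrm M (\<lambda>w. X m w - X (r j) w) < (1/2)^k" using r(1) elim m 
          by (intro r) (auto simp: strict_mono_less_eq)
        then show ?case
          by (simp only: nn_integral_nrm[OF L2_diff[OF X X]]) (intro ennreal_leI power_mono, auto simp: nrm_nonneg)
      qed
    qed simp
    finally show ?thesis .
  qed
  have "integrable M (\<lambda>w. (cmod (X (r 0) w - Y w))\<^sup>2)"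
    using fat[of 0 "r 0"] by (intro integrableI_bounded) (auto intro: order.strict_trans1)
  then have "(\<lambda>w. X (r 0) w - Y w) \<in> L2 M" by (intro L2I) simp_all
  from L2_diff[OF X[of "r 0"] this] have Y: "Y \<in> L2 M" by simp
  have nle: "nrm M (\<lambda>w. X m w - Y w) \<le> (1/2)^k" if "m \<ge> r k" for m k
  proof -
    have "(nrm M (\<lambda>w. X m w - Y w))\<^sup>2 \<le> ((1/2)^k)\<^sup>2"
      using fat[OF that] by (simp only: nn_integral_nrm[OF L2_diff[OF X Y]]) simp
    then show ?thesis by (rule power2_le_imp_le) simp
  qed
  have "L2_lim M X Y"
  proof (rule LIMSEQ_I)
    fix e :: real assume "e > 0"
    then obtain k where k: "(1/2)^k < e" using real_arch_pow_inv[of e "1/2"] by auto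
    show "\<exists>no. \<forall>n\<ge>no. norm (nrm M (\<lambda>w. X n w - Y w) - 0) < e"
    proof (intro exI allI impI)
      fix n assume "n \<ge> r k"
      then show "norm (nrm M (\<lambda>w. X n w - Y w) - 0) < e" using nle[of k n] k nrm_nonneg[of M "\<lambda>w. X n w - Y w"] by auto
    qed
  qed
  with Y show ?thesis using that by blast
qed

section \<open>The Fourier transform on the line\<close>

lemma borel_measurable_cis [measurable]:
  "h \<in> borel_measurable M \<Longrightarrow> (\<lambda>x. cis (h x)) \<in> borel_measurable M"
  by (rule borel_measurable_continuous_on[of cis]) (auto intro: continuous_intros)

text \<open>The integrand is dominated by \<open>C\<close> times a product of two integrable
  functions of one variable each. Nearly every exchange of integrals below is an instance, mostly
  with a \<open>cis\<close> kernel and \<open>C = 1\<close>.\<close>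

lemma fubini_bounded_kernel:
  fixes a b :: "real \<Rightarrow> complex" and k :: "real \<Rightarrow> real \<Rightarrow> complex"
  assumes a: "integrable lborel a" and b: "integrable lborel b"
    and [measurable]: "(\<lambda>(x, y). k x y) \<in> borel_measurable (lborel \<Otimes>\<^sub>M lborel)"
    and k: "\<And>x y. cmod (k x y) \<le> C"
  shows "(LBINT x. a x * (LBINT y. b y * k x y)) = (LBINT y. b y * (LBINT x. a x * k x y))"
    and "integrable (lborel \<Otimes>\<^sub>M lborel) (\<lambda>(x, y). a x * b y * k x y)"
proof -
  have [measurable]: "a \<in> borel_measurable lborel" "b \<in> borel_measurable lborel"
    using a b by auto
  have C: "0 \<le> C" using k[of 0 0] norm_ge_zero order_trans by blast
  have bk: "integrable lborel (\<lambda>y. b y * k x y)" for x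
    by (rule Bochner_Integration.integrable_bound[OF integrable_mult_right[OF integrable_norm[OF b], of C]])
       (auto simp: norm_mult C mult.commute[of C] intro!: mult_left_mono k)
  show int: "integrable (lborel \<Otimes>\<^sub>M lborel) (\<lambda>(x, y). a x * b y * k x y)"
  proof (rule lborel_pair.Fubini_integrable)
    show "(\<lambda>(x, y). a x * b y * k x y) \<in> borel_measurable (lborel \<Otimes>\<^sub>M lborel)" by measurable
    show "integrable lborel (\<lambda>x. LBINT y. cmod (case (x, y) of (x, y) \<Rightarrow> a x * b y * k x y))"
    proof (rule Bochner_Integration.integrable_bound)
      show "integrable lborel (\<lambda>x. (C * (LBINT y. cmod (b y))) * cmod (a x))"
        using a by simp
      have le: "(LBINT y. cmod (a x * b y * k x y)) \<le> (C * (LBINT y. cmod (b y))) * cmod (a x)" for x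
      proof -
        have "(LBINT y. cmod (a x * b y * k x y)) \<le> (LBINT y. C * cmod (a x) * cmod (b y))"
        proof (rule integral_mono)
          show "integrable lborel (\<lambda>y. cmod (a x * b y * k x y))"
            using integrable_norm[OF integrable_mult_right[OF bk, of "a x" x]] by (simp add: mult.assoc)
          show "cmod (a x * b y * k x y) \<le> C * cmod (a x) * cmod (b y)" for y
            using mult_left_mono[OF k[of x y], of "cmod (a x) * cmod (b y)"]
            by (simp add: norm_mult mult_ac)
        qed (use b in simp)
        then show ?thesis by (simp add: mult_ac)
      qed
      show "AE x in lborel. norm (LBINT y. cmod (case (x, y) of (x, y) \<Rightarrow> a x * b y * k x y))
          \<le> norm (C * (LBINT y. cmod (b y)) * cmod (a x))"
        using le C by (auto intro!: AE_I2 simp: abs_mult integral_nonneg_AE)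
    qed measurable
    show "AE x in lborel. integrable lborel (\<lambda>y. case (x, y) of (x, y) \<Rightarrow> a x * b y * k x y)"
      using integrable_mult_right[OF bk] by (simp add: mult.assoc)
  qed
  have "(LBINT x. a x * (LBINT y. b y * k x y)) = (LBINT x. LBINT y. a x * b y * k x y)"
    by (simp add: mult.assoc)
  also have "\<dots> = (LBINT y. LBINT x. a x * b y * k x y)"
    using lborel_pair.Fubini_integral[OF int] by simp
  also have "\<dots> = (LBINT y. b y * (LBINT x. a x * k x y))"
    by (simp add: mult_ac flip: integral_mult_right_zero)
  finally show "(LBINT x. a x * (LBINT y. b y * k x y)) = (LBINT y. b y * (LBINT x. a x * k x y))" .
qed

text \<open>The exponent is positive and there is no normalising factor, so \<open>2 * pi\<close>
  appears in Plancherel's identity and \<open>ift\<close> carries the whole factor. For a function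
  that is not integrable the value is the default 0.\<close>

definition ft :: "(real \<Rightarrow> complex) \<Rightarrow> real \<Rightarrow> complex" where
  "ft \<phi> l = (LBINT t. \<phi> t * cis (t * l))"

lemma ft_measurable [measurable]:
  assumes "\<phi> \<in> borel_measurable borel" shows "ft \<phi> \<in> borel_measurable borel"
proof -
  have [measurable]: "\<phi> \<in> borel_measurable lborel" using assms by simp
  have "ft \<phi> \<in> borel_measurable lborel" unfolding ft_def by measurable
  then show ?thesis by simp
qed

lemma integrable_mult_bounded:
  fixes \<phi> k :: "real \<Rightarrow> complex"
  assumes "integrable lborel \<phi>" "k \<in> borel_measurable borel" "\<And>x. cmod (k x) \<le> B"
  shows "integrable lborel (\<lambda>x. \<phi> x * k x)"
proof (rule Bochner_Integration.integrable_bound)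
  show "integrable lborel (\<lambda>x. B * cmod (\<phi> x))" using assms(1) by simp
  have "cmod (\<phi> x) * cmod (k x) \<le> \<bar>B\<bar> * cmod (\<phi> x)" for x
    using mult_left_mono[OF order_trans[OF assms(3) abs_ge_self], of "cmod (\<phi> x)" x] by (simp add: mult.commute)
  then show "AE x in lborel. norm (\<phi> x * k x) \<le> norm (B * cmod (\<phi> x))"
    by (auto simp: norm_mult abs_mult)
qed (use assms in measurable)

lemma ft_integrable: "integrable lborel \<phi> \<Longrightarrow> integrable lborel (\<lambda>t. \<phi> t * cis (t * l))"
  by (rule integrable_mult_bounded[where B=1]) auto

lemma ft_bound: "integrable lborel \<phi> \<Longrightarrow> cmod (ft \<phi> l) \<le> (LBINT t. cmod (\<phi> t))"
  unfolding ft_def by (rule order_trans[OF integral_norm_bound]) (simp add: norm_mult)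

lemma ft_continuous:
  assumes "integrable lborel \<phi>" shows "continuous_on UNIV (ft \<phi>)"
proof -
  have "isCont (ft \<phi>) l" for l
  proof (rule continuous_at_sequentiallyI)
    fix u assume u: "u \<longlonglongrightarrow> l"
    show "(\<lambda>n. ft \<phi> (u n)) \<longlonglongrightarrow> ft \<phi> l"
      unfolding ft_def
    proof (rule integral_dominated_convergence)
      show "integrable lborel (\<lambda>t. cmod (\<phi> t))" using assms by simp
      show "AE t in lborel. (\<lambda>n. \<phi> t * cis (t * u n)) \<longlonglongrightarrow> \<phi> t * cis (t * l)"
        using u by (auto intro!: tendsto_intros simp: cis_conv_exp)
    qed (use assms in \<open>auto simp: norm_mult\<close>)
  qed
  then show ?thesis by (simp add: continuous_at_imp_continuous_on)
qed

lemma ft_add: "integrable lborel \<phi> \<Longrightarrow> integrable lborel \<psi> \<Longrightarrow> ft (\<lambda>t. \<phi> t + \<psi> t) l = ft \<phi> l + ft \<psi> l"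
  unfolding ft_def by (simp add: distrib_right ft_integrable)

lemma ft_diff: "integrable lborel \<phi> \<Longrightarrow> integrable lborel \<psi> \<Longrightarrow> ft (\<lambda>t. \<phi> t - \<psi> t) l = ft \<phi> l - ft \<psi> l"
  unfolding ft_def by (simp add: left_diff_distrib ft_integrable)

lemma ft_mult: "ft (\<lambda>t. b * \<phi> t) l = b * ft \<phi> l"
  unfolding ft_def by (simp add: mult.assoc)

lemma cnj_ft: "cnj (ft \<phi> l) = ft (\<lambda>t. cnj (\<phi> t)) (- l)"
  unfolding ft_def by (subst Bochner_Integration.integral_cnj[symmetric]) (simp add: cis_cnj)

lemma ft_multiplication:
  assumes "integrable lborel \<phi>" "integrable lborel \<psi>"
  shows "(LBINT t. \<phi> t * ft \<psi> t) = (LBINT l. ft \<phi> l * \<psi> l)"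
  using fubini_bounded_kernel(1)[of \<phi> \<psi> "\<lambda>x y. cis (x * y)" 1] assms
  unfolding ft_def by (simp add: mult.commute)

text \<open>This is the characteristic function of the standard normal law after rescaling by
  \<open>e\<close>, with dual variable \<open>t = x / e\<close>. The result is \<open>2 * pi\<close>
  times a probability density, which is why it can serve as an approximate identity.\<close>

lemma gaussian_ft:
  assumes "0 < e"
  shows "(LBINT l. of_real (exp (- ((e * l)\<^sup>2) / 2)) * cis (x * l)) = complex_of_real (2 * pi * normal_density 0 e x)"
    and "integrable lborel (\<lambda>l. exp (- ((e * l)\<^sup>2) / 2))"
proof -
  have s: "std_normal_density y = exp (- y\<^sup>2 / 2) / sqrt (2 * pi)" for y
    by (simp add: normal_density_def)
  have "integrable lborel (\<lambda>y. sqrt (2 * pi) * std_normal_density y)" by (intro integrable_mult_right) simp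
  then have "integrable lborel (\<lambda>y::real. exp (- (y\<^sup>2) / 2))" by (simp add: s)
  then have "integrable lborel (\<lambda>l. exp (- ((0 + e * l)\<^sup>2) / 2))"
    by (rule lborel_integrable_real_affine) (use assms in simp)
  then show "integrable lborel (\<lambda>l. exp (- ((e * l)\<^sup>2) / 2))" by simp
  define t where "t = x / e"
  have "complex_of_real (exp (- (t\<^sup>2) / 2)) = char std_normal_distribution t"
    by (simp add: char_std_normal_distribution)
  also have "\<dots> = (LBINT y. std_normal_density y *\<^sub>R iexp (t * y))"
    unfolding char_def by (rule integral_density) (auto simp: normal_density_nonneg)
  also have "\<dots> = \<bar>e\<bar> *\<^sub>R (LBINT l. std_normal_density (0 + e * l) *\<^sub>R iexp (t * (0 + e * l)))"
    by (rule lborel_integral_real_affine) (use assms in simp)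
  also have "(\<lambda>l. std_normal_density (0 + e * l) *\<^sub>R iexp (t * (0 + e * l)))
      = (\<lambda>l. of_real (1 / sqrt (2 * pi)) * (of_real (exp (- ((e * l)\<^sup>2) / 2)) * cis (x * l)))"
    using assms by (auto simp: s t_def cis_conv_exp scaleR_conv_of_real fun_eq_iff)
  finally have "complex_of_real (exp (- (t\<^sup>2) / 2)) = of_real e * (of_real (1 / sqrt (2 * pi)) *
      (LBINT l. of_real (exp (- ((e * l)\<^sup>2) / 2)) * cis (x * l)))"
    using assms by (simp add: scaleR_conv_of_real)
  moreover have "exp (- (t\<^sup>2) / 2) = e / sqrt (2 * pi) * (2 * pi * normal_density 0 e x)"
  proof -
    have "sqrt (2 * pi) * sqrt (2 * pi) = 2 * pi" by simp
    then show ?thesis using assms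
      by (simp add: normal_density_def t_def power_divide real_sqrt_mult field_simps)
  qed
  ultimately have "complex_of_real (e / sqrt (2 * pi)) * (LBINT l. of_real (exp (- ((e * l)\<^sup>2) / 2)) * cis (x * l))
     = of_real (e / sqrt (2 * pi)) * of_real (2 * pi * normal_density 0 e x)"
    by (simp only: of_real_mult[symmetric]) (simp add: field_simps)
  moreover have "complex_of_real (e / sqrt (2 * pi)) \<noteq> 0" using assms by simp
  ultimately show "(LBINT l. of_real (exp (- ((e * l)\<^sup>2) / 2)) * cis (x * l)) = complex_of_real (2 * pi * normal_density 0 e x)"
    using mult_left_cancel by blast
qed

text \<open>Transforms of merely integrable functions need not be square integrable. The Gaussian
  factor makes the integral over \<open>l\<close> absolutely convergent, so two exchanges of
  integrals are legitimate. Letting \<open>e\<close> tend to 0 is left to the uses: by Fatou in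
  \<open>ft_L2_bound\<close>, by dominated convergence in \<open>weak_inversion\<close>.\<close>

lemma gaussian_parseval:
  assumes \<phi>: "integrable lborel \<phi>" and \<psi>: "integrable lborel \<psi>" and "0 < e"
  shows "(LBINT l. ft \<phi> l * cnj (ft \<psi> l) * of_real (exp (- ((e * l)\<^sup>2) / 2)))
    = (LBINT t. \<phi> t * (LBINT u. cnj (\<psi> u) * of_real (2 * pi * normal_density 0 e (t - u))))"
proof -
  define E where "E l = complex_of_real (exp (- ((e * l)\<^sup>2) / 2))" for l
  have [measurable]: "\<phi> \<in> borel_measurable borel" "\<psi> \<in> borel_measurable borel" "E \<in> borel_measurable borel"
    using assms unfolding E_def by auto
  have E: "integrable lborel E" using gaussian_ft(2)[OF assms(3)] unfolding E_def by simp
  have EP: "integrable lborel (\<lambda>l. E l * cnj (ft \<psi> l))"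
    by (rule integrable_mult_bounded[OF E, of _ "LBINT t. cmod (\<psi> t)"]) (auto simp: ft_bound \<psi>)
  have c: "cnj (ft \<psi> l) = (LBINT u. cnj (\<psi> u) * cis (- (u * l)))" for l
    unfolding ft_def by (subst Bochner_Integration.integral_cnj[symmetric]) (simp add: cis_cnj)
  have "(LBINT l. ft \<phi> l * cnj (ft \<psi> l) * E l) = (LBINT l. (E l * cnj (ft \<psi> l)) * (LBINT t. \<phi> t * cis (t * l)))"
    by (simp add: ft_def mult_ac)
  also have "\<dots> = (LBINT t. \<phi> t * (LBINT l. (E l * cnj (ft \<psi> l)) * cis (t * l)))"
    by (rule fubini_bounded_kernel(1)[OF EP \<phi>, where C=1]) auto
  also have "\<dots> = (LBINT t. \<phi> t * (LBINT u. cnj (\<psi> u) * of_real (2 * pi * normal_density 0 e (t - u))))"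
  proof (rule Bochner_Integration.integral_cong[OF refl])
    fix t
    have "(LBINT l. (E l * cnj (ft \<psi> l)) * cis (t * l)) = 
      (LBINT l. E l * (LBINT u. cnj (\<psi> u) * cis ((t - u) * l)))"
      unfolding c by (simp add: mult.assoc cis_mult left_diff_distrib mult.commute[of _ "cis (t * _)"]
          flip: integral_mult_right_zero) (simp add: mult_ac cis_mult)
    also have "\<dots> = (LBINT u. cnj (\<psi> u) * (LBINT l. E l * cis ((t - u) * l)))"
      by (rule fubini_bounded_kernel(1)[OF E, where C=1]) (auto simp: \<psi>)
    finally show "\<phi> t * (LBINT l. (E l * cnj (ft \<psi> l)) * cis (t * l)) 
      = \<phi> t * (LBINT u. cnj (\<psi> u) * of_real (2 * pi * normal_density 0 e (t - u)))"
      unfolding E_def gaussian_ft(1)[OF assms(3)] by simp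
  qed
  finally show ?thesis unfolding E_def .
qed

definition L12 :: "(real \<Rightarrow> complex) \<Rightarrow> bool" where
  "L12 \<phi> \<longleftrightarrow> integrable lborel \<phi> \<and> \<phi> \<in> L2 lborel"

lemma L12D: "L12 \<phi> \<Longrightarrow> integrable lborel \<phi>" "L12 \<phi> \<Longrightarrow> \<phi> \<in> L2 lborel" 
  by (auto simp: L12_def)

lemma L12_add: "L12 \<phi> \<Longrightarrow> L12 \<psi> \<Longrightarrow> L12 (\<lambda>t. \<phi> t + \<psi> t)" by (simp add: L12_def L2_add)
lemma L12_diff: "L12 \<phi> \<Longrightarrow> L12 \<psi> \<Longrightarrow> L12 (\<lambda>t. \<phi> t - \<psi> t)" by (simp add: L12_def L2_diff)
lemma L12_mult: "L12 \<phi> \<Longrightarrow> L12 (\<lambda>t. b * \<phi> t)" by (simp add: L12_def L2_mult_left)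
lemma L12_cnj: "L12 \<phi> \<Longrightarrow> L12 (\<lambda>t. cnj (\<phi> t))" by (simp add: L12_def L2_cnj)

lemma L12_mult_bounded:
  "L12 \<phi> \<Longrightarrow> k \<in> borel_measurable borel \<Longrightarrow> (\<And>x. cmod (k x) \<le> B) \<Longrightarrow> L12 (\<lambda>x. \<phi> x * k x)"
  unfolding L12_def
  by (auto intro!: integrable_mult_bounded L2_bound[of \<phi> _ _ B] mult_right_mono AE_I2
      simp: norm_mult mult.commute[of "cmod (\<phi> _)"] L2_measurable)

lemma norm_integral_le_nn_integral:
  fixes f :: "'a \<Rightarrow> complex"
  shows "ennreal (norm (integral\<^sup>L M f)) \<le> (\<integral>\<^sup>+x. ennreal (norm (f x)) \<partial>M)"
  by (cases "integrable M f") (auto simp: integral_norm_bound_ennreal not_integrable_integral_eq)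

text \<open>Schur's test for the Gaussian kernel: the product of two moduli is at most half the sum
  of their squares, and the kernel has mass 1 in each variable. This bounds the regularised integral
  uniformly in \<open>e\<close>. Only the inequality is obtained here; \<open>plancherel\<close>
  turns it into an equality.\<close>

lemma ft_L2_bound:
  assumes "L12 \<phi>"
  shows "ft \<phi> \<in> L2 lborel" "(nrm lborel (ft \<phi>))\<^sup>2 \<le> 2 * pi * (nrm lborel \<phi>)\<^sup>2"
proof -
  have \<phi>: "integrable lborel \<phi>" "\<phi> \<in> L2 lborel" using assms by (auto simp: L12_def)
  have [measurable]: "\<phi> \<in> borel_measurable borel" using \<phi> by auto
  let ?E = "\<lambda>e l :: real. exp (- ((e * l)\<^sup>2) / 2)"
  let ?q = "\<lambda>n l. ennreal ((cmod (ft \<phi> l))\<^sup>2 * ?E (inverse (real (Suc n))) l)"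
  let ?p = "\<lambda>t. ennreal (pi * (cmod (\<phi> t))\<^sup>2)"
  define B where "B = 2 * pi * (nrm lborel \<phi>)\<^sup>2"
  have B: "B \<ge> 0" by (simp add: B_def)
  have step: "(\<integral>\<^sup>+l. ennreal ((cmod (ft \<phi> l))\<^sup>2 * ?E e l) \<partial>lborel) \<le> ennreal B" if e: "0 < e" for e
  proof -
    have i: "integrable lborel (\<lambda>l. (cmod (ft \<phi> l))\<^sup>2 * ?E e l)"
    proof (rule Bochner_Integration.integrable_bound)
      show "integrable lborel (\<lambda>l. (LBINT t. cmod (\<phi> t))\<^sup>2 * ?E e l)"
        using gaussian_ft(2)[OF e] by simp
      show "AE l in lborel. norm ((cmod (ft \<phi> l))\<^sup>2 * ?E e l)
         \<le> norm ((LBINT t. cmod (\<phi> t))\<^sup>2 * ?E e l)"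
        by (auto simp: abs_mult intro!: mult_right_mono power_mono ft_bound \<phi>)
    qed measurable
    have "of_real (LBINT l. (cmod (ft \<phi> l))\<^sup>2 * ?E e l) = 
       (LBINT l. ft \<phi> l * cnj (ft \<phi> l) * of_real (?E e l))"
      by (simp only: integral_complex_of_real[symmetric] of_real_mult complex_norm_square)
    also have "\<dots> = (LBINT t. \<phi> t * (LBINT u. cnj (\<phi> u) * of_real (2 * pi * normal_density 0 e (t - u))))"
      by (rule gaussian_parseval[OF \<phi>(1) \<phi>(1) e])
    finally have eq: "complex_of_real (LBINT l. (cmod (ft \<phi> l))\<^sup>2 * ?E e l) = \<dots>" .
    let ?n = "normal_density 0 e"
    let ?k = "\<lambda>t u. ennreal (?n (t - u))"
    have n1: "(\<integral>\<^sup>+u. ?k t u \<partial>lborel) = 1" for t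
    proof -
      have "(\<integral>\<^sup>+u. ?k t u \<partial>lborel) = (\<integral>\<^sup>+u. ennreal (normal_density t e u) \<partial>lborel)"
        by (simp add: normal_density_def power2_commute)
      also have "\<dots> = ennreal (LBINT u. normal_density t e u)"
        using e by (intro nn_integral_eq_integral) auto
      finally show ?thesis using e by simp
    qed
    have n2: "(\<integral>\<^sup>+t. ?k t u \<partial>lborel) = 1" for u
    proof -
      have "(\<integral>\<^sup>+t. ?k t u \<partial>lborel) = (\<integral>\<^sup>+t. ennreal (normal_density u e t) \<partial>lborel)"
        by (simp add: normal_density_def)
      also have "\<dots> = ennreal (LBINT t. normal_density u e t)"
        using e by (intro nn_integral_eq_integral) auto
      finally show ?thesis using e by simp
    qed
    have nphi: "(\<integral>\<^sup>+t. ennreal ((cmod (\<phi> t))\<^sup>2) \<partial>lborel) = ennreal ((nrm lborel \<phi>)\<^sup>2)"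
      by (rule nn_integral_nrm[OF \<phi>(2)])
    have "(\<integral>\<^sup>+l. ennreal ((cmod (ft \<phi> l))\<^sup>2 * ?E e l) \<partial>lborel)
      = ennreal (cmod (LBINT t. \<phi> t * (LBINT u. cnj (\<phi> u) * of_real (2 * pi * ?n (t - u)))))"
      unfolding eq[symmetric] by (subst nn_integral_eq_integral[OF i]) (auto simp: integral_nonneg_AE)
    also have "\<dots> \<le> (\<integral>\<^sup>+t. ennreal (cmod (\<phi> t)) * (\<integral>\<^sup>+u. ennreal (cmod (\<phi> u)) * ennreal (2 * pi * ?n (t - u)) \<partial>lborel) \<partial>lborel)"
    proof (rule order_trans[OF norm_integral_le_nn_integral])
      show "(\<integral>\<^sup>+t. ennreal (cmod (\<phi> t * (LBINT u. cnj (\<phi> u) * of_real (2 * pi * ?n (t - u))))) \<partial>lborel)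
        \<le> (\<integral>\<^sup>+t. ennreal (cmod (\<phi> t)) * (\<integral>\<^sup>+u. ennreal (cmod (\<phi> u)) * ennreal (2 * pi * ?n (t - u)) \<partial>lborel) \<partial>lborel)"
      proof (rule nn_integral_mono)
        fix t
        have "ennreal (cmod (LBINT u. cnj (\<phi> u) * of_real (2 * pi * ?n (t - u))))
          \<le> (\<integral>\<^sup>+u. ennreal (cmod (cnj (\<phi> u) * of_real (2 * pi * ?n (t - u)))) \<partial>lborel)"
          by (rule norm_integral_le_nn_integral)
        also have "\<dots> = (\<integral>\<^sup>+u. ennreal (cmod (\<phi> u)) * ennreal (2 * pi * ?n (t - u)) \<partial>lborel)"
          by (simp add: norm_mult ennreal_mult normal_density_nonneg)
        finally show "ennreal (cmod (\<phi> t * (LBINT u. cnj (\<phi> u) * of_real (2 * pi * ?n (t - u)))))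
           \<le> ennreal (cmod (\<phi> t)) * (\<integral>\<^sup>+u. ennreal (cmod (\<phi> u)) * ennreal (2 * pi * ?n (t - u)) \<partial>lborel)"
          by (simp add: norm_mult ennreal_mult mult_left_mono)
      qed
    qed
    also have "\<dots> = (\<integral>\<^sup>+t. (\<integral>\<^sup>+u. ennreal (cmod (\<phi> t) * cmod (\<phi> u) * (2 * pi * ?n (t - u))) \<partial>lborel) \<partial>lborel)"
      by (subst nn_integral_cmult[symmetric]) (auto simp: ennreal_mult normal_density_nonneg mult.assoc)
    also have "\<dots> \<le> (\<integral>\<^sup>+t. (\<integral>\<^sup>+u. ?p t * ?k t u + ?p u * ?k t u \<partial>lborel) \<partial>lborel)"
    proof (intro nn_integral_mono)
      fix t u
      have "(cmod (\<phi> t) * cmod (\<phi> u) * (2 * pi * ?n (t - u))) = (2 * cmod (\<phi> t) * cmod (\<phi> u)) * (pi * ?n (t - u))"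
        by simp
      also have "\<dots> \<le> ((cmod (\<phi> t))\<^sup>2 + (cmod (\<phi> u))\<^sup>2) * (pi * ?n (t - u))"
        by (intro mult_right_mono sum_squares_bound) (simp add: normal_density_nonneg)
      finally have "ennreal (cmod (\<phi> t) * cmod (\<phi> u) * (2 * pi * ?n (t - u))) 
         \<le> ennreal (pi * (cmod (\<phi> t))\<^sup>2 * ?n (t - u) + pi * (cmod (\<phi> u))\<^sup>2 * ?n (t - u))"
        by (intro ennreal_leI) (simp add: algebra_simps)
      then show "ennreal (cmod (\<phi> t) * cmod (\<phi> u) * (2 * pi * ?n (t - u))) 
         \<le> ?p t * ?k t u + ?p u * ?k t u"
        by (simp add: ennreal_mult normal_density_nonneg)
    qed
    also have "\<dots> = (\<integral>\<^sup>+t. (\<integral>\<^sup>+u. ?p t * ?k t u \<partial>lborel) \<partial>lborel) 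
       + (\<integral>\<^sup>+t. (\<integral>\<^sup>+u. ?p u * ?k t u \<partial>lborel) \<partial>lborel)"
      by (subst nn_integral_add[symmetric], simp, simp) (simp add: nn_integral_add)
    also have "(\<integral>\<^sup>+t. (\<integral>\<^sup>+u. ?p u * ?k t u \<partial>lborel) \<partial>lborel)
       = (\<integral>\<^sup>+u. (\<integral>\<^sup>+t. ?p u * ?k t u \<partial>lborel) \<partial>lborel)"
      by (rule lborel_pair.Fubini') simp
    also have "(\<integral>\<^sup>+t. (\<integral>\<^sup>+u. ?p t * ?k t u \<partial>lborel) \<partial>lborel) = (\<integral>\<^sup>+t. ?p t \<partial>lborel)"
      by (subst nn_integral_cmult) (auto simp: n1)
    also have "(\<integral>\<^sup>+u. (\<integral>\<^sup>+t. ?p u * ?k t u \<partial>lborel) \<partial>lborel) = (\<integral>\<^sup>+t. ?p t \<partial>lborel)"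
      by (subst nn_integral_cmult) (auto simp: n2)
    also have "(\<integral>\<^sup>+t. ?p t \<partial>lborel) = ennreal (pi * (nrm lborel \<phi>)\<^sup>2)"
      by (simp add: ennreal_mult nn_integral_cmult nphi del: ennreal_power)
    finally show ?thesis by (simp add: B_def mult.assoc flip: ennreal_plus) 
  qed
  \<comment> \<open>Fatou with \<open>e = 1 / (n + 1)\<close> removes the Gaussian. The integral
    could still be infinite at this point, so the bound is proved in \<open>ennreal\<close> before
    membership in \<open>L2\<close> is claimed.\<close>
  have "(\<integral>\<^sup>+l. ennreal ((cmod (ft \<phi> l))\<^sup>2) \<partial>lborel) 
      = (\<integral>\<^sup>+l. liminf (\<lambda>n. ?q n l) \<partial>lborel)"
  proof (rule nn_integral_cong)
    fix l
    have "(\<lambda>n. ?q n l) 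
      \<longlonglongrightarrow> ennreal ((cmod (ft \<phi> l))\<^sup>2 * ?E 0 l)"
      by (intro tendsto_intros LIMSEQ_inverse_real_of_nat) simp
    then show "ennreal ((cmod (ft \<phi> l))\<^sup>2) = liminf (\<lambda>n. ?q n l)"
      by (intro lim_imp_Liminf[symmetric]) auto
  qed
  also have "\<dots> \<le> liminf (\<lambda>n. \<integral>\<^sup>+l. ?q n l \<partial>lborel)"
    by (rule nn_integral_liminf) measurable
  also have "\<dots> \<le> ennreal B"
    
  proof (rule Liminf_le)
    show "\<forall>\<^sub>F n in sequentially. (\<integral>\<^sup>+l. ?q n l \<partial>lborel) \<le> ennreal B"
      by (rule always_eventually, intro allI step) simp
  qed simp
  finally have le: "(\<integral>\<^sup>+l. ennreal ((cmod (ft \<phi> l))\<^sup>2) \<partial>lborel) \<le> ennreal B" .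
  show L: "ft \<phi> \<in> L2 lborel"
    by (rule L2I) (auto intro!: integrableI_bounded order.strict_trans1[OF le])
  show "(nrm lborel (ft \<phi>))\<^sup>2 \<le> 2 * pi * (nrm lborel \<phi>)\<^sup>2"
    using le B unfolding nn_integral_nrm[OF L] B_def by simp
qed


text \<open>Nonnegativity on intervals makes the primitive of \<open>m\<close> nondecreasing. Its
  Stieltjes measure agrees with integration of \<open>m\<close> on half-open intervals, hence on all
  Borel sets; so the integral of \<open>m\<close> over \<open>{t. m t < 0}\<close> is nonnegative
  too, and this set is null.\<close>

lemma AE_nonneg_of_intervals:
  fixes m :: "real \<Rightarrow> real"
  assumes m: "integrable lborel m"
    and pos: "\<And>a b. a \<le> b \<Longrightarrow> 0 \<le> (LBINT t. indicator {a..b} t * m t)"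
  shows "AE t in lborel. 0 \<le> m t"
proof -
  have [measurable]: "m \<in> borel_measurable borel" using m by auto
  have im: "integrable lborel (\<lambda>t. indicator A t * m t)" if "A \<in> sets borel" for A
    using integrable_mult_indicator[of A lborel m] that m by simp
  define F where "F x = (LBINT t. indicator {..x} t * m t)" for x
  have Fd: "F y - F x = (LBINT t. indicator {x<..y} t * m t)" if "x \<le> y" for x y
  proof -
    have "F y - F x = (LBINT t. indicator {..y} t * m t - indicator {..x} t * m t)"
      unfolding F_def by (rule Bochner_Integration.integral_diff[symmetric]) (auto simp: im)
    also have "\<dots> = (LBINT t. indicator {x<..y} t * m t)"
      using that by (intro Bochner_Integration.integral_cong) (auto split: split_indicator)
    finally show ?thesis .
  qed
  have oc: "(LBINT t. indicator {x<..y} t * m t) = (LBINT t. indicator {x..y} t * m t)" for x y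
  proof (rule integral_cong_AE)
    show "AE t in lborel. indicator {x<..y} t * m t = indicator {x..y} t * m t"
      using AE_lborel_singleton[of x] by eventually_elim (auto split: split_indicator)
  qed auto
  have F_mono: "F x \<le> F y" if "x \<le> y" for x y
    using Fd[OF that] pos[OF that] by (simp add: oc)
  have F_cont: "continuous (at_right a) F" for a
    unfolding continuous_within
  proof (rule tendsto_at_right_sequentially[of a "a + 1"])
    fix S assume S: "\<And>n. a < S n" "decseq S" "S \<longlonglongrightarrow> a"
    show "(\<lambda>n. F (S n)) \<longlonglongrightarrow> F a"
      unfolding F_def
    proof (rule integral_dominated_convergence)
      show "integrable lborel (\<lambda>t. \<bar>m t\<bar>)" using m by simp
      show "AE t in lborel. (\<lambda>n. indicator {..S n} t * m t) \<longlonglongrightarrow> indicator {..a} t * m t"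
      proof (rule AE_I2)
        fix t
        have "(\<lambda>n. indicator {..S n} t :: real) \<longlonglongrightarrow> indicator {..a} t"
        proof (cases "t \<le> a")
          case True
          then have "t \<le> S n" for n using S(1)[of n] by simp
          then show ?thesis using True by simp
        next
          case False
          then have "\<forall>\<^sub>F n in sequentially. S n < t" using S(3) by (intro order_tendstoD) auto
          then have "\<forall>\<^sub>F n in sequentially. indicator {..a} t = (indicator {..S n} t :: real)"
            by eventually_elim (use False in \<open>auto split: split_indicator\<close>)
          then show ?thesis by (rule eventually_const_tendsto)
        qed
        then show "(\<lambda>n. indicator {..S n} t * m t) \<longlonglongrightarrow> indicator {..a} t * m t" by (intro tendsto_intros)
      qed
    qed (auto split: split_indicator)
  qed simp
  define N where "N = interval_measure F"
  have NI: "emeasure N {a<..b} = ennreal (LBINT t. indicator {a<..b} t * m t)" if "a \<le> b" for a b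
    unfolding N_def using emeasure_interval_measure_Ioc[OF that F_mono F_cont] Fd[OF that] by simp
  have setsN [simp, measurable_cong]: "sets N = sets borel" "space N = UNIV" by (simp_all add: N_def)
  \<comment> \<open>The complement step of the induction needs the total mass. The whole line is not
    one of the generating intervals, so it is reached as a limit of
    \<open>{- real n<..real n}\<close>.\<close>
  define c where "c n = (LBINT t. indicator {- real n<..real n} t * m t)" for n
  have c_lim: "c \<longlonglongrightarrow> (LBINT t. m t)"
    unfolding c_def
  proof (rule integral_dominated_convergence)
    show "integrable lborel (\<lambda>t. \<bar>m t\<bar>)" using m by simp
    show "AE t in lborel. (\<lambda>n. indicator {- real n<..real n} t * m t) \<longlonglongrightarrow> m t"
    proof (rule AE_I2)
      fix t
      obtain n0 where n0: "real n0 > \<bar>t\<bar>" using reals_Archimedean2 by blast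
      have "\<forall>\<^sub>F n in sequentially. m t = indicator {- real n<..real n} t * m t"
        using eventually_ge_at_top[of n0] by eventually_elim (use n0 in \<open>auto split: split_indicator\<close>)
      then show "(\<lambda>n. indicator {- real n<..real n} t * m t) \<longlonglongrightarrow> m t"
        by (rule eventually_const_tendsto)
    qed
  qed (auto split: split_indicator)
  have "(\<lambda>n. emeasure N {- real n<..real n}) \<longlonglongrightarrow> emeasure N (\<Union>n. {- real n<..real n})"
    by (intro Lim_emeasure_incseq) (auto simp: incseq_def)
  moreover have "(\<Union>n. {- real n<..real n}) = UNIV"
  proof -
    have "\<exists>n. t \<in> {- real n<..real n}" for t
    proof -
      obtain n where "\<bar>t\<bar> < real n" using reals_Archimedean2 by blast
      then show ?thesis by (intro exI[of _ n]) auto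
    qed
    then show ?thesis by blast
  qed
  moreover have "(\<lambda>n. emeasure N {- real n<..real n}) \<longlonglongrightarrow> ennreal (LBINT t. m t)"
    using c_lim by (simp add: NI flip: c_def)
  ultimately have NU: "emeasure N UNIV = ennreal (LBINT t. m t)"
    using LIMSEQ_unique by metis
  interpret finite_measure N by (rule finite_measureI) (simp add: NU)
  have tot: "0 \<le> (LBINT t. m t)"
    using c_lim by (rule LIMSEQ_le_const) (use pos in \<open>auto simp: c_def oc\<close>)
  have N: "measure N A = (LBINT t. indicator A t * m t)" if "A \<in> sets borel" for A
  proof -
    have gen: "sets borel = sigma_sets UNIV (range (\<lambda>(a, b). {a <.. b::real}))"
      unfolding borel_sigma_sets_Ioc by simp
    have "Int_stable (range (\<lambda>(a, b). {a <.. b::real}))"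
      unfolding Int_stable_def
    proof (intro ballI)
      fix A B :: "real set" assume "A \<in> range (\<lambda>(a, b). {a <.. b})" "B \<in> range (\<lambda>(a, b). {a <.. b})"
      then obtain a b c d where "A = {a<..b}" "B = {c<..d}" by auto
      then have "A \<inter> B = {max a c <.. min b d}" by auto
      then show "A \<inter> B \<in> range (\<lambda>(a, b). {a <.. b})" by (auto intro: range_eqI[of _ _ "(_, _)"])
    qed
    moreover have "range (\<lambda>(a, b). {a <.. b::real}) \<subseteq> Pow UNIV" by simp
    moreover have "A \<in> sigma_sets UNIV (range (\<lambda>(a, b). {a <.. b::real}))" using that gen by simp
    ultimately show ?thesis
    proof (induction rule: sigma_sets_induct_disjoint)
      case (basic A)
      then obtain a b where A: "A = {a<..b}" by auto
      show ?case
      proof (cases "a \<le> b")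
        case True
        then show ?thesis using NI[OF True] pos[OF True] by (simp add: A measure_def oc)
      qed (simp add: A)
    next
      case empty show ?case by simp
    next
      case (compl A)
      then have A: "A \<in> sets borel" by (simp add: gen)
      have "measure N (UNIV - A) = measure N UNIV - measure N A" using finite_measure_compl[of A] A by simp
      also have "\<dots> = (LBINT t. m t) - (LBINT t. indicator A t * m t)"
        using NU tot compl by (simp add: measure_def)
      also have "\<dots> = (LBINT t. m t - indicator A t * m t)"
        by (rule Bochner_Integration.integral_diff[symmetric]) (auto simp: im m A)
      also have "\<dots> = (LBINT t. indicator (UNIV - A) t * m t)"
        by (intro Bochner_Integration.integral_cong) (auto split: split_indicator)
      finally show ?case .
    next
      case (union A)
      have A: "A i \<in> sets borel" for i using union(2) by (auto simp: gen)
      have "(\<lambda>i. measure N (A i)) sums (measure N (\<Union>i. A i))"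
        by (rule finite_measure_UNION) (use A union(1) in auto)
      moreover have "(LBINT t:(\<Union>i. A i). m t) = (\<Sum>i. (LBINT t:(A i). m t))"
        by (rule lebesgue_integral_countable_add)
           (use A union(1) m in \<open>auto simp: disjoint_family_on_def set_integrable_def intro!: im\<close>)
      ultimately show ?case
        using union(3) by (simp add: sums_iff set_lebesgue_integral_def)
    qed
  qed
  define E where "E = {t. m t < 0}"
  have [measurable]: "E \<in> sets borel" unfolding E_def by measurable
  have "0 \<le> (LBINT t. indicator E t * m t)" using N[of E] by (metis \<open>E \<in> sets borel\<close> measure_nonneg)
  then have "(LBINT t. - (indicator E t * m t)) \<le> 0" by simp
  moreover have nn: "AE t in lborel. 0 \<le> - (indicator E t * m t)"
    by (auto simp: E_def split: split_indicator)
  ultimately have "(LBINT t. - (indicator E t * m t)) = 0"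
    using integral_nonneg_AE[OF nn] by linarith
  then have "AE t in lborel. - (indicator E t * m t) = 0"
    using integral_nonneg_eq_0_iff_AE[OF _ nn] im[of E] by simp
  then show ?thesis
    by eventually_elim (auto simp: E_def split: split_indicator_asm)
qed

text \<open>If the real parts of \<open>c * u t\<close> are nonnegative for \<open>c\<close> among
  1, -1, \<i> and -\<i>, then \<open>u t\<close> is 0. The truncation to
  \<open>{- real n..real n}\<close> is there because \<open>u\<close> is only locally integrable, as
  an element of \<open>L2\<close> is.\<close>

lemma AE_zero_of_intervals:
  fixes u :: "real \<Rightarrow> complex"
  assumes u: "\<And>a b. integrable lborel (\<lambda>t. indicator {a..b} t * u t)"
    and z: "\<And>a b. a \<le> b \<Longrightarrow> (LBINT t. indicator {a..b} t * u t) = 0"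
  shows "AE t in lborel. u t = 0"
proof -
  have key: "AE t in lborel. 0 \<le> Re (c * (indicator {-real n..real n} t * u t))" for c n
  proof (rule AE_nonneg_of_intervals)
    show i: "integrable lborel (\<lambda>t. Re (c * (indicator {- real n..real n} t * u t)))"
      by (intro integrable_Re integrable_mult_right u)
    fix a b :: real assume "a \<le> b"
    have "(LBINT t. indicator {a..b} t * Re (c * (indicator {- real n..real n} t * u t)))
      = (LBINT t. Re (c * (indicator {max a (- real n)..min b (real n)} t * u t)))"
      by (rule Bochner_Integration.integral_cong) (auto split: split_indicator)
    also have "\<dots> = Re (c * (LBINT t. indicator {max a (- real n)..min b (real n)} t * u t))"
      by (subst integral_Re) (auto intro: integrable_mult_right u)
    also have "\<dots> = 0"
      using z[of "max a (- real n)" "min b (real n)"]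
      by (cases "max a (- real n) \<le> min b (real n)") auto
    finally show "0 \<le> (LBINT t. indicator {a..b} t * Re (c * (indicator {- real n..real n} t * u t)))" by simp
  qed
  have "AE t in lborel. \<forall>n. \<forall>c\<in>{1,-1,\<i>,-\<i>}. 0 \<le> Re (c * (indicator {-real n..real n} t * u t))"
    unfolding AE_all_countable by (intro allI, subst AE_ball_countable, simp, intro ballI, rule key)
  then show ?thesis
  proof eventually_elim
    case (elim t)
    obtain n where n: "\<bar>t\<bar> \<le> real n" using real_arch_simple by blast
    then have ind: "indicator {- real n..real n} t = (1::complex)"
      by (auto simp: abs_le_iff split: split_indicator)
    then show ?case using elim[rule_format, of 1 n] elim[rule_format, of "-1" n] elim[rule_format, of "\<i>" n] elim[rule_format, of "-\<i>" n]
      unfolding ind by (simp add: complex_eq_iff)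
  qed
qed

text \<open>The substitution \<open>u = t - x / real (Suc n)\<close> moves the scaling into the
  indicator, so \<open>\<bar>k x\<bar>\<close> dominates for all \<open>n\<close>. Endpoints are
  excluded since there the limit sees, in general, only the mass of \<open>k\<close> on one side. It
  is applied to the normal density and to the Fejer kernel.\<close>

lemma interval_approximate_identity:
  fixes k :: "real \<Rightarrow> real"
  assumes k: "integrable lborel k"
  shows "t \<noteq> a \<Longrightarrow> t \<noteq> b \<Longrightarrow> (\<lambda>n. LBINT u. indicator {a..b} u * (real (Suc n) * k (real (Suc n) * (t - u))))
      \<longlonglongrightarrow> indicator {a..b} t * (LBINT x. k x)"
    and "\<bar>LBINT u. indicator {a..b} u * (real (Suc n) * k (real (Suc n) * (t - u)))\<bar> \<le> (LBINT x. \<bar>k x\<bar>)"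
proof -
  have [measurable]: "k \<in> borel_measurable borel" using k by auto
  have eq: "(LBINT u. indicator {a..b} u * (real (Suc n) * k (real (Suc n) * (t - u))))
      = (LBINT x. indicator {a..b} (t - x / real (Suc n)) * k x)" for n
  proof -
    have "(LBINT u. indicator {a..b} u * (real (Suc n) * k (real (Suc n) * (t - u))))
      = \<bar>- 1 / real (Suc n)\<bar> *\<^sub>R (LBINT x. indicator {a..b} (t + - 1 / real (Suc n) * x) * (real (Suc n) * k (real (Suc n) * (t - (t + - 1 / real (Suc n) * x)))))"
      by (rule lborel_integral_real_affine) simp
    also have "(\<lambda>x. indicator {a..b} (t + - 1 / real (Suc n) * x) * (real (Suc n) * k (real (Suc n) * (t - (t + - 1 / real (Suc n) * x)))))
      = (\<lambda>x. real (Suc n) * (indicator {a..b} (t - x / real (Suc n)) * k x))"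
      by (auto simp: fun_eq_iff simp del: of_nat_Suc)
    finally show ?thesis by (simp del: of_nat_Suc)
  qed
  show "(\<lambda>n. LBINT u. indicator {a..b} u * (real (Suc n) * k (real (Suc n) * (t - u))))
      \<longlonglongrightarrow> indicator {a..b} t * (LBINT x. k x)" if t: "t \<noteq> a" "t \<noteq> b"
    unfolding eq integral_mult_right_zero[symmetric]
  proof (rule integral_dominated_convergence)
    show "integrable lborel (\<lambda>x. \<bar>k x\<bar>)" using k by simp
    show "AE x in lborel. (\<lambda>n. indicator {a..b} (t - x / real (Suc n)) * k x) \<longlonglongrightarrow> indicator {a..b} t * k x"
    proof (rule AE_I2)
      fix x
      have "(\<lambda>n. t - x / real (Suc n)) \<longlonglongrightarrow> t - x * 0"
        unfolding divide_inverse by (intro tendsto_intros LIMSEQ_inverse_real_of_nat)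
      then have L: "(\<lambda>n. t - x / real (Suc n)) \<longlonglongrightarrow> t" by simp
      have "\<forall>\<^sub>F n in sequentially. (t - x / real (Suc n) < a) = (t < a) \<and> (t - x / real (Suc n) > b) = (t > b)"
      proof (rule eventually_conj)
        show "\<forall>\<^sub>F n in sequentially. (t - x / real (Suc n) < a) = (t < a)"
        proof (cases "t < a")
          case True
          then show ?thesis using order_tendstoD(2)[OF L True] by (auto elim: eventually_mono)
        next
          case False
          then have "a < t" using t by simp
          from order_tendstoD(1)[OF L this] show ?thesis by eventually_elim (use False in auto)
        qed
        show "\<forall>\<^sub>F n in sequentially. (t - x / real (Suc n) > b) = (t > b)"
        proof (cases "t > b")
          case True
          then show ?thesis using order_tendstoD(1)[OF L True] by (auto elim: eventually_mono)
        next
          case False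
          then have "t < b" using t by simp
          from order_tendstoD(2)[OF L this] show ?thesis by eventually_elim (use False in auto)
        qed
      qed
      then have "\<forall>\<^sub>F n in sequentially. indicator {a..b} t * k x = indicator {a..b} (t - x / real (Suc n)) * k x"
        by eventually_elim (auto split: split_indicator)
      then show "(\<lambda>n. indicator {a..b} (t - x / real (Suc n)) * k x) \<longlonglongrightarrow> indicator {a..b} t * k x"
        by (rule eventually_const_tendsto)
    qed
  qed (auto split: split_indicator)
  show "\<bar>LBINT u. indicator {a..b} u * (real (Suc n) * k (real (Suc n) * (t - u)))\<bar> \<le> (LBINT x. \<bar>k x\<bar>)"
    unfolding eq
  proof (rule order_trans[OF integral_abs_bound integral_mono'])
    show "integrable lborel (\<lambda>x. \<bar>k x\<bar>)" using k by simp
  qed (auto split: split_indicator)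
qed

section \<open>Inversion tested on intervals, and the inverse transform\<close>

lemma of_real_indicator_eq: "(\<lambda>x. of_real (indicator A x)) = indicator A"
  by (auto split: split_indicator)

lemma L12_indicator: "L12 (indicator {a..b})"
  unfolding L12_def L2_def
proof (intro conjI CollectI)
  show i: "integrable lborel (indicator {a..b} :: real \<Rightarrow> complex)"
    using integrable_of_real[of lborel "indicator {a..b}", where 'a=complex]
    by (simp add: integrable_indicator_iff emeasure_lborel_Icc_eq of_real_indicator_eq)
  have "(\<lambda>w. (cmod (indicator {a..b} w))\<^sup>2) = (indicator {a..b} :: real \<Rightarrow> real)"
    by (auto split: split_indicator)
  then show "integrable lborel (\<lambda>w. (cmod (indicator {a..b} w))\<^sup>2)"
    by (simp add: integrable_indicator_iff emeasure_lborel_Icc_eq)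
qed simp

text \<open>Both sides are limits of the same Gaussian means \<open>G\<close>: dominated convergence
  removes the Gaussian on the left, and \<open>gaussian_parseval\<close> turns it into a smoothed
  indicator on the right. Assuming integrability of the product only, rather than of
  \<open>ft \<phi>\<close>, lets the lemma serve both \<open>L1_inversion\<close> and
  \<open>plancherel\<close>.\<close>

lemma weak_inversion:
  fixes \<phi> :: "real \<Rightarrow> complex"
  assumes \<phi>: "integrable lborel \<phi>"
    and i: "integrable lborel (\<lambda>l. ft \<phi> l * cnj (ft (indicator {a..b}) l))"
  shows "(LBINT l. ft \<phi> l * cnj (ft (indicator {a..b}) l)) = 2 * pi * (LBINT t. indicator {a..b} t * \<phi> t)"
proof (rule LIMSEQ_unique)
  have [measurable]: "\<phi> \<in> borel_measurable borel" using \<phi> by auto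
  define G where "G n = (LBINT l. ft \<phi> l * cnj (ft (indicator {a..b}) l) * 
      complex_of_real (exp (- ((inverse (real (Suc n)) * l)\<^sup>2) / 2)))" for n
  show "G \<longlonglongrightarrow> (LBINT l. ft \<phi> l * cnj (ft (indicator {a..b}) l))"
    unfolding G_def
  proof (rule integral_dominated_convergence)
    show "integrable lborel (\<lambda>l. cmod (ft \<phi> l * cnj (ft (indicator {a..b}) l)))" using i by (rule integrable_norm)
    have "(\<lambda>n. ft \<phi> l * cnj (ft (indicator {a..b}) l) * complex_of_real (exp (- ((inverse (real (Suc n)) * l)\<^sup>2) / 2)))
      \<longlonglongrightarrow> ft \<phi> l * cnj (ft (indicator {a..b}) l) * complex_of_real (exp (- ((0 * l)\<^sup>2) / 2))" for l
      by (intro tendsto_intros LIMSEQ_inverse_real_of_nat) simp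
    then show "AE l in lborel. (\<lambda>n. ft \<phi> l * cnj (ft (indicator {a..b}) l) * complex_of_real (exp (- ((inverse (real (Suc n)) * l)\<^sup>2) / 2)))
      \<longlonglongrightarrow> ft \<phi> l * cnj (ft (indicator {a..b}) l)" by simp
  qed (auto simp: norm_mult mult_left_le)
  define J where "J n t = (LBINT u. indicator {a..b} u * (real (Suc n) * std_normal_density (real (Suc n) * (t - u))))" for n t
  have k: "integrable lborel std_normal_density" by simp
  have J: "t \<noteq> a \<Longrightarrow> t \<noteq> b \<Longrightarrow> (\<lambda>n. J n t) \<longlonglongrightarrow> indicator {a..b} t" "\<bar>J n t\<bar> \<le> 1" for n t
    unfolding J_def using interval_approximate_identity(1)[OF k, of t a b] interval_approximate_identity(2)[OF k, where a=a and b=b and t=t and n=n]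
    by (simp_all add: normal_density_nonneg del: of_nat_Suc)
  have [measurable]: "J n \<in> borel_measurable borel" for n
  proof -
    have "J n \<in> borel_measurable lborel" unfolding J_def by measurable
    then show ?thesis by simp
  qed
  have nd: "normal_density 0 (inverse (real (Suc n))) x = real (Suc n) * std_normal_density (real (Suc n) * x)" for n x
    by (simp add: normal_density_def real_sqrt_divide power_mult_distrib power_inverse field_simps real_sqrt_mult del: of_nat_Suc)
  have GJ: "G n = (LBINT t. \<phi> t * complex_of_real (2 * pi * J n t))" for n
  proof -
    have "(LBINT u. cnj (indicator {a..b} u) * complex_of_real (2 * pi * normal_density 0 (inverse (real (Suc n))) (t - u)))
       = of_real (2 * pi * J n t)" for t
    proof -
      have "(LBINT u. cnj (indicator {a..b} u) * complex_of_real (2 * pi * normal_density 0 (inverse (real (Suc n))) (t - u)))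
        = (LBINT u. complex_of_real (2 * pi * (indicator {a..b} u * (real (Suc n) * std_normal_density (real (Suc n) * (t - u))))))"
        unfolding nd by (rule Bochner_Integration.integral_cong) (auto split: split_indicator)
      also have "\<dots> = of_real (2 * pi * J n t)" unfolding J_def integral_complex_of_real by (simp only: integral_mult_right_zero)
      finally show ?thesis .
    qed
    then show ?thesis
      unfolding G_def by (subst gaussian_parseval) (auto simp: \<phi> L12D[OF L12_indicator] simp del: of_nat_Suc)
  qed
  have "(\<lambda>n. LBINT t. \<phi> t * complex_of_real (2 * pi * J n t)) \<longlonglongrightarrow> (LBINT t. \<phi> t * complex_of_real (2 * pi * indicator {a..b} t))"
  proof (rule integral_dominated_convergence)
    show "integrable lborel (\<lambda>t. 2 * pi * cmod (\<phi> t))" using \<phi> by simp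
    show "AE t in lborel. (\<lambda>n. \<phi> t * complex_of_real (2 * pi * J n t)) \<longlonglongrightarrow> \<phi> t * complex_of_real (2 * pi * indicator {a..b} t)"
      using AE_lborel_singleton[of a] AE_lborel_singleton[of b]
      by eventually_elim (intro tendsto_intros J, auto)
    show "AE t in lborel. norm (\<phi> t * complex_of_real (2 * pi * J n t)) \<le> 2 * pi * cmod (\<phi> t)" for n
      using mult_left_mono[OF J(2), of "2 * pi * cmod (\<phi> _)" n] by (auto simp: norm_mult abs_mult mult_ac)
  qed auto
  moreover have "(LBINT t. \<phi> t * complex_of_real (2 * pi * indicator {a..b} t)) = 2 * pi * (LBINT t. indicator {a..b} t * \<phi> t)"
    unfolding integral_mult_right_zero[symmetric] by (rule Bochner_Integration.integral_cong) (auto split: split_indicator)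
  ultimately show "G \<longlonglongrightarrow> 2 * pi * (LBINT t. indicator {a..b} t * \<phi> t)"
    unfolding GJ[abs_def] by (simp only:)
qed


definition ift :: "(real \<Rightarrow> complex) \<Rightarrow> real \<Rightarrow> complex" where
  "ift G t = ft G (- t) / (2 * pi)"

lemma ift_measurable [measurable]: "G \<in> borel_measurable borel \<Longrightarrow> ift G \<in> borel_measurable borel"
  unfolding ift_def by (measurable; simp)

lemma ift_continuous: "integrable lborel G \<Longrightarrow> continuous_on UNIV (ift G)"
  unfolding ift_def
  by (intro continuous_intros continuous_on_compose2[OF ft_continuous, of G UNIV uminus]) auto

lemma ift_bound: "integrable lborel G \<Longrightarrow> cmod (ift G t) \<le> (LBINT t. cmod (G t)) / (2 * pi)"
  unfolding ift_def by (simp add: norm_divide ft_bound divide_right_mono)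

lemma ift_diff: "integrable lborel \<phi> \<Longrightarrow> integrable lborel \<psi> \<Longrightarrow> ift (\<lambda>t. \<phi> t - \<psi> t) l = ift \<phi> l - ift \<psi> l"
  by (simp add: ift_def ft_diff diff_divide_distrib)

lemma nrm_reflect:
  fixes h :: "real \<Rightarrow> complex" shows "nrm lborel (\<lambda>t. h (- t)) = nrm lborel h"
  unfolding nrm_def using lborel_integral_real_affine[of "-1" "\<lambda>t. (cmod (h t))\<^sup>2" 0] by simp

lemma L2_reflect:
  fixes h :: "real \<Rightarrow> complex" shows "h \<in> L2 lborel \<Longrightarrow> (\<lambda>t. h (- t)) \<in> L2 lborel"
proof (rule L2I)
  assume h: "h \<in> L2 lborel"
  then have [measurable]: "h \<in> borel_measurable borel" by (auto simp: L2_def)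
  show "(\<lambda>t. h (- t)) \<in> borel_measurable lborel" by measurable
  show "integrable lborel (\<lambda>t. (cmod (h (- t)))\<^sup>2)"
    using lborel_integrable_real_affine[OF L2_integrable[OF h], of "-1" 0] by simp
qed

lemma ift_L2_bound:
  assumes "L12 G"
  shows "ift G \<in> L2 lborel" "(nrm lborel (ift G))\<^sup>2 \<le> (nrm lborel G)\<^sup>2 / (2 * pi)"
proof -
  have eq: "ift G = (\<lambda>t. (1 / (2 * pi)) * ft G (- t))" by (simp add: ift_def fun_eq_iff)
  show "ift G \<in> L2 lborel"
    unfolding eq by (intro L2_mult_left L2_reflect ft_L2_bound assms)
  have "nrm lborel (ift G) = cmod (1 / (2 * pi)) * nrm lborel (ft G)"
    unfolding eq nrm_mult_left by (simp add: nrm_reflect)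
  then have "(nrm lborel (ift G))\<^sup>2 = (1 / (2 * pi))\<^sup>2 * (nrm lborel (ft G))\<^sup>2"
    by (simp add: norm_divide norm_mult power_mult_distrib power_divide)
  also have "\<dots> \<le> (1 / (2 * pi))\<^sup>2 * (2 * pi * (nrm lborel G)\<^sup>2)"
    by (intro mult_left_mono ft_L2_bound assms) simp
  also have "\<dots> = (nrm lborel G)\<^sup>2 / (2 * pi)" by (simp add: power2_eq_square)
  finally show "(nrm lborel (ift G))\<^sup>2 \<le> (nrm lborel G)\<^sup>2 / (2 * pi)" .
qed

lemma ift_interval:
  assumes "integrable lborel G"
  shows "(LBINT t. indicator {a..b} t * ift G t) = (LBINT l. G l * cnj (ft (indicator {a..b}) l)) / (2 * pi)"
proof -
  have c: "cnj (ft (indicator {a..b}) l) = (LBINT t. indicator {a..b} t * cis (- (t * l)))" for l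
    unfolding cnj_ft unfolding ft_def
    by (rule Bochner_Integration.integral_cong) (auto split: split_indicator)
  have "(LBINT t. indicator {a..b} t * ift G t) = (LBINT t. indicator {a..b} t * (LBINT l. G l * cis (- (t * l)))) / (2 * pi)"
    unfolding ift_def ft_def by (simp add: mult.commute[of _ "_::real"])
  also have "(LBINT t. indicator {a..b} t * (LBINT l. G l * cis (- (t * l))))
     = (LBINT l. G l * (LBINT t. indicator {a..b} t * cis (- (t * l))))"
    by (rule fubini_bounded_kernel(1)[OF L12D(1)[OF L12_indicator] assms, of _ 1]) auto
  finally show ?thesis unfolding c .
qed

lemma integrable_indicator_bounded:
  fixes u :: "real \<Rightarrow> complex"
  assumes "u \<in> borel_measurable borel" "\<And>t. cmod (u t) \<le> B"
  shows "integrable lborel (\<lambda>t. indicator {a..b} t * u t)"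
  by (rule integrable_mult_bounded[OF L12D(1)[OF L12_indicator] assms])

lemma integrable_interval:
  fixes u :: "real \<Rightarrow> complex"
  shows "integrable lborel u \<Longrightarrow> integrable lborel (\<lambda>t. indicator {a..b} t * u t)"
  using integrable_mult_bounded[of u "indicator {a..b}" 1]
  by (auto simp: mult.commute split: split_indicator)

lemma L2_interval:
  fixes u :: "real \<Rightarrow> complex" shows "u \<in> L2 lborel \<Longrightarrow> integrable lborel (\<lambda>t. indicator {a..b} t * u t)"
  by (rule L2_mult_integrable[OF L12D(2)[OF L12_indicator]])

text \<open>By \<open>weak_inversion\<close> and \<open>ift_interval\<close> both functions have the
  same integral over every interval.\<close>

lemma L1_inversion:
  assumes \<phi>: "integrable lborel \<phi>" and F: "integrable lborel (ft \<phi>)"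
  shows "AE t in lborel. \<phi> t = ift (ft \<phi>) t"
proof -
  have [measurable]: "\<phi> \<in> borel_measurable borel" using \<phi> by auto
  have i: "integrable lborel (\<lambda>t. indicator {a..b} t * \<phi> t)" 
    "integrable lborel (\<lambda>t. indicator {a..b} t * ift (ft \<phi>) t)" for a b
    by (intro integrable_interval \<phi>, rule integrable_indicator_bounded[OF _ ift_bound[OF F]]) measurable
  have "AE t in lborel. \<phi> t - ift (ft \<phi>) t = 0"
  proof (rule AE_zero_of_intervals)
    fix a b :: real
    show "integrable lborel (\<lambda>t. indicator {a..b} t * (\<phi> t - ift (ft \<phi>) t))"
      using i by (simp add: right_diff_distrib)
    have "(LBINT l. ft \<phi> l * cnj (ft (indicator {a..b}) l)) = 2 * pi * (LBINT t. indicator {a..b} t * \<phi> t)"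
      by (rule weak_inversion[OF \<phi>], rule integrable_mult_bounded[OF F, of _ "LBINT t. cmod (indicator {a..b} t :: complex)"])
         (auto intro!: ft_bound L12D[OF L12_indicator])
    then show "(LBINT t. indicator {a..b} t * (\<phi> t - ift (ft \<phi>) t)) = 0"
      using i by (simp add: right_diff_distrib ift_interval[OF F])
  qed
  then show ?thesis by simp
qed

section \<open>Plancherel's theorem and the transform on \<open>L2\<close>\<close>

lemma L12_truncate:
  fixes X :: "real \<Rightarrow> complex"
  assumes "X \<in> L2 lborel" shows "L12 (\<lambda>l. indicator {a..b} l * X l)"
  unfolding L12_def
proof
  have [measurable]: "X \<in> borel_measurable borel" using assms by (auto simp: L2_def)
  show "integrable lborel (\<lambda>l. indicator {a..b} l * X l)" by (rule L2_interval[OF assms])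
  show "(\<lambda>l. indicator {a..b} l * X l) \<in> L2 lborel"
    by (rule L2_bound[OF assms, of _ 1]) (auto split: split_indicator)
qed

lemma truncate_tendsto:
  fixes X :: "real \<Rightarrow> complex"
  assumes "X \<in> L2 lborel"
  shows "(\<lambda>n. nrm lborel (\<lambda>l. indicator {- real n..real n} l * X l - X l)) \<longlonglongrightarrow> 0"
proof (rule L2_dominated(3)[OF _ _ assms, of _ _ 1])
  have [measurable]: "X \<in> borel_measurable borel" using assms by (auto simp: L2_def)
  show "(\<lambda>l. indicator {- real n..real n} l * X l) \<in> borel_measurable lborel" for n by measurable
  show "X \<in> borel_measurable lborel" by simp
  show "AE w in lborel. cmod (indicator {- real n..real n} w * X w) \<le> 1 * cmod (X w)" for n
    by (auto split: split_indicator)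
  show "AE w in lborel. (\<lambda>n. indicator {- real n..real n} w * X w) \<longlonglongrightarrow> X w"
  proof (rule AE_I2)
    fix w
    obtain n0 where n0: "real n0 > \<bar>w\<bar>" using reals_Archimedean2 by blast
    have "\<forall>\<^sub>F n in sequentially. X w = indicator {- real n..real n} w * X w"
      using eventually_ge_at_top[of n0] by eventually_elim (use n0 in \<open>auto split: split_indicator\<close>)
    then show "(\<lambda>n. indicator {- real n..real n} w * X w) \<longlonglongrightarrow> X w"
      by (rule eventually_const_tendsto)
  qed
qed

lemma Cauchy_of_convergent:
  assumes X: "\<And>n. X n \<in> L2 M" "Y \<in> L2 M" "L2_lim M X Y" and "0 < e"
  shows "\<exists>N. \<forall>m\<ge>N. \<forall>n\<ge>N. nrm M (\<lambda>w. X m w - X n w) < e"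
proof -
  from LIMSEQ_D[OF X(3) half_gt_zero[OF \<open>0 < e\<close>]] obtain N where N: "\<And>n. n \<ge> N \<Longrightarrow> nrm M (\<lambda>w. X n w - Y w) < e / 2"
    by (auto simp: nrm_nonneg)
  have "nrm M (\<lambda>w. X m w - X n w) < e" if "m \<ge> N" "n \<ge> N" for m n
    using nrm_triangle_diff[OF X(1) X(2) X(1), of m n] N[OF that(1)] N[OF that(2)] nrm_minus_commute[of M Y "X n"]
    by linarith
  then show ?thesis by blast
qed

text \<open>The lower bound uses no density argument: the inverse transforms of the truncations of
  \<open>ft \<phi>\<close> converge in \<open>L2\<close>, and weak inversion against intervals identifies their limit as \<open>\<phi>\<close>.\<close>

theorem plancherel:
  assumes "L12 \<phi>"
  shows "(nrm lborel (ft \<phi>))\<^sup>2 = 2 * pi * (nrm lborel \<phi>)\<^sup>2"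
proof (rule antisym)
  show "(nrm lborel (ft \<phi>))\<^sup>2 \<le> 2 * pi * (nrm lborel \<phi>)\<^sup>2" by (rule ft_L2_bound[OF assms])
  have F: "ft \<phi> \<in> L2 lborel" by (rule ft_L2_bound[OF assms])
  define \<Psi> where "\<Psi> n l = indicator {- real n..real n} l * ft \<phi> l" for n l
  have \<Psi>: "L12 (\<Psi> n)" for n unfolding \<Psi>_def by (rule L12_truncate[OF F])
  have \<Psi>_lim: "L2_lim lborel \<Psi> (ft \<phi>)" unfolding \<Psi>_def by (rule truncate_tendsto[OF F])
  have L: "ift (\<Psi> n) \<in> L2 lborel" for n by (rule ift_L2_bound[OF \<Psi>])
  obtain \<psi> where \<psi>: "\<psi> \<in> L2 lborel" "L2_lim lborel (\<lambda>n. ift (\<Psi> n)) \<psi>"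
  proof (rule L2_complete[OF L])
    fix e :: real assume "0 < e"
    from Cauchy_of_convergent[OF L12D(2)[OF \<Psi>] F \<Psi>_lim this] obtain N where 
      N: "\<And>m n. m \<ge> N \<Longrightarrow> n \<ge> N \<Longrightarrow> nrm lborel (\<lambda>l. \<Psi> m l - \<Psi> n l) < e" by blast
    have "nrm lborel (\<lambda>t. ift (\<Psi> m) t - ift (\<Psi> n) t) < e" if "m \<ge> N" "n \<ge> N" for m n
    proof -
      have "(nrm lborel (\<lambda>t. ift (\<Psi> m) t - ift (\<Psi> n) t))\<^sup>2 \<le> (nrm lborel (\<lambda>l. \<Psi> m l - \<Psi> n l))\<^sup>2 / (2 * pi)"
        using ift_L2_bound(2)[OF L12_diff[OF \<Psi> \<Psi>]] by (simp add: ift_diff[OF L12D(1)[OF \<Psi>] L12D(1)[OF \<Psi>], abs_def])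
      also have "\<dots> \<le> (nrm lborel (\<lambda>l. \<Psi> m l - \<Psi> n l))\<^sup>2 / 1"
        by (intro divide_left_mono) (use pi_gt3 in auto)
      finally have "nrm lborel (\<lambda>t. ift (\<Psi> m) t - ift (\<Psi> n) t) \<le> nrm lborel (\<lambda>l. \<Psi> m l - \<Psi> n l)"
        using nrm_nonneg power2_le_imp_le by fastforce
      with N[OF that] show ?thesis by simp
    qed
    then show "\<exists>N. \<forall>m\<ge>N. \<forall>n\<ge>N. nrm lborel (\<lambda>t. ift (\<Psi> m) t - ift (\<Psi> n) t) < e" by blast
  qed
  have \<phi>: "\<phi> \<in> L2 lborel" by (rule L12D[OF assms])
  have "AE t in lborel. \<psi> t - \<phi> t = 0"
  proof (rule AE_zero_of_intervals)
    fix a b :: real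
    show "integrable lborel (\<lambda>t. indicator {a..b} t * (\<psi> t - \<phi> t))"
      by (rule L2_interval[OF L2_diff[OF \<psi>(1) \<phi>]])
    have I: "indicator {a..b} \<in> L2 lborel" "ft (indicator {a..b}) \<in> L2 lborel"
      using L12_indicator by (auto intro: L12D ft_L2_bound)
    have ipI: "ip lborel x (indicator {a..b}) = (LBINT t. indicator {a..b} t * x t)" for x
      unfolding ip_def by (rule Bochner_Integration.integral_cong) (auto split: split_indicator)
    have "(\<lambda>n. ip lborel (ift (\<Psi> n)) (indicator {a..b})) \<longlonglongrightarrow> ip lborel \<psi> (indicator {a..b})"
      by (rule ip_tendsto[OF L \<psi> I(1)])
    moreover have "ip lborel (ift (\<Psi> n)) (indicator {a..b}) = ip lborel (\<Psi> n) (ft (indicator {a..b})) / (2 * pi)" for n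
      unfolding ipI ift_interval[OF L12D(1)[OF \<Psi>]] by (simp add: ip_def)
    moreover have "(\<lambda>n. ip lborel (\<Psi> n) (ft (indicator {a..b})) / (2 * pi)) \<longlonglongrightarrow> ip lborel (ft \<phi>) (ft (indicator {a..b})) / (2 * pi)"
      by (intro tendsto_divide tendsto_const ip_tendsto[OF L12D(2)[OF \<Psi>] F \<Psi>_lim I(2)]) simp
    ultimately have "ip lborel \<psi> (indicator {a..b}) = ip lborel (ft \<phi>) (ft (indicator {a..b})) / (2 * pi)"
      using LIMSEQ_unique by (simp only:)
    also have "\<dots> = ip lborel \<phi> (indicator {a..b})"
      using weak_inversion[OF L12D(1)[OF assms] ip_integrable[OF F I(2)]] unfolding ipI by (simp add: ip_def)
    finally show "(LBINT t. indicator {a..b} t * (\<psi> t - \<phi> t)) = 0"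
      unfolding ipI by (simp add: right_diff_distrib L2_interval \<psi> \<phi>)
  qed
  then have eq: "nrm lborel \<psi> = nrm lborel \<phi>"
    by (intro nrm_cong_AE) (use \<psi> \<phi> in \<open>auto simp: L2_def\<close>)
  \<comment> \<open>The upper bound, applied to the inverse transform of \<open>\<Psi> n\<close>,
    becomes in the limit the lower bound for \<open>ft \<phi>\<close>.\<close>
  have "(nrm lborel \<phi>)\<^sup>2 \<le> (nrm lborel (ft \<phi>))\<^sup>2 / (2 * pi)"
  proof (rule LIMSEQ_le)
    show "(\<lambda>n. (nrm lborel (ift (\<Psi> n)))\<^sup>2) \<longlonglongrightarrow> (nrm lborel \<phi>)\<^sup>2"
      unfolding eq[symmetric] by (intro tendsto_power nrm_tendsto[OF L \<psi>])
    show "(\<lambda>n. (nrm lborel (\<Psi> n))\<^sup>2 / (2 * pi)) \<longlonglongrightarrow> (nrm lborel (ft \<phi>))\<^sup>2 / (2 * pi)"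
      by (intro tendsto_divide tendsto_const tendsto_power nrm_tendsto[OF L12D(2)[OF \<Psi>] F \<Psi>_lim]) simp
    show "\<exists>N. \<forall>n\<ge>N. (nrm lborel (ift (\<Psi> n)))\<^sup>2 \<le> (nrm lborel (\<Psi> n))\<^sup>2 / (2 * pi)"
      using ift_L2_bound(2)[OF \<Psi>] by blast
  qed
  then show "2 * pi * (nrm lborel \<phi>)\<^sup>2 \<le> (nrm lborel (ft \<phi>))\<^sup>2" by (simp add: field_simps)
qed

corollary nrm_ift: "L12 G \<Longrightarrow> (nrm lborel (ift G))\<^sup>2 = (nrm lborel G)\<^sup>2 / (2 * pi)"
proof -
  assume G: "L12 G"
  have eq: "ift G = (\<lambda>t. (1 / (2 * pi)) * ft G (- t))" by (simp add: ift_def fun_eq_iff)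
  have "nrm lborel (ift G) = cmod (1 / (2 * pi)) * nrm lborel (ft G)"
    unfolding eq nrm_mult_left by (simp add: nrm_reflect)
  then have "(nrm lborel (ift G))\<^sup>2 = (1 / (2 * pi))\<^sup>2 * (nrm lborel (ft G))\<^sup>2"
    by (simp add: norm_divide norm_mult power_mult_distrib power_divide)
  then show ?thesis unfolding plancherel[OF G] by (simp add: power2_eq_square)
qed

text \<open>Polarisation of \<open>plancherel\<close>: \<open>c = 1\<close> gives the real parts and
  \<open>c = \<i>\<close> the imaginary parts.\<close>

theorem parseval:
  assumes "L12 \<phi>" "L12 \<psi>"
  shows "ip lborel (ft \<phi>) (ft \<psi>) = 2 * pi * ip lborel \<phi> \<psi>"
proof -
  have L: "\<phi> \<in> L2 lborel" "\<psi> \<in> L2 lborel" "ft \<phi> \<in> L2 lborel" "ft \<psi> \<in> L2 lborel"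
    using assms by (auto intro: L12D ft_L2_bound)
  have key: "Re (ip lborel (ft \<phi>) (\<lambda>l. c * ft \<psi> l)) = 2 * pi * Re (ip lborel \<phi> (\<lambda>t. c * \<psi> t))" for c
  proof -
    have eq: "ft (\<lambda>t. \<phi> t + c * \<psi> t) = (\<lambda>l. ft \<phi> l + c * ft \<psi> l)"
      using ft_add[OF L12D(1)[OF assms(1)] L12D(1)[OF L12_mult[OF assms(2)]], of c]
      by (simp add: fun_eq_iff ft_mult)
    have "(nrm lborel (\<lambda>l. ft \<phi> l + c * ft \<psi> l))\<^sup>2 = 2 * pi * (nrm lborel (\<lambda>t. \<phi> t + c * \<psi> t))\<^sup>2"
      using plancherel[OF L12_add[OF assms(1) L12_mult[OF assms(2)]], of c] unfolding eq .
    then show ?thesis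
      using plancherel[OF assms(1)] plancherel[OF assms(2)]
      by (simp add: nrm_add_sq L L2_mult_left nrm_mult_left algebra_simps power_mult_distrib)
  qed
  from key[of 1] key[of \<i>] show ?thesis by (simp add: ip_mult_right complex_eq_iff)
qed

text \<open>The multiplication formula determines the Fourier-Plancherel transform; as a relation it avoids
  choosing a version.\<close>

definition wFT :: "(real \<Rightarrow> complex) \<Rightarrow> (real \<Rightarrow> complex) \<Rightarrow> bool" where
  "wFT x X \<longleftrightarrow> x \<in> L2 lborel \<and> X \<in> L2 lborel \<and>
     (\<forall>g. L12 g \<longrightarrow> (LBINT t. x t * ft g t) = (LBINT l. X l * g l))"

lemma wFT_ft: "L12 \<phi> \<Longrightarrow> wFT \<phi> (ft \<phi>)"
  unfolding wFT_def by (auto intro: ft_multiplication L12D ft_L2_bound)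

lemma L2_mult_tendsto:
  assumes "\<And>n. X n \<in> L2 M" "Y \<in> L2 M" "L2_lim M X Y" "V \<in> L2 M"
  shows "(\<lambda>n. LINT w|M. X n w * V w) \<longlonglongrightarrow> (LINT w|M. Y w * V w)"
  using ip_tendsto[OF assms(1-3) L2_cnj[OF assms(4)]] by (simp add: ip_def)

lemma wFT_limit:
  assumes "\<And>n. wFT (x n) (X n)" "y \<in> L2 lborel" "Y \<in> L2 lborel"
    "L2_lim lborel x y" "L2_lim lborel X Y"
  shows "wFT y Y"
  unfolding wFT_def
proof (intro conjI allI impI assms)
  fix g assume g: "L12 g"
  have "(\<lambda>n. LBINT t. x n t * ft g t) \<longlonglongrightarrow> (LBINT t. y t * ft g t)"
    by (rule L2_mult_tendsto) (use assms g in \<open>auto simp: wFT_def intro: ft_L2_bound\<close>)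
  moreover have "(\<lambda>n. LBINT t. X n t * g t) \<longlonglongrightarrow> (LBINT t. Y t * g t)"
    by (rule L2_mult_tendsto) (use assms g in \<open>auto simp: wFT_def intro: L12D\<close>)
  moreover have "(LBINT t. x n t * ft g t) = (LBINT t. X n t * g t)" for n
    using assms(1) g by (simp add: wFT_def)
  ultimately show "(LBINT t. y t * ft g t) = (LBINT l. Y l * g l)"
    using LIMSEQ_unique by (simp only:)
qed

lemma wFT_exists:
  assumes x: "x \<in> L2 lborel" obtains X where "wFT x X" "(nrm lborel X)\<^sup>2 = 2 * pi * (nrm lborel x)\<^sup>2"
proof -
  define x' where "x' n t = indicator {- real n..real n} t * x t" for n t
  have x': "L12 (x' n)" for n unfolding x'_def by (rule L12_truncate[OF x])
  have lim: "L2_lim lborel x' x" unfolding x'_def by (rule truncate_tendsto[OF x])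
  have L: "ft (x' n) \<in> L2 lborel" for n by (rule ft_L2_bound[OF x'])
  obtain X where X: "X \<in> L2 lborel" "L2_lim lborel (\<lambda>n. ft (x' n)) X"
  proof (rule L2_complete[OF L])
    fix e :: real assume "0 < e"
    then have e': "0 < e / 3" by simp
    from Cauchy_of_convergent[OF L12D(2)[OF x'] x lim e'] obtain N where 
      N: "\<And>m n. m \<ge> N \<Longrightarrow> n \<ge> N \<Longrightarrow> nrm lborel (\<lambda>l. x' m l - x' n l) < e / 3" by blast
    have "nrm lborel (\<lambda>t. ft (x' m) t - ft (x' n) t) < e" if "m \<ge> N" "n \<ge> N" for m n
    proof -
      have "(nrm lborel (\<lambda>t. ft (x' m) t - ft (x' n) t))\<^sup>2 = 2 * pi * (nrm lborel (\<lambda>l. x' m l - x' n l))\<^sup>2"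
        using plancherel[OF L12_diff[OF x' x']] by (simp add: ft_diff[OF L12D(1)[OF x'] L12D(1)[OF x'], abs_def])
      \<comment> \<open>9 is a perfect square above \<open>2 * pi\<close>; its root 3 is the factor
        anticipated in \<open>e / 3\<close>.\<close>
      also have "\<dots> \<le> 9 * (nrm lborel (\<lambda>l. x' m l - x' n l))\<^sup>2"
        by (intro mult_right_mono) (use pi_less_4 in auto)
      also have "\<dots> = (3 * nrm lborel (\<lambda>l. x' m l - x' n l))\<^sup>2" by (simp add: power_mult_distrib)
      finally have "nrm lborel (\<lambda>t. ft (x' m) t - ft (x' n) t) \<le> 3 * nrm lborel (\<lambda>l. x' m l - x' n l)"
        by (rule power2_le_imp_le) (simp add: nrm_nonneg)
      with N[OF that] show ?thesis by simp
    qed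
    then show "\<exists>N. \<forall>m\<ge>N. \<forall>n\<ge>N. nrm lborel (\<lambda>t. ft (x' m) t - ft (x' n) t) < e" by blast
  qed
  have "(nrm lborel X)\<^sup>2 = 2 * pi * (nrm lborel x)\<^sup>2"
  proof (rule LIMSEQ_unique)
    show "(\<lambda>n. (nrm lborel (ft (x' n)))\<^sup>2) \<longlonglongrightarrow> (nrm lborel X)\<^sup>2"
      by (intro tendsto_power nrm_tendsto[OF L X])
    show "(\<lambda>n. (nrm lborel (ft (x' n)))\<^sup>2) \<longlonglongrightarrow> 2 * pi * (nrm lborel x)\<^sup>2"
      unfolding plancherel[OF x'] by (intro tendsto_intros nrm_tendsto[OF L12D(2)[OF x'] x lim])
  qed
  with wFT_limit[OF wFT_ft[OF x'] x X(1) lim X(2)] show ?thesis by (rule that)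
qed

text \<open>Indicators of intervals are admissible test functions, so both candidates have the same
  integral over each interval.\<close>

lemma wFT_unique:
  assumes "wFT x X" "wFT x' X'" "AE t in lborel. x t = x' t"
  shows "AE l in lborel. X l = X' l"
proof -
  have L: "x \<in> L2 lborel" "X \<in> L2 lborel" "x' \<in> L2 lborel" "X' \<in> L2 lborel" using assms by (auto simp: wFT_def)
  then have [measurable]: "x \<in> borel_measurable borel" "x' \<in> borel_measurable borel" by (auto simp: L2_def)
  have "AE l in lborel. X l - X' l = 0"
  proof (rule AE_zero_of_intervals)
    fix a b :: real
    show "integrable lborel (\<lambda>t. indicator {a..b} t * (X t - X' t))" by (rule L2_interval[OF L2_diff[OF L(2,4)]])
    have "(LBINT t. x t * ft (indicator {a..b}) t) = (LBINT t. x' t * ft (indicator {a..b}) t)"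
      using assms(3) by (intro integral_cong_AE) auto
    then have "(LBINT t. X t * indicator {a..b} t) = (LBINT t. X' t * indicator {a..b} t)"
      using assms(1,2) L12_indicator by (auto simp: wFT_def)
    then show "(LBINT t. indicator {a..b} t * (X t - X' t)) = 0"
      by (simp add: right_diff_distrib L2_interval L mult.commute[of _ "indicator _ _"])
  qed
  then show ?thesis by simp
qed

text \<open>The multiplication formula for \<open>v\<close> with test function
  \<open>cnj (G l)\<close>, conjugated. With \<open>W z\<close> in the role of \<open>v\<close> it
  turns inner products on \<open>T\<close> into integrals over frequencies.\<close>

lemma ift_multiplication:
  assumes G: "L12 G" and g: "wFT v V"
  shows "(LBINT t. ift G t * cnj (v t)) = (LBINT l. G l * cnj (V l)) / (2 * pi)"
proof -
  have "(LBINT t. v t * ft (\<lambda>l. cnj (G l)) t) = (LBINT l. V l * cnj (G l))"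
    using g L12_cnj[OF G] by (simp add: wFT_def)
  then have "cnj (LBINT t. v t * ft (\<lambda>l. cnj (G l)) t) = cnj (LBINT l. V l * cnj (G l))" by (rule arg_cong)
  then have "(LBINT t. cnj (v t) * ft G (- t)) = (LBINT l. cnj (V l) * G l)"
    by (subst (asm) (1 2) Bochner_Integration.integral_cnj[symmetric]) (simp add: cnj_ft)
  then show ?thesis by (simp add: ift_def mult.commute)
qed

text \<open>\<open>ift G\<close> is the conjugate of the transform of \<open>cnj (G l)\<close>
  divided by \<open>2 * pi\<close>, so the multiplication formula is \<open>parseval\<close> for
  \<open>g\<close> and \<open>cnj (G l)\<close>.\<close>

lemma wFT_ift:
  assumes G: "L12 G" shows "wFT (ift G) G"
  unfolding wFT_def
proof (intro conjI allI impI)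
  fix g assume g: "L12 g"
  have eq: "ift G t = cnj (ft (\<lambda>l. cnj (G l)) t) / (2 * pi)" for t by (simp add: ift_def cnj_ft)
  have "ip lborel (ft g) (ft (\<lambda>l. cnj (G l))) = 2 * pi * ip lborel g (\<lambda>l. cnj (G l))"
    by (rule parseval[OF g L12_cnj[OF G]])
  then show "(LBINT t. ift G t * ft g t) = (LBINT l. G l * g l)"
    unfolding eq by (simp add: ip_def mult.commute)
qed (use G in \<open>auto intro: ift_L2_bound L12D\<close>)


lemma wFT_nrm: "wFT x X \<Longrightarrow> (nrm lborel X)\<^sup>2 = 2 * pi * (nrm lborel x)\<^sup>2"
proof -
  assume X: "wFT x X"
  then have "x \<in> L2 lborel" by (simp add: wFT_def)
  then obtain X' where X': "wFT x X'" "(nrm lborel X')\<^sup>2 = 2 * pi * (nrm lborel x)\<^sup>2"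
    by (rule wFT_exists)
  have "nrm lborel X = nrm lborel X'"
    by (rule nrm_cong_AE) (use wFT_unique[OF X X'(1)] X X'(1) in \<open>auto simp: wFT_def L2_def\<close>)
  with X'(2) show ?thesis by simp
qed

lemma wFT_diff: "wFT x X \<Longrightarrow> wFT y Y \<Longrightarrow> wFT (\<lambda>t. x t - y t) (\<lambda>l. X l - Y l)"
  unfolding wFT_def
  by (auto simp: L2_diff left_diff_distrib L2_mult_integrable ft_L2_bound L12D)

lemma wFT_inject:
  assumes "wFT x X" "wFT y X" shows "AE t in lborel. x t = y t"
proof -
  have "(nrm lborel (\<lambda>t. x t - y t))\<^sup>2 = 0"
    using wFT_nrm[OF wFT_diff[OF assms]] by (simp add: nrm_def)
  then show ?thesis
    using assms by (simp add: nrm_eq_0 wFT_def L2_diff)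
qed

lemma wFT_cong_AE:
  assumes "wFT x X" "y \<in> borel_measurable borel" "AE t in lborel. x t = y t"
  shows "wFT y X"
  unfolding wFT_def
proof (intro conjI allI impI)
  have x: "x \<in> L2 lborel" "X \<in> L2 lborel" using assms by (auto simp: wFT_def)
  show y: "y \<in> L2 lborel" by (rule L2_cong_AE[OF x(1)]) (use assms in auto)
  show "X \<in> L2 lborel" by fact
  fix g assume g: "L12 g"
  have [measurable]: "x \<in> borel_measurable borel" "g \<in> borel_measurable borel" "y \<in> borel_measurable borel"
    using x g assms by (auto simp: L2_def L12_def)
  have "(LBINT t. y t * ft g t) = (LBINT t. x t * ft g t)"
    by (rule integral_cong_AE) (use assms(3) in auto)
  then show "(LBINT t. y t * ft g t) = (LBINT l. X l * g l)" using assms(1) g by (simp add: wFT_def)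
qed

text \<open>A nonempty open set is not null. This upgrades almost everywhere vanishing of an inverse
  transform to vanishing at each observed time, which matters since every single time contributes a
  generator of the span.\<close>

lemma continuous_AE_zero_imp_zero:
  fixes u :: "real \<Rightarrow> complex"
  assumes "continuous_on UNIV u" "open S" "AE t in lborel. t \<in> S \<longrightarrow> u t = 0" "t \<in> S"
  shows "u t = 0"
proof (rule ccontr)
  assume "u t \<noteq> 0"
  let ?V = "S \<inter> u -` (- {0})"
  have "open ?V"
    using assms(1,2) by (intro open_Int open_vimage[of "- {0}" u]) (auto simp: open_Compl)
  moreover have "?V \<noteq> {}" using assms(4) \<open>u t \<noteq> 0\<close> by auto
  ultimately have "\<not> negligible ?V" by (rule open_not_negligible)
  moreover have "?V \<in> null_sets lborel"
  proof -
    have "AE t in lborel. t \<notin> ?V" using assms(3) by eventually_elim auto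
    moreover have "?V \<in> sets lborel" using \<open>open ?V\<close> by simp
    ultimately show ?thesis by (simp only: AE_iff_null_sets)
  qed
  then have "negligible ?V" unfolding negligible_iff_null_sets by (rule null_sets_completionI)
  ultimately show False by simp
qed

section \<open>The form of the operator \<open>B\<close>\<close>

locale observation_scheme =
  fixes s :: nat and N K :: "nat \<Rightarrow> real"
  assumes N0: "N 0 = 0" and K0: "K 0 = 0" and NK: "\<forall>k\<in>{1..s}. 0 \<le> N k \<and> 0 \<le> K k"
begin

abbreviation "T \<equiv> Tset s N K"

abbreviation "L2_T \<equiv> L2T s N K"
abbreviation "inner_T \<equiv> T_inner s N K"

text \<open>Overlapping gaps are counted with multiplicity \<open>wt\<close>; every statement about \<open>T_integral\<close> is
  turned into one about Lebesgue integrals of \<open>W x\<close>.\<close>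

definition wt :: "real \<Rightarrow> real" where
  "wt t = (\<Sum>l=1..s. indicator {- Msum N K l - N l .. - Msum N K l} t) + indicator {0..} t"

definition W :: "(real \<Rightarrow> complex) \<Rightarrow> real \<Rightarrow> complex" where
  "W x t = of_real (wt t) * x t"

text \<open>An element of \<open>L2_T\<close> may take arbitrary, even nonmeasurable, values off
  \<open>T\<close>. This picks the version that is a genuine function on the line.\<close>

definition cut :: "(real \<Rightarrow> complex) \<Rightarrow> real \<Rightarrow> complex" where
  "cut x t = indicator T t * x t"

lemma Msum_nonneg: "l \<in> {1..s} \<Longrightarrow> 0 \<le> Msum N K l"
  unfolding Msum_def
proof (rule sum_nonneg)
  fix k assume "l \<in> {1..s}" "k \<in> {0..l}"
  then show "0 \<le> N k + K k" using NK N0 K0 by (cases "k = 0") auto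
qed

lemma T_measurable [measurable]: "T \<in> sets borel"
  unfolding Tset_def gaps_def by auto

lemma wt_measurable [measurable]: "wt \<in> borel_measurable borel"
  unfolding wt_def by measurable

lemma wt_nonneg: "0 \<le> wt t"
  unfolding wt_def by (intro add_nonneg_nonneg sum_nonneg) auto

lemma wt_ge_1: "t \<in> T \<Longrightarrow> 1 \<le> wt t"
proof -
  assume "t \<in> T"
  then consider "t \<ge> 0" | l where "l \<in> {1..s}" "t \<in> {- Msum N K l - N l .. - Msum N K l}"
    unfolding Tset_def gaps_def by auto
  then show ?thesis
  proof cases
    case 1
    then show ?thesis unfolding wt_def by (auto intro!: sum_nonneg)
  next
    case 2
    have "indicator {- Msum N K l - N l .. - Msum N K l} t \<le> (\<Sum>l=1..s. indicator {- Msum N K l - N l .. - Msum N K l} t :: real)"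
      by (rule member_le_sum) (use 2 in auto)
    then show ?thesis unfolding wt_def using 2 by (auto intro: order_trans split: split_indicator_asm)
  qed
qed

lemma wt_outside: "t \<notin> T \<Longrightarrow> wt t = 0"
  unfolding wt_def Tset_def gaps_def by (auto intro!: sum.neutral split: split_indicator)

lemma wt_le: "wt t \<le> real s + 1"
proof -
  have "(\<Sum>l=1..s. indicator {- Msum N K l - N l .. - Msum N K l} t :: real) \<le> (\<Sum>l=1..s. 1)"
    by (rule sum_mono) (auto split: split_indicator)
  then show ?thesis unfolding wt_def by (auto intro: add_mono split: split_indicator)
qed

text \<open>As all \<open>N k\<close> and \<open>K k\<close> are nonnegative, every gap lies in
  \<open>{..0}\<close>. The point 0 is left out because a gap with \<open>Msum N K l = 0\<close>
  contains it.\<close>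

lemma wt_positive: "0 < t \<Longrightarrow> wt t = 1"
  unfolding wt_def using Msum_nonneg by (force intro!: sum.neutral split: split_indicator)

text \<open>Each summand of \<open>T_integral\<close> has its own default value 0, so they can be
  merged only when the integrand is integrable on all of \<open>T\<close>. Stating this for
  \<open>cut \<phi>\<close> keeps values off \<open>T\<close> out of the hypothesis.\<close>

lemma T_integral_wt:
  assumes "integrable lborel (cut \<phi>)"
  shows "T_integral s N K \<phi> = (LBINT t. of_real (wt t) * \<phi> t)"
proof -
  define I where "I l = {- Msum N K l - N l .. - Msum N K l}" for l
  have piece: "integrable lborel (\<lambda>t. indicator A t *\<^sub>R \<phi> t)" if "A \<subseteq> T" "A \<in> sets borel" for A
  proof -
    have "(\<lambda>t. indicator A t *\<^sub>R \<phi> t) = (\<lambda>t. indicator A t *\<^sub>R cut \<phi> t)"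
      using that by (auto simp: cut_def fun_eq_iff split: split_indicator)
    then show ?thesis using integrable_mult_indicator[of A lborel "cut \<phi>"] assms that by simp
  qed
  have sub: "I l \<subseteq> T" if "l \<in> {1..s}" for l using that unfolding I_def Tset_def gaps_def by auto
  have "T_integral s N K \<phi> = (\<Sum>l=1..s. (LBINT t. indicator (I l) t *\<^sub>R \<phi> t)) + (LBINT t. indicator {0..} t *\<^sub>R \<phi> t)"
    by (simp add: T_integral_def set_lebesgue_integral_def I_def)
  also have "\<dots> = (LBINT t. (\<Sum>l=1..s. indicator (I l) t *\<^sub>R \<phi> t) + indicator {0..} t *\<^sub>R \<phi> t)"
    by (subst Bochner_Integration.integral_add, (intro Bochner_Integration.integrable_sum piece sub; simp add: I_def),
        (rule piece; auto simp: Tset_def),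
        subst Bochner_Integration.integral_sum) (use piece sub in \<open>auto simp: I_def\<close>)
  also have "\<dots> = (LBINT t. of_real (wt t) * \<phi> t)"
    by (rule Bochner_Integration.integral_cong)
       (simp_all add: wt_def I_def scaleR_conv_of_real sum_distrib_right distrib_right)
  finally show ?thesis .
qed

lemma L2T_iff: "x \<in> L2T s N K \<longleftrightarrow> cut x \<in> L2 lborel"
proof -
  have eq: "(\<lambda>t. indicator T t *\<^sub>R (cmod (x t))\<^sup>2) = (\<lambda>t. (cmod (cut x t))\<^sup>2)"
    by (auto simp: cut_def fun_eq_iff split: split_indicator)
  have eq': "(\<lambda>t. indicator T t *\<^sub>R x t) = cut x"
    by (auto simp: cut_def fun_eq_iff split: split_indicator)
  show ?thesis
    unfolding L2T_def L2_def
    by (simp add: borel_measurable_restrict_space_iff integrable_restrict_space eq eq' del: real_scaleR_def)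
qed

lemma cut_L2: "x \<in> L2T s N K \<Longrightarrow> cut x \<in> L2 lborel" by (simp add: L2T_iff)

lemma W_cut: "W x t = of_real (wt t) * cut x t"
  by (auto simp: W_def cut_def wt_outside split: split_indicator)

lemma W_L2:
  assumes "x \<in> L2T s N K" shows "W x \<in> L2 lborel"
proof -
  have [measurable]: "cut x \<in> borel_measurable borel" using cut_L2[OF assms] by (auto simp: L2_def)
  show ?thesis
    by (rule L2_bound[OF cut_L2[OF assms], of _ "real s + 1"])
       (auto simp: W_cut[abs_def] norm_mult wt_nonneg intro!: mult_right_mono wt_le)
qed

lemma L2T_I:
  assumes "x \<in> L2 lborel" shows "x \<in> L2T s N K"
proof -
  have [measurable]: "x \<in> borel_measurable borel" using assms by (auto simp: L2_def)
  show ?thesis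
    unfolding L2T_iff
    by (rule L2_bound[OF assms, of _ 1]) (auto simp: cut_def[abs_def] split: split_indicator)
qed

text \<open>The first argument will be the image under a truncated operator, an unweighted inverse
  transform. The weight of the outer integral therefore goes with \<open>z\<close>, so that the
  transform of \<open>W z\<close> appears.\<close>

lemma T_inner_ip:
  assumes "x \<in> L2_T" "z \<in> L2_T"
  shows "inner_T x z = ip lborel (cut x) (W z)"
proof -
  have "cut (\<lambda>t. x t * cnj (z t)) = (\<lambda>t. cut x t * cnj (cut z t))"
    by (auto simp: cut_def fun_eq_iff split: split_indicator)
  then have "integrable lborel (cut (\<lambda>t. x t * cnj (z t)))"
    using ip_integrable[OF assms[THEN cut_L2]] by simp
  then have "inner_T x z = (LBINT t. of_real (wt t) * (x t * cnj (z t)))"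
    unfolding T_inner_def by (rule T_integral_wt)
  also have "\<dots> = ip lborel (cut x) (W z)"
    unfolding ip_def
    by (rule Bochner_Integration.integral_cong) (auto simp: W_def cut_def wt_outside split: split_indicator)
  finally show ?thesis .
qed

lemma T_inner_ip':
  assumes "x \<in> L2 lborel" "z \<in> L2_T"
  shows "inner_T x z = ip lborel x (W z)"
  unfolding T_inner_ip[OF L2T_I[OF assms(1)] assms(2)] unfolding ip_def
  by (rule Bochner_Integration.integral_cong) (auto simp: W_def cut_def wt_outside split: split_indicator)

text \<open>Here the weight is split evenly as \<open>sqrt (wt t)\<close>, which makes
  Cauchy-Schwarz on the line available for the weighted inner product.\<close>

lemma T_inner_self:
  assumes "x \<in> L2_T"
  shows "inner_T x x = of_real ((nrm lborel (\<lambda>t. of_real (sqrt (wt t)) * cut x t))\<^sup>2)"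
  unfolding T_inner_ip[OF assms assms] ip_self[symmetric] unfolding ip_def
  by (rule Bochner_Integration.integral_cong) (auto simp: W_cut mult_ac wt_nonneg simp flip: of_real_mult)

lemma T_inner_weighted:
  assumes "x \<in> L2_T" "z \<in> L2_T"
  shows "inner_T x z = ip lborel (\<lambda>t. of_real (sqrt (wt t)) * cut x t) (\<lambda>t. of_real (sqrt (wt t)) * cut z t)"
  unfolding T_inner_ip[OF assms] unfolding ip_def
  by (rule Bochner_Integration.integral_cong) (auto simp: W_cut mult_ac wt_nonneg simp flip: of_real_mult)

lemma weighted_L2:
  assumes "x \<in> L2_T"
  shows "(\<lambda>t. of_real (sqrt (wt t)) * cut x t) \<in> L2 lborel"
proof -
  have [measurable]: "cut x \<in> borel_measurable borel" using cut_L2[OF assms] by (auto simp: L2_def)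
  show ?thesis
    by (rule L2_bound[OF cut_L2[OF assms], of _ "sqrt (real s + 1)"])
       (auto simp: norm_mult wt_nonneg intro!: mult_right_mono wt_le)
qed

lemma nrm_restrict:
  "nrm (restrict_space lborel T) x = nrm lborel (cut x)"
proof -
  have eq: "(\<lambda>t. indicator T t *\<^sub>R (cmod (x t))\<^sup>2) = (\<lambda>t. (cmod (cut x t))\<^sup>2)"
    by (auto simp: cut_def fun_eq_iff split: split_indicator)
  show ?thesis unfolding nrm_def by (subst integral_restrict_space) (simp, simp only: eq)
qed

lemma T_inner_tendsto:
  assumes "\<And>n. X n \<in> L2_T" "r \<in> L2_T" "z \<in> L2_T"
    "L2_tendsto (restrict_space lborel T) X r"
  shows "(\<lambda>n. inner_T (X n) z) \<longlonglongrightarrow> inner_T r z"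
proof -
  have "L2_lim (restrict_space lborel T) X r"
    using assms by (subst (asm) L2_tendsto_iff) (auto simp: L2T_def)
  then have "L2_lim lborel (\<lambda>n. cut (X n)) (cut r)"
    by (simp add: nrm_restrict cut_def[abs_def] right_diff_distrib)
  then show ?thesis
    unfolding T_inner_ip[OF assms(1,3)] T_inner_ip[OF assms(2,3)]
    by (intro ip_tendsto cut_L2 W_L2 assms)
qed

end

section \<open>The weight \<open>1 / (f + g)\<close> and its truncations\<close>

locale spectral_pair =
  fixes f g :: "real \<Rightarrow> real"
  assumes f_int: "integrable lborel f" and g_int: "integrable lborel g"
    and f_nonneg: "\<And>l. 0 \<le> f l" and g_nonneg: "\<And>l. 0 \<le> g l"
    and fg_pos: "AE l in lborel. 0 < f l + g l"
begin

lemma fg_measurable [measurable]: "f \<in> borel_measurable borel" "g \<in> borel_measurable borel"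
  using f_int g_int by auto

text \<open>\<open>V\<close> maps the weighted space with weight \<open>1 / (f + g)\<close> isometrically into \<open>L2 lborel\<close>.\<close>

definition V :: "(real \<Rightarrow> complex) \<Rightarrow> real \<Rightarrow> complex" where
  "V X l = X l / of_real (sqrt (f l + g l))"

lemma sqrt_fg_measurable [measurable]: "(\<lambda>l. complex_of_real (sqrt (f l + g l))) \<in> borel_measurable borel"
  by (rule borel_measurable_continuous_on[where f = "\<lambda>x. complex_of_real (sqrt x)"])
     (auto intro!: continuous_intros)

lemma V_measurable [measurable]:
  assumes [measurable]: "X \<in> borel_measurable borel" shows "V X \<in> borel_measurable borel"
  unfolding V_def[abs_def] by measurable

lemma V_mult: "V X l * cnj (V Z l) = X l * cnj (Z l) / of_real (f l + g l)"
proof -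
  have "complex_of_real (sqrt (f l + g l)) * of_real (sqrt (f l + g l)) = of_real (f l + g l)"
    using f_nonneg[of l] g_nonneg[of l] by (simp flip: of_real_mult)
  then show ?thesis unfolding V_def by (simp del: of_real_add)
qed

text \<open>\<open>X\<close> is the product of \<open>V X\<close> and the square root of
  \<open>f + g\<close>, both square integrable. Transforms of finite energy thus have continuous
  inverse transforms, whose values at single times make sense.\<close>

lemma V_L2_imp_integrable:
  assumes "X \<in> borel_measurable borel" "V X \<in> L2 lborel"
  shows "integrable lborel X"
proof (rule Bochner_Integration.integrable_bound)
  show "integrable lborel (\<lambda>l. (cmod (V X l))\<^sup>2 + (f l + g l))"
    using L2_integrable[OF assms(2)] f_int g_int by simp
  show "AE l in lborel. norm (X l) \<le> norm ((cmod (V X l))\<^sup>2 + (f l + g l))"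
    using fg_pos
  proof eventually_elim
    case (elim l)
    have "cmod (X l) = cmod (V X l) * sqrt (f l + g l)" using elim by (simp add: V_def norm_divide)
    also have "\<dots> \<le> (cmod (V X l))\<^sup>2 + (sqrt (f l + g l))\<^sup>2"
      using sum_squares_bound[of "cmod (V X l)" "sqrt (f l + g l)"] 
        mult_nonneg_nonneg[OF norm_ge_zero[of "V X l"] real_sqrt_ge_zero[OF less_imp_le[OF elim]]] by linarith
    finally show ?case using elim by simp
  qed
qed (use assms in measurable)

abbreviation "tr \<equiv> truncation f g"

lemma tr_measurable [measurable]: "tr n \<in> sets borel"
  unfolding truncation_def by measurable

lemma tr_interval: "indicator (tr n) l = indicator {- real n..real n} l * (indicator (tr n) l :: complex)"
  by (auto simp: truncation_def split: split_indicator)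

lemma tr_eventually: "0 < f l + g l \<Longrightarrow> \<forall>\<^sub>F n in sequentially. l \<in> tr n"
proof -
  assume l: "0 < f l + g l"
  obtain n1 where n1: "\<bar>l\<bar> \<le> real n1" using real_arch_simple by blast
  obtain n2 where n2: "1 / (f l + g l) \<le> real n2" using real_arch_simple by blast
  have "l \<in> tr n" if "n \<ge> Suc (max n1 n2)" for n
  proof -
    have "1 / (f l + g l) \<le> real n" "\<bar>l\<bar> \<le> real n" "0 < real n" using that n1 n2 by auto
    then show ?thesis using l by (simp add: truncation_def field_simps)
  qed
  then show ?thesis unfolding eventually_sequentially by blast
qed

lemma tr_tendsto:
  fixes X :: "real \<Rightarrow> complex"
  shows "AE l in lborel. (\<lambda>n. indicator (tr n) l * X l) \<longlonglongrightarrow> X l"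
  using fg_pos
proof eventually_elim
  case (elim l)
  have "\<forall>\<^sub>F n in sequentially. X l = indicator (tr n) l * X l"
    using tr_eventually[OF elim] by eventually_elim simp
  then show ?case by (rule eventually_const_tendsto)
qed

lemma tr_L2_tendsto:
  assumes "X \<in> L2 lborel"
  shows "(\<lambda>l. indicator (tr n) l * X l) \<in> L2 lborel"
    and "(\<lambda>n. nrm lborel (\<lambda>l. indicator (tr n) l * X l - X l)) \<longlonglongrightarrow> 0"
proof -
  have [measurable]: "X \<in> borel_measurable borel" using assms by (auto simp: L2_def)
  show "(\<lambda>l. indicator (tr n) l * X l) \<in> L2 lborel"
    by (rule L2_bound[OF assms, of _ 1]) (auto split: split_indicator)
  show "(\<lambda>n. nrm lborel (\<lambda>l. indicator (tr n) l * X l - X l)) \<longlonglongrightarrow> 0"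
    by (rule L2_dominated(3)[OF _ _ assms, of _ _ 1]) (auto simp: tr_tendsto split: split_indicator)
qed

lemma tr_inverse_bounded: "\<exists>B. \<forall>l. cmod (indicator (tr n) l / of_real (f l + g l)) \<le> B"
proof (intro exI allI)
  fix l
  \<comment> \<open>\<open>tr 0\<close> is the single point 0: since \<open>1 / real 0 = 0\<close>,
    its condition on \<open>f + g\<close> always holds. The summand \<open>1 / (f 0 + g 0)\<close>
    covers this case.\<close>
  show "cmod (indicator (tr n) l / of_real (f l + g l)) \<le> real n + 1 / (f 0 + g 0)"
  proof (cases "l \<in> tr n")
    case True
    have *: "0 \<le> 1 / (f 0 + g 0)" "0 \<le> f l + g l" using f_nonneg g_nonneg by (auto intro!: divide_nonneg_nonneg add_nonneg_nonneg)
    have "1 / (f l + g l) \<le> real n + 1 / (f 0 + g 0)"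
    proof (cases "n = 0")
      case True
      then have "l = 0" using \<open>l \<in> tr n\<close> by (simp add: truncation_def)
      then show ?thesis by simp
    next
      case False
      then have n: "1 / real n \<le> f l + g l" "0 < 1 / real n" using True by (auto simp: truncation_def)
      then have "0 < f l + g l" by linarith
      with n have "1 / (f l + g l) \<le> 1 / (1 / real n)" using False by (intro divide_left_mono mult_pos_pos) auto
      then have "1 / (f l + g l) \<le> real n" by simp
      with *(1) show ?thesis by linarith
    qed
    then show ?thesis using True * by (simp add: norm_divide del: of_real_add)
  next
    case False
    then show ?thesis using f_nonneg g_nonneg by (auto intro!: divide_nonneg_nonneg add_nonneg_nonneg)
  qed
qed

lemma L12_tr:
  assumes "X \<in> L2 lborel"
  shows "L12 (\<lambda>l. indicator (tr n) l * (X l / of_real (f l + g l)))"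
proof -
  obtain B where B: "\<And>l. cmod (indicator (tr n) l / of_real (f l + g l)) \<le> B" using tr_inverse_bounded by blast
  have "L12 (\<lambda>l. (indicator {- real n..real n} l * X l) * (indicator (tr n) l / of_real (f l + g l)))"
    by (rule L12_mult_bounded[OF L12_truncate[OF assms] _ B]) measurable
  then show ?thesis
    by (subst tr_interval) (simp add: mult_ac)
qed

end

section \<open>\<open>B\<close> as a form in the frequency domain, and its coercivity\<close>

locale filtering = observation_scheme s N K + spectral_pair f g
  for s N K f g
begin

text \<open>The kernel depends on \<open>u - t\<close> only, so the truncated operator is a
  multiplier between the transform of \<open>W x\<close> and an inverse transform. The
  multiplication formula with test function \<open>k\<close> takes the place of Fubini's theorem, as
  \<open>x\<close> may fail to be integrable.\<close>

lemma B_trunc_ift: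
  assumes x: "x \<in> L2_T" and X: "wFT (W x) X"
  shows "B_trunc s N K f g n x = ift (\<lambda>l. indicator (tr n) l * (X l / of_real (f l + g l)))"
proof
  fix t
  obtain B where B: "\<And>l. cmod (indicator (tr n) l / of_real (f l + g l)) \<le> B" using tr_inverse_bounded by blast
  define k where "k l = indicator {- real n..real n} l * (indicator (tr n) l / of_real (f l + g l) * cis (- (l * t)))" for l
  have k: "L12 k"
    unfolding k_def by (rule L12_mult_bounded[OF L12_indicator, of _ B]) (use B in \<open>simp_all add: norm_mult norm_divide\<close>)
  have ke: "k l = indicator (tr n) l / of_real (f l + g l) * cis (- (l * t))" for l
    unfolding k_def by (subst (2) tr_interval) simp
  have e: "(LBINT l:tr n. cis (l * (u - t)) * of_real (1 / (f l + g l))) = ft k u" for u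
    unfolding ft_def set_lebesgue_integral_def ke
    by (rule Bochner_Integration.integral_cong)
       (auto simp: cis_mult algebra_simps split: split_indicator)
  have "cut (\<lambda>u. x u * ft k u) = (\<lambda>u. cut x u * ft k u)" by (simp add: cut_def fun_eq_iff mult_ac)
  then have "integrable lborel (cut (\<lambda>u. x u * ft k u))"
    using L2_mult_integrable[OF cut_L2[OF x] ft_L2_bound(1)[OF k]] by simp
  then have "T_integral s N K (\<lambda>u. x u * ft k u) = (LBINT u. W x u * ft k u)"
    by (subst T_integral_wt) (auto simp: W_def mult.assoc)
  also have "\<dots> = (LBINT l. X l * k l)" using X k by (simp add: wFT_def)
  also have "\<dots> = ft (\<lambda>l. indicator (tr n) l * (X l / of_real (f l + g l))) (- t)"
    unfolding ft_def ke by (rule Bochner_Integration.integral_cong) auto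
  finally show "B_trunc s N K f g n x t = ift (\<lambda>l. indicator (tr n) l * (X l / of_real (f l + g l))) t"
    unfolding B_trunc_def e ift_def by simp
qed

lemma T_inner_B_trunc:
  assumes x: "x \<in> L2_T" "wFT (W x) X" and z: "z \<in> L2_T" "wFT (W z) Z"
  shows "inner_T (B_trunc s N K f g n x) z = (LBINT l. indicator (tr n) l * (V X l * cnj (V Z l))) / (2 * pi)"
proof -
  have X: "X \<in> L2 lborel" using x by (simp add: wFT_def)
  note G = L12_tr[OF X, of n]
  have "inner_T (B_trunc s N K f g n x) z = ip lborel (ift (\<lambda>l. indicator (tr n) l * (X l / of_real (f l + g l)))) (W z)"
    unfolding B_trunc_ift[OF x] by (rule T_inner_ip'[OF ift_L2_bound(1)[OF G] z(1)])
  also have "\<dots> = (LBINT l. indicator (tr n) l * (X l / of_real (f l + g l)) * cnj (Z l)) / (2 * pi)"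
    unfolding ip_def by (rule ift_multiplication[OF G z(2)])
  also have "(LBINT l. indicator (tr n) l * (X l / of_real (f l + g l)) * cnj (Z l))
     = (LBINT l. indicator (tr n) l * (V X l * cnj (V Z l)))"
    unfolding V_mult by (rule Bochner_Integration.integral_cong) auto
  finally show ?thesis .
qed

text \<open>The truncated energies are integrals of \<open>(cmod (V X l))\<^sup>2\<close> over
  \<open>tr n\<close>, divided by \<open>2 * pi\<close>. Fatou's lemma gives one direction, since
  almost every \<open>l\<close> is eventually in \<open>tr n\<close>; monotonicity of the integral
  gives the other.\<close>

lemma form_domain_iff:
  assumes x: "x \<in> L2_T" "wFT (W x) X"
  shows "x \<in> B_form_domain s N K f g \<longleftrightarrow> V X \<in> L2 lborel"
proof -
  have X: "X \<in> L2 lborel" using x by (simp add: wFT_def)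
  then have Xm [measurable]: "X \<in> borel_measurable borel" by (auto simp: L2_def)
  let ?q = "\<lambda>n l. indicator (tr n) l * (cmod (V X l))\<^sup>2"
  have eq: "inner_T (B_trunc s N K f g n x) x = of_real ((LBINT l. ?q n l) / (2 * pi))" for n
  proof -
    have "(LBINT l. indicator (tr n) l * (V X l * cnj (V X l))) = (LBINT l. complex_of_real (?q n l))"
      by (rule Bochner_Integration.integral_cong) (auto simp flip: complex_norm_square split: split_indicator)
    then show ?thesis unfolding T_inner_B_trunc[OF x x] by (simp only: integral_complex_of_real of_real_divide)
  qed
  have qint: "integrable lborel (?q n)" for n
  proof -
    have "integrable lborel (\<lambda>l. (indicator (tr n) l * (X l / of_real (f l + g l))) * cnj (X l))"
      by (rule L2_mult_integrable[OF L12D(2)[OF L12_tr[OF X]] L2_cnj[OF X]])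
    also have "(\<lambda>l. (indicator (tr n) l * (X l / of_real (f l + g l))) * cnj (X l)) = (\<lambda>l. complex_of_real (?q n l))"
      by (auto simp: fun_eq_iff V_mult[of X _ X] complex_norm_square simp del: of_real_power split: split_indicator)
    finally show ?thesis by (simp only: complex_of_real_integrable_eq)
  qed
  have q_nonneg: "0 \<le> (LBINT l. ?q n l)" for n by (intro integral_nonneg_AE) auto
  show ?thesis
  proof
    assume "x \<in> B_form_domain s N K f g"
    then obtain b where "\<And>n. cmod (inner_T (B_trunc s N K f g n x) x) \<le> b"
      unfolding B_form_domain_def bounded_iff by auto
    then have b: "cmod (of_real ((LBINT l. ?q n l) / (2 * pi))) \<le> b" for n unfolding eq .
    have qb: "(LBINT l. ?q n l) \<le> b * (2 * pi)" for n
      using b[of n] q_nonneg[of n] by (simp add: norm_divide field_simps)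
    have "(\<integral>\<^sup>+l. ennreal ((cmod (V X l))\<^sup>2) \<partial>lborel) = (\<integral>\<^sup>+l. liminf (\<lambda>n. ennreal (?q n l)) \<partial>lborel)"
    proof (rule nn_integral_cong_AE)
      show "AE l in lborel. ennreal ((cmod (V X l))\<^sup>2) = liminf (\<lambda>n. ennreal (?q n l))"
        using fg_pos
      proof eventually_elim
        case (elim l)
        have "\<forall>\<^sub>F n in sequentially. ennreal ((cmod (V X l))\<^sup>2) = ennreal (?q n l)"
          using tr_eventually[OF elim] by eventually_elim simp
        then have "(\<lambda>n. ennreal (?q n l)) \<longlonglongrightarrow> ennreal ((cmod (V X l))\<^sup>2)"
          by (rule eventually_const_tendsto)
        then show ?case by (intro lim_imp_Liminf[symmetric]) auto
      qed
    qed
    also have "\<dots> \<le> liminf (\<lambda>n. \<integral>\<^sup>+l. ennreal (?q n l) \<partial>lborel)"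
      by (rule nn_integral_liminf) measurable
    also have "\<dots> \<le> ennreal (b * (2 * pi))"
    proof (rule Liminf_le)
      show "\<forall>\<^sub>F n in sequentially. (\<integral>\<^sup>+l. ennreal (?q n l) \<partial>lborel) \<le> ennreal (b * (2 * pi))"
        by (intro always_eventually allI, subst nn_integral_eq_integral[OF qint]) (auto intro!: ennreal_leI qb)
    qed simp
    finally have le: "(\<integral>\<^sup>+l. ennreal ((cmod (V X l))\<^sup>2) \<partial>lborel) \<le> ennreal (b * (2 * pi))" .
    show "V X \<in> L2 lborel"
      by (rule L2I) (auto intro!: integrableI_bounded order.strict_trans1[OF le])
  next
    assume VX: "V X \<in> L2 lborel"
    have "cmod (inner_T (B_trunc s N K f g n x) x) \<le> (LBINT l. (cmod (V X l))\<^sup>2) / (2 * pi)" for n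
    proof -
      have "(LBINT l. ?q n l) \<le> (LBINT l. (cmod (V X l))\<^sup>2)"
        by (rule integral_mono[OF qint L2_integrable[OF VX]]) (auto split: split_indicator)
      then show ?thesis unfolding eq using q_nonneg[of n] by (simp add: norm_divide divide_right_mono)
    qed
    then show "x \<in> B_form_domain s N K f g"
      unfolding B_form_domain_def bounded_iff using x(1) by auto
  qed
qed

lemma form_domainD:
  assumes "x \<in> B_form_domain s N K f g"
  obtains X where "x \<in> L2_T" "wFT (W x) X" "V X \<in> L2 lborel" "integrable lborel X"
proof -
  have x: "x \<in> L2_T" using assms by (simp add: B_form_domain_def)
  obtain X where X: "wFT (W x) X" using wFT_exists[OF W_L2[OF x]] by blast
  then have "X \<in> borel_measurable borel" by (auto simp: wFT_def L2_def)
  moreover have "V X \<in> L2 lborel" using form_domain_iff[OF x X] assms by simp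
  ultimately show ?thesis using that x X V_L2_imp_integrable by blast
qed

lemma form_tendsto:
  assumes x: "x \<in> L2_T" "wFT (W x) X" "V X \<in> L2 lborel"
    and z: "z \<in> L2_T" "wFT (W z) Z" "V Z \<in> L2 lborel"
  shows "(\<lambda>n. inner_T (B_trunc s N K f g n x) z) \<longlonglongrightarrow> ip lborel (V X) (V Z) / (2 * pi)"
proof -
  have "(\<lambda>n. ip lborel (\<lambda>l. indicator (tr n) l * V X l) (V Z)) \<longlonglongrightarrow> ip lborel (V X) (V Z)"
    by (rule ip_tendsto[OF tr_L2_tendsto(1)[OF x(3)] x(3) tr_L2_tendsto(2)[OF x(3)] z(3)])
  then have "(\<lambda>n. ip lborel (\<lambda>l. indicator (tr n) l * V X l) (V Z) / (2 * pi)) \<longlonglongrightarrow> ip lborel (V X) (V Z) / (2 * pi)"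
    by (intro tendsto_divide tendsto_const) auto
  then show ?thesis unfolding T_inner_B_trunc[OF x(1,2) z(1,2)] ip_def by (simp add: mult.assoc)
qed

text \<open>\<open>form_tendsto\<close> evaluates the limit in \<open>B_op\<close>, so
  \<open>B x = y\<close> becomes the weak equation of a form. After this no limit over truncations
  of \<open>B\<close> has to be taken.\<close>

lemma B_op_iff:
  assumes x: "x \<in> L2_T" "wFT (W x) X" "V X \<in> L2 lborel" and y: "y \<in> L2_T"
  shows "B_op s N K f g x y \<longleftrightarrow>
    (\<forall>z Z. z \<in> L2_T \<and> wFT (W z) Z \<and> V Z \<in> L2 lborel \<longrightarrow> ip lborel (V X) (V Z) / (2 * pi) = inner_T y z)"
    (is "_ \<longleftrightarrow> ?R")
proof
  assume B: "B_op s N K f g x y"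
  show ?R
  proof (intro allI impI)
    fix z Z assume z: "z \<in> L2_T \<and> wFT (W z) Z \<and> V Z \<in> L2 lborel"
    then have "z \<in> B_form_domain s N K f g" using form_domain_iff by blast
    then have "(\<lambda>n. inner_T (B_trunc s N K f g n x) z) \<longlonglongrightarrow> inner_T y z"
      using B by (simp add: B_op_def)
    then show "ip lborel (V X) (V Z) / (2 * pi) = inner_T y z"
      using form_tendsto[OF x, of z Z] z LIMSEQ_unique by blast
  qed
next
  assume R: ?R
  show "B_op s N K f g x y"
    unfolding B_op_def
  proof (intro conjI ballI y)
    show "x \<in> B_form_domain s N K f g" using form_domain_iff[OF x(1,2)] x(3) by simp
    fix z assume "z \<in> B_form_domain s N K f g"
    then obtain Z where z: "z \<in> L2_T" "wFT (W z) Z" "V Z \<in> L2 lborel" using form_domainD by blast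
    with R form_tendsto[OF x z] show "(\<lambda>n. inner_T (B_trunc s N K f g n x) z) \<longlonglongrightarrow> inner_T y z"
      by simp
  qed
qed

text \<open>With \<open>x = B\<^sup>-\<^sup>1 z\<close>: \<open>\<parallel>z\<parallel>\<^sup>2 = b(x, z)\<close>, whose square is at most
  \<open>b(x, x) b(z, z) = \<langle>z, x\<rangle> b(z, z)\<close>, and \<open>\<parallel>x\<parallel>\<close> is bounded by a multiple of \<open>\<parallel>z\<parallel>\<close>.\<close>

lemma coercive:
  assumes "B_invertible s N K f g"
  obtains \<kappa> where "0 \<le> \<kappa>"
    "\<And>z Z. z \<in> L2_T \<Longrightarrow> wFT (W z) Z \<Longrightarrow> V Z \<in> L2 lborel \<Longrightarrow>
       Re (inner_T z z) \<le> \<kappa> * (nrm lborel (V Z))\<^sup>2"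
proof -
  obtain c where c: "\<And>x y. B_op s N K f g x y \<Longrightarrow> Re (inner_T x x) \<le> c * Re (inner_T y y)"
    using assms unfolding B_invertible_def by blast
  \<comment> \<open>The given \<open>c\<close> may be negative and bounds squared norms, hence the
    clamping and the root.\<close>
  define c' where "c' = sqrt (max c 0)"
  have c': "0 \<le> c'" "c'\<^sup>2 = max c 0" unfolding c'_def by auto
  have "Re (inner_T z z) \<le> (c' / (2 * pi)) * (nrm lborel (V Z))\<^sup>2"
    if z: "z \<in> L2_T" "wFT (W z) Z" "V Z \<in> L2 lborel" for z Z
  proof -
    obtain x where x: "B_op s N K f g x z" using assms z(1) unfolding B_invertible_def by blast
    then have "x \<in> B_form_domain s N K f g" by (simp add: B_op_def)
    then obtain X where X: "x \<in> L2_T" "wFT (W x) X" "V X \<in> L2 lborel" using form_domainD by blast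
    note B = x[unfolded B_op_iff[OF X z(1)]]
    let ?w = "\<lambda>x t. complex_of_real (sqrt (wt t)) * cut x t"
    define nz nx VX VZ where "nz = nrm lborel (?w z)" and "nx = nrm lborel (?w x)"
      and "VX = nrm lborel (V X)" and "VZ = nrm lborel (V Z)"
    have nn: "0 \<le> nz" "0 \<le> nx" "0 \<le> VX" "0 \<le> VZ" by (simp_all add: nz_def nx_def VX_def VZ_def nrm_nonneg)
    have 1: "nx\<^sup>2 \<le> c'\<^sup>2 * nz\<^sup>2"
    proof -
      have "nx\<^sup>2 \<le> c * nz\<^sup>2" using c[OF x] by (simp add: T_inner_self X z nz_def nx_def del: of_real_power)
      also have "\<dots> \<le> c'\<^sup>2 * nz\<^sup>2" unfolding c' by (rule mult_right_mono) auto
      finally show ?thesis .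
    qed
    then have 1: "nx \<le> c' * nz" using nn c' by (intro power2_le_imp_le[of nx]) (auto simp: power_mult_distrib)
    have "complex_of_real (VX\<^sup>2) / of_real (2 * pi) = inner_T z x"
      using B X unfolding VX_def ip_self[symmetric] by blast
    then have "inner_T z x = of_real (VX\<^sup>2 / (2 * pi))" by simp
    then have "VX\<^sup>2 / (2 * pi) = cmod (inner_T z x)"
      by (simp only: norm_of_real) simp
    also have "\<dots> \<le> nz * nx"
      unfolding T_inner_weighted[OF z(1) X(1)] nz_def nx_def
      by (intro cauchy_schwarz weighted_L2 X z)
    also have "\<dots> \<le> c' * nz\<^sup>2" using mult_left_mono[OF 1 nn(1)] by (simp add: power2_eq_square mult_ac)
    finally have 2: "VX\<^sup>2 \<le> 2 * pi * c' * nz\<^sup>2" by (simp add: field_simps)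
    have "ip lborel (V X) (V Z) / complex_of_real (2 * pi) = of_real (nz\<^sup>2)"
      using B z T_inner_self[OF z(1)] unfolding nz_def by metis
    then have "cmod (ip lborel (V X) (V Z) / complex_of_real (2 * pi)) = nz\<^sup>2"
      by (simp only: norm_of_real) simp
    then have "nz\<^sup>2 = cmod (ip lborel (V X) (V Z)) / (2 * pi)"
      by (simp only: norm_divide norm_of_real) simp
    also have "\<dots> \<le> VX * VZ / (2 * pi)"
      unfolding VX_def VZ_def by (intro divide_right_mono cauchy_schwarz X z) simp
    finally have 3: "nz\<^sup>2 * (2 * pi) \<le> VX * VZ" by (simp add: field_simps)
    have "nz\<^sup>2 \<le> c' / (2 * pi) * VZ\<^sup>2"
    \<comment> \<open>The combined estimate has the factor \<open>nz\<^sup>2\<close> on both sides,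
      which can be cancelled only if it is positive.\<close>
    proof (cases "nz = 0")
      case True then show ?thesis using c' by simp
    next
      case False
      then have pos: "0 < nz\<^sup>2" using nn by simp
      have "(nz\<^sup>2 * (2 * pi))\<^sup>2 \<le> (VX * VZ)\<^sup>2" by (rule power_mono[OF 3]) simp
      also have "\<dots> = VX\<^sup>2 * VZ\<^sup>2" by (simp add: power_mult_distrib)
      also have "\<dots> \<le> 2 * pi * c' * nz\<^sup>2 * VZ\<^sup>2" by (intro mult_right_mono 2) simp
      finally have "(2 * pi * nz\<^sup>2) * (2 * pi * nz\<^sup>2) \<le> (2 * pi * nz\<^sup>2) * (c' * VZ\<^sup>2)"
        by (simp add: power2_eq_square mult_ac)
      then have "2 * pi * nz\<^sup>2 \<le> c' * VZ\<^sup>2" using pos by (subst (asm) mult_le_cancel_left_pos) auto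
      then show ?thesis by (simp add: field_simps)
    qed
    then show ?thesis unfolding T_inner_self[OF z(1)] nz_def VZ_def by (simp del: of_real_power)
  qed
  moreover have "0 \<le> c' / (2 * pi)" using c' by simp
  ultimately show ?thesis using that by blast
qed

text \<open>On positive times the weight is 1, so functions on the half line need no correction,
  whatever the gaps are.\<close>

lemma wFT_W_half_line:
  assumes x: "wFT x X" and 0: "\<And>t. t < 0 \<Longrightarrow> x t = 0"
  shows "wFT (W x) X"
proof (rule wFT_cong_AE[OF x])
  have [measurable]: "x \<in> borel_measurable borel" using x by (auto simp: wFT_def L2_def)
  show "W x \<in> borel_measurable borel" unfolding W_def[abs_def] by measurable
  show "AE t in lborel. x t = W x t"
    using AE_lborel_singleton[of 0]
  proof eventually_elim
    case (elim t)
    then show ?case using 0[of t] wt_positive[of t] by (cases "t < 0") (auto simp: W_def)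
  qed
qed

end

section \<open>Test functions on the half line and the bound on \<open>f + g\<close>\<close>

lemma ift_mult_half_line:
  assumes \<gamma>: "integrable lborel \<gamma>" and \<psi>: "integrable lborel \<psi>"
    and 0: "\<And>t. t < 0 \<Longrightarrow> ift \<gamma> t = 0" "\<And>t. t < 0 \<Longrightarrow> \<psi> t = 0" and t: "t < 0"
  shows "ift (\<lambda>l. \<gamma> l * ft \<psi> l) t = 0"
proof -
  have i: "integrable lborel (\<lambda>l. \<gamma> l * cis (- (l * t)))"
    by (rule integrable_mult_bounded[OF \<gamma>, of _ 1]) auto
  have "ft (\<lambda>l. \<gamma> l * ft \<psi> l) (- t) = (LBINT l. (\<gamma> l * cis (- (l * t))) * (LBINT s. \<psi> s * cis (s * l)))"
    by (simp add: ft_def[of _ "- t"] ft_def[of \<psi>] mult_ac)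
  also have "\<dots> = (LBINT s. \<psi> s * (LBINT l. (\<gamma> l * cis (- (l * t))) * cis (s * l)))"
    by (rule fubini_bounded_kernel(1)[OF i \<psi>, where C=1]) auto
  \<comment> \<open>Up to \<open>2 * pi\<close> this is the convolution of \<psi> with
    \<open>ift \<gamma>\<close>: for \<open>t < 0\<close>, either \<open>s\<close> or
    \<open>t - s\<close> is negative.\<close>
  also have "\<dots> = (LBINT s. \<psi> s * (2 * pi * ift \<gamma> (t - s)))"
    by (simp add: ift_def ft_def mult.assoc cis_mult algebra_simps)
  also have "(\<lambda>s. \<psi> s * (2 * pi * ift \<gamma> (t - s))) = (\<lambda>s. 0)"
  proof
    fix s
    show "\<psi> s * (2 * pi * ift \<gamma> (t - s)) = 0"
      using 0(1)[of "t - s"] 0(2)[of s] t by (cases "s < 0") auto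
  qed
  finally show ?thesis by (simp add: ift_def)
qed

text \<open>The modulation moves the transform to the frequency \<open>c\<close>, and the length
  \<tau> concentrates it at scale \<open>1 / \<tau>\<close>. The squared modulus is the Fejer
  kernel, up to scaling.\<close>

lemma ft_scaled_indicator:
  assumes "0 < \<tau>"
  shows "ft (\<lambda>s. indicator {0..\<tau>} s * cis (- (c * s))) l = of_real \<tau> * ft (indicator {0..1}) (\<tau> * (l - c))"
proof -
  have "ft (\<lambda>s. indicator {0..\<tau>} s * cis (- (c * s))) l = (LBINT s. indicator {0..\<tau>} s * cis (s * (l - c)))"
    unfolding ft_def by (rule Bochner_Integration.integral_cong) (auto simp: cis_mult mult.assoc algebra_simps)
  also have "\<dots> = \<bar>\<tau>\<bar> *\<^sub>R (LBINT s. indicator {0..\<tau>} (0 + \<tau> * s) * cis ((0 + \<tau> * s) * (l - c)))"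
    by (rule lborel_integral_real_affine) (use assms in simp)
  also have "(\<lambda>s. indicator {0..\<tau>} (0 + \<tau> * s) * cis ((0 + \<tau> * s) * (l - c))) 
     = (\<lambda>s. indicator {0..1} s * cis (s * (\<tau> * (l - c))))"
    using assms by (auto simp: fun_eq_iff mult_ac zero_le_mult_iff split: split_indicator)
  finally show ?thesis using assms by (simp add: ft_def scaleR_conv_of_real)
qed

text \<open>The kernels in the hypothesis are Fejer kernels; integrating over \<open>c\<close> in an interval and
  letting \<open>\<tau>\<close> tend to infinity gives the integral of \<open>m\<close> over that interval.\<close>

lemma AE_nonneg_of_fejer:
  fixes m :: "real \<Rightarrow> real"
  assumes m: "integrable lborel m"
    and pos: "\<And>\<tau> c. 0 < \<tau> \<Longrightarrow> 0 \<le> (LBINT l. m l * (cmod (ft (indicator {0..1}) (\<tau> * (l - c))))\<^sup>2)"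
  shows "AE l in lborel. 0 \<le> m l"
proof (rule AE_nonneg_of_intervals[OF m])
  fix a b :: real assume "a \<le> b"
  define k where "k x = (cmod (ft (indicator {0..1}) x))\<^sup>2" for x :: real
  have I: "L12 (indicator {0..1::real})" by (rule L12_indicator)
  have [measurable]: "k \<in> borel_measurable borel" "m \<in> borel_measurable borel" 
    unfolding k_def using m by (measurable; auto)+
  have k: "integrable lborel k" unfolding k_def by (rule L2_integrable[OF ft_L2_bound(1)[OF I]])
  have k0: "0 \<le> k x" for x by (simp add: k_def)
  obtain C where C: "\<And>x. k x \<le> C"
  proof
    show "k x \<le> (LBINT t. cmod (indicator {0..1::real} t :: complex))\<^sup>2" for x
      unfolding k_def by (intro power_mono ft_bound L12D(1)[OF I]) simp
  qed
  \<comment> \<open>The mass of the Fejer kernel is Plancherel's identity for the indicator of the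
    unit interval, whose norm is 1.\<close>
  have K: "(LBINT x. k x) = 2 * pi"
  proof -
    have "(nrm lborel (indicator {0..1::real}))\<^sup>2 = (LBINT t. indicator {0..1::real} t)"
      unfolding nrm_sq by (rule Bochner_Integration.integral_cong) (auto split: split_indicator)
    also have "\<dots> = 1" by simp
    finally show ?thesis using plancherel[OF I] unfolding nrm_sq k_def by simp
  qed
  define J where "J n l = (LBINT c. indicator {a..b} c * (real (Suc n) * k (real (Suc n) * (l - c))))" for n l
  have J: "l \<noteq> a \<Longrightarrow> l \<noteq> b \<Longrightarrow> (\<lambda>n. J n l) \<longlonglongrightarrow> indicator {a..b} l * (2 * pi)" "\<bar>J n l\<bar> \<le> 2 * pi" for n l
    unfolding J_def using interval_approximate_identity(1)[OF k, of l a b] interval_approximate_identity(2)[OF k, of a b n l]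
    by (simp_all add: K k0 del: of_nat_Suc)
  have [measurable]: "J n \<in> borel_measurable borel" for n
  proof -
    have "J n \<in> borel_measurable lborel" unfolding J_def by measurable
    then show ?thesis by simp
  qed
  \<comment> \<open>This is the hypothesis with \<open>\<tau> = real (Suc n)\<close>, averaged over
    \<open>c\<close> in \<open>{a..b}\<close>. Passing to complex values makes
    \<open>fubini_bounded_kernel\<close> applicable.\<close>
  have nn: "0 \<le> (LBINT l. m l * J n l)" for n
  proof -
    define \<tau> where "\<tau> = real (Suc n)"
    have \<tau>: "0 < \<tau>" by (simp add: \<tau>_def)
    have Jc: "complex_of_real (J n l) = (LBINT c. indicator {a..b} c * complex_of_real (\<tau> * k (\<tau> * (l - c))))" for l
      unfolding J_def \<tau>_def integral_complex_of_real[symmetric]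
      by (rule Bochner_Integration.integral_cong) (auto split: split_indicator)
    have "complex_of_real (LBINT l. m l * J n l) = (LBINT l. complex_of_real (m l) * (LBINT c. indicator {a..b} c * complex_of_real (\<tau> * k (\<tau> * (l - c)))))"
      unfolding integral_complex_of_real[symmetric] of_real_mult Jc ..
    also have "\<dots> = (LBINT c. indicator {a..b} c * (LBINT l. complex_of_real (m l) * complex_of_real (\<tau> * k (\<tau> * (l - c)))))"
      by (rule fubini_bounded_kernel(1)[where C = "\<tau> * C"])
         (use m \<tau> in \<open>auto intro!: L12D(1)[OF L12_indicator] mult_left_mono C simp: abs_mult k0 simp flip: of_real_mult\<close>)
    also have "\<dots> = (LBINT c. complex_of_real (indicator {a..b} c * (\<tau> * (LBINT l. m l * k (\<tau> * (l - c))))))"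
    proof (rule Bochner_Integration.integral_cong[OF refl])
      fix c
      have "(LBINT l. complex_of_real (m l) * complex_of_real (\<tau> * k (\<tau> * (l - c)))) = of_real (LBINT l. \<tau> * (m l * k (\<tau> * (l - c))))"
        unfolding integral_complex_of_real[symmetric] by (rule Bochner_Integration.integral_cong) auto
      then show "indicator {a..b} c * (LBINT l. complex_of_real (m l) * complex_of_real (\<tau> * k (\<tau> * (l - c)))) 
        = complex_of_real (indicator {a..b} c * (\<tau> * (LBINT l. m l * k (\<tau> * (l - c)))))"
        by (simp split: split_indicator)
    qed
    finally have "(LBINT l. m l * J n l) = (LBINT c. indicator {a..b} c * (\<tau> * (LBINT l. m l * k (\<tau> * (l - c)))))"
      unfolding integral_complex_of_real of_real_eq_iff .
    also have "0 \<le> \<dots>"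
      using pos[OF \<tau>] \<tau> by (intro integral_nonneg_AE) (auto simp: k_def intro!: mult_nonneg_nonneg)
    finally show ?thesis .
  qed
  have "(\<lambda>n. LBINT l. m l * J n l) \<longlonglongrightarrow> (LBINT l. m l * (indicator {a..b} l * (2 * pi)))"
  proof (rule integral_dominated_convergence)
    show "integrable lborel (\<lambda>l. 2 * pi * \<bar>m l\<bar>)" using m by simp
    show "AE l in lborel. (\<lambda>n. m l * J n l) \<longlonglongrightarrow> m l * (indicator {a..b} l * (2 * pi))"
      using AE_lborel_singleton[of a] AE_lborel_singleton[of b]
      by eventually_elim (intro tendsto_intros J, auto)
    show "AE l in lborel. norm (m l * J n l) \<le> 2 * pi * \<bar>m l\<bar>" for n
      using mult_left_mono[OF J(2), of "\<bar>m _\<bar>" n] by (auto simp: abs_mult mult_ac)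
  qed auto
  then have "0 \<le> (LBINT l. m l * (indicator {a..b} l * (2 * pi)))"
    by (rule LIMSEQ_le_const) (use nn in blast)
  also have "(LBINT l. m l * (indicator {a..b} l * (2 * pi))) = 2 * pi * (LBINT l. indicator {a..b} l * m l)"
    unfolding integral_mult_right_zero[symmetric] by (rule Bochner_Integration.integral_cong) auto
  finally show "0 \<le> (LBINT l. indicator {a..b} l * m l)"
    using pi_gt_zero by (auto simp: zero_le_mult_iff dest: leD)
qed

text \<open>By the identity theorem a nontrivial entire function has only countably many
  zeros.\<close>

lemma entire_nonzero_AE_real:
  assumes "\<gamma> holomorphic_on UNIV" "\<gamma> z \<noteq> 0"
  shows "AE l in lborel. \<gamma> (complex_of_real l) \<noteq> 0"
proof -
  have c: "countable {z. \<gamma> z = 0}"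
  proof (rule ccontr)
    assume "uncountable {z. \<gamma> z = 0}"
    then have "\<gamma> = (\<lambda>z. 0)" by (intro holomorphic_countable_equal_UNIV assms) auto
    then show False using assms(2) by simp
  qed
  have "countable (complex_of_real -` {z. \<gamma> z = 0})"
  proof (rule countable_image_inj_on)
    show "countable (complex_of_real ` (complex_of_real -` {z. \<gamma> z = 0}))"
      by (rule countable_subset[OF _ c]) auto
  qed (auto simp: inj_on_def)
  then have "complex_of_real -` {z. \<gamma> z = 0} \<in> null_sets lborel" by (rule countable_imp_null_set_lborel)
  then show ?thesis by (rule AE_not_in[THEN AE_mp]) auto
qed

text \<open>\<gamma> is integrable because its modulus is at most the sum of the minimality
  integrand and \<open>f + g\<close>; being the transform of an integrable function it is bounded,
  hence also in \<open>L2\<close>. Inversion recovers \<alpha> on the half line from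
  \<open>ift \<gamma>\<close>, and continuity removes the exceptional negative times.\<close>

lemma minimality_function:
  assumes m: "minimality_condition f g" and fi: "integrable lborel f" "integrable lborel g"
    and nn: "\<And>l. 0 \<le> f l" "\<And>l. 0 \<le> g l"
  obtains \<gamma> where "L12 \<gamma>" "\<And>t. t < 0 \<Longrightarrow> ift \<gamma> t = 0" "AE l in lborel. \<gamma> l \<noteq> 0"
    "integrable lborel (\<lambda>l. (cmod (\<gamma> l))\<^sup>2 / (f l + g l))" "AE l in lborel. 0 < f l + g l"
proof -
  have [measurable]: "f \<in> borel_measurable borel" "g \<in> borel_measurable borel" using fi by auto
  obtain \<gamma>c \<alpha> z where \<gamma>c: "\<gamma>c holomorphic_on UNIV" "\<gamma>c z \<noteq> 0" "set_integrable lborel {0..} \<alpha>"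
    "\<And>l. \<gamma>c (of_real l) = (LBINT t:{0..}. \<alpha> t * cis (t * l))"
    "(\<integral>\<^sup>+l. ennreal ((cmod (\<gamma>c (of_real l)))\<^sup>2) / ennreal (f l + g l) \<partial>lborel) < \<infinity>"
    using m unfolding minimality_condition_def by blast
  define \<gamma> where "\<gamma> l = \<gamma>c (complex_of_real l)" for l
  define \<alpha>1 where "\<alpha>1 t = indicator {0..} t * \<alpha> t" for t :: real
  have "(\<lambda>t. indicator {0..} t *\<^sub>R \<alpha> t) = \<alpha>1" by (auto simp: \<alpha>1_def fun_eq_iff split: split_indicator)
  then have \<alpha>1: "integrable lborel \<alpha>1" using \<gamma>c(3) by (simp add: set_integrable_def)
  have \<gamma>ft: "\<gamma> = ft \<alpha>1"
    unfolding \<gamma>_def \<gamma>c(4) ft_def set_lebesgue_integral_def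
    by (rule ext, rule Bochner_Integration.integral_cong) (auto simp: \<alpha>1_def split: split_indicator)
  have [measurable]: "\<gamma> \<in> borel_measurable borel" unfolding \<gamma>ft using \<alpha>1 by auto
  have nz: "AE l in lborel. \<gamma> l \<noteq> 0" unfolding \<gamma>_def by (rule entire_nonzero_AE_real[OF \<gamma>c(1,2)])
  have fin: "AE l in lborel. ennreal ((cmod (\<gamma> l))\<^sup>2) / ennreal (f l + g l) \<noteq> \<infinity>"
    by (rule nn_integral_noteq_infinite) (use \<gamma>c(5) in \<open>auto simp: \<gamma>_def[symmetric]\<close>)
  \<comment> \<open>In \<open>ennreal\<close> a positive number divided by 0 is infinite, so
    finiteness almost everywhere excludes zeros of \<open>f + g\<close> away from the null set of
    zeros of \<gamma>.\<close>
  have pos: "AE l in lborel. 0 < f l + g l"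
    using fin nz
  proof eventually_elim
    case (elim l)
    show ?case
    proof (rule ccontr)
      assume "\<not> 0 < f l + g l"
      then have "ennreal (f l + g l) = 0" by (simp add: ennreal_neg)
      then show False using elim by (simp add: ennreal_divide_zero)
    qed
  qed
  have int: "integrable lborel (\<lambda>l. (cmod (\<gamma> l))\<^sup>2 / (f l + g l))"
  proof (rule integrableI_bounded)
    have "(\<integral>\<^sup>+l. ennreal (norm ((cmod (\<gamma> l))\<^sup>2 / (f l + g l))) \<partial>lborel) = (\<integral>\<^sup>+l. ennreal ((cmod (\<gamma> l))\<^sup>2) / ennreal (f l + g l) \<partial>lborel)"
      using pos by (intro nn_integral_cong_AE) (auto elim!: eventually_mono simp: divide_ennreal)
    then show "(\<integral>\<^sup>+l. ennreal (norm ((cmod (\<gamma> l))\<^sup>2 / (f l + g l))) \<partial>lborel) < \<infinity>"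
      using \<gamma>c(5) by (simp add: \<gamma>_def)
  qed measurable
  have \<gamma>int: "integrable lborel \<gamma>"
  proof (rule Bochner_Integration.integrable_bound)
    show "integrable lborel (\<lambda>l. (cmod (\<gamma> l))\<^sup>2 / (f l + g l) + (f l + g l))" using int fi by simp
    show "AE l in lborel. norm (\<gamma> l) \<le> norm ((cmod (\<gamma> l))\<^sup>2 / (f l + g l) + (f l + g l))"
      using pos
    proof eventually_elim
      case (elim l)
      have "2 * cmod (\<gamma> l) * (f l + g l) \<le> (cmod (\<gamma> l))\<^sup>2 + (f l + g l)\<^sup>2" by (rule sum_squares_bound)
      moreover have "0 \<le> cmod (\<gamma> l) * (f l + g l)" using elim by (intro mult_nonneg_nonneg) auto
      ultimately have "cmod (\<gamma> l) * (f l + g l) \<le> (cmod (\<gamma> l))\<^sup>2 + (f l + g l)\<^sup>2" by linarith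
      then have "cmod (\<gamma> l) \<le> ((cmod (\<gamma> l))\<^sup>2 + (f l + g l)\<^sup>2) / (f l + g l)" using elim by (simp add: pos_le_divide_eq)
      also have "\<dots> = (cmod (\<gamma> l))\<^sup>2 / (f l + g l) + (f l + g l)" using elim
        by (simp add: add_divide_distrib power2_eq_square[of "f l + g l"])
      finally show ?case by simp
    qed
  qed measurable
  have L12: "L12 \<gamma>"
    unfolding L12_def
  proof
    show "\<gamma> \<in> L2 lborel"
    proof (rule L2I)
      have "integrable lborel (\<lambda>l. \<gamma> l * cnj (\<gamma> l))"
        by (rule integrable_mult_bounded[OF \<gamma>int, of _ "LBINT t. cmod (\<alpha>1 t)"]) (use ft_bound[OF \<alpha>1] in \<open>auto simp flip: \<gamma>ft\<close>)
      then have "integrable lborel (\<lambda>l. complex_of_real ((cmod (\<gamma> l))\<^sup>2))" by (simp only: complex_norm_square)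
      then show "integrable lborel (\<lambda>l. (cmod (\<gamma> l))\<^sup>2)" by (simp only: complex_of_real_integrable_eq)
    qed measurable
  qed (rule \<gamma>int)
  have "AE t in lborel. \<alpha>1 t = ift \<gamma> t" unfolding \<gamma>ft by (rule L1_inversion[OF \<alpha>1 \<gamma>int[unfolded \<gamma>ft]])
  then have AE0: "AE t in lborel. t \<in> {..<0} \<longrightarrow> ift \<gamma> t = 0"
    by eventually_elim (auto simp: \<alpha>1_def split: split_indicator_asm)
  have "ift \<gamma> t = 0" if "t < 0" for t
    by (rule continuous_AE_zero_imp_zero[OF ift_continuous[OF \<gamma>int] _ AE0]) (use that in auto)
  then show ?thesis using that L12 nz int pos by blast
qed

context filtering
begin

text \<open>Multiplying \<open>\<gamma>\<close> by the transform of \<open>\<psi>\<close>, supported on \<open>[0, \<tau>]\<close>, keeps the inverse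
  transform on \<open>[0, \<infinity>) \<subseteq> T\<close>, so coercivity applies to it whatever the gaps are.\<close>

lemma density_bounded:
  assumes inv: "B_invertible s N K f g" and m: "minimality_condition f g"
  obtains \<kappa> where "0 \<le> \<kappa>" "AE l in lborel. f l + g l \<le> \<kappa>"
proof -
  obtain \<gamma> where \<gamma>: "L12 \<gamma>" "\<And>t. t < 0 \<Longrightarrow> ift \<gamma> t = 0" "AE l in lborel. \<gamma> l \<noteq> 0"
    "integrable lborel (\<lambda>l. (cmod (\<gamma> l))\<^sup>2 / (f l + g l))"
    using minimality_function[OF m f_int g_int f_nonneg g_nonneg] by blast
  obtain \<kappa> where \<kappa>: "0 \<le> \<kappa>"
    "\<And>z Z. z \<in> L2_T \<Longrightarrow> wFT (W z) Z \<Longrightarrow> V Z \<in> L2 lborel \<Longrightarrow>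
       Re (inner_T z z) \<le> \<kappa> * (nrm lborel (V Z))\<^sup>2"
    using coercive[OF inv] by blast
  have [measurable]: "\<gamma> \<in> borel_measurable borel" using L12D(1)[OF \<gamma>(1)] by auto
  \<comment> \<open>Chosen so that coercivity on \<open>G = \<gamma> * ft \<psi>\<close> says that
    the integral of \<open>m\<close> against \<open>(cmod (ft \<psi> l))\<^sup>2\<close> is
    nonnegative. Where \<gamma> is not 0, \<open>0 \<le> m l\<close> means
    \<open>f l + g l \<le> 2 * pi * \<kappa>\<close>; the \<open>2 * pi\<close> stems from
    \<open>nrm_ift\<close>.\<close>
  define m where "m l = 2 * pi * \<kappa> * ((cmod (\<gamma> l))\<^sup>2 / (f l + g l)) - (cmod (\<gamma> l))\<^sup>2" for l
  have mi: "integrable lborel m"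
    unfolding m_def
    by (intro Bochner_Integration.integrable_diff integrable_mult_right \<gamma>(4) L2_integrable[OF L12D(2)[OF \<gamma>(1)]])
  have "AE l in lborel. 0 \<le> m l"
  proof (rule AE_nonneg_of_fejer[OF mi])
    fix \<tau> c :: real assume \<tau>: "0 < \<tau>"
    define \<psi> where "\<psi> s = indicator {0..\<tau>} s * cis (- (c * s))" for s
    have \<psi>: "L12 \<psi>" unfolding \<psi>_def by (rule L12_mult_bounded[OF L12_indicator, of _ 1]) auto
    then have [measurable]: "\<psi> \<in> borel_measurable borel" by (auto simp: L12_def)
    define G where "G l = \<gamma> l * ft \<psi> l" for l
    define M where "M = (LBINT t. cmod (\<psi> t))"
    have G: "L12 G" unfolding G_def by (rule L12_mult_bounded[OF \<gamma>(1), of _ M]) (auto simp: M_def ft_bound \<psi> L12D)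
    have [measurable]: "G \<in> borel_measurable borel" unfolding G_def by measurable
    have zero: "ift G t = 0" if "t < 0" for t
      unfolding G_def by (rule ift_mult_half_line) (use \<gamma> \<psi> that in \<open>auto simp: L12_def \<psi>_def\<close>)
    have W: "wFT (W (ift G)) G" by (rule wFT_W_half_line[OF wFT_ift[OF G] zero])
    have z: "ift G \<in> L2 lborel" by (rule ift_L2_bound[OF G])
    have Vsq: "(cmod (V G l))\<^sup>2 = (cmod (G l))\<^sup>2 / (f l + g l)" for l
      using f_nonneg[of l] g_nonneg[of l] by (simp add: V_def norm_divide power_divide)
    have i1: "integrable lborel (\<lambda>l. (cmod (G l))\<^sup>2 / (f l + g l))"
    proof (rule Bochner_Integration.integrable_bound)
      show "integrable lborel (\<lambda>l. M\<^sup>2 * ((cmod (\<gamma> l))\<^sup>2 / (f l + g l)))" by (rule integrable_mult_right[OF \<gamma>(4)])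
      have "(cmod (G l))\<^sup>2 / (f l + g l) \<le> M\<^sup>2 * ((cmod (\<gamma> l))\<^sup>2 / (f l + g l))" for l
      proof -
        have "(cmod (G l))\<^sup>2 \<le> M\<^sup>2 * (cmod (\<gamma> l))\<^sup>2"
          unfolding G_def norm_mult power_mult_distrib M_def
          using mult_right_mono[OF power_mono[OF ft_bound[OF L12D(1)[OF \<psi>], of l] norm_ge_zero, of 2], of "(cmod (\<gamma> l))\<^sup>2"]
          by (simp add: mult.commute)
        then show ?thesis using divide_right_mono[of "(cmod (G l))\<^sup>2" "M\<^sup>2 * (cmod (\<gamma> l))\<^sup>2" "f l + g l"]
          f_nonneg[of l] g_nonneg[of l] by simp
      qed
      then show "AE l in lborel. norm ((cmod (G l))\<^sup>2 / (f l + g l)) \<le> norm (M\<^sup>2 * ((cmod (\<gamma> l))\<^sup>2 / (f l + g l)))"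
        using f_nonneg g_nonneg by (auto intro!: AE_I2 simp: abs_mult)
    qed measurable
    have VG: "V G \<in> L2 lborel" by (rule L2I) (auto simp: Vsq i1)
    \<comment> \<open>\<open>ift G\<close> lives on the half line, where the weight is 1 almost
      everywhere.\<close>
    have "Re (inner_T (ift G) (ift G)) = (nrm lborel (ift G))\<^sup>2"
    proof -
      have "inner_T (ift G) (ift G) = ip lborel (ift G) (W (ift G))" by (rule T_inner_ip'[OF z L2T_I[OF z]])
      also have "\<dots> = ip lborel (ift G) (ift G)"
        unfolding ip_def
      proof (rule integral_cong_AE)
        show "AE t in lborel. ift G t * cnj (W (ift G) t) = ift G t * cnj (ift G t)"
          using AE_lborel_singleton[of 0]
        proof eventually_elim
          case (elim t)
          then show ?case using zero[of t] wt_positive[of t] by (cases "t < 0") (auto simp: W_def)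
        qed
      qed (auto simp: W_def[abs_def])
      finally show ?thesis by (simp add: ip_self del: of_real_power)
    qed
    then have "(nrm lborel G)\<^sup>2 / (2 * pi) \<le> \<kappa> * (nrm lborel (V G))\<^sup>2"
      using \<kappa>(2)[OF L2T_I[OF z] W VG] nrm_ift[OF G] by simp
    then have "0 \<le> 2 * pi * \<kappa> * (nrm lborel (V G))\<^sup>2 - (nrm lborel G)\<^sup>2" by (simp add: field_simps)
    also have "\<dots> = (LBINT l. 2 * pi * \<kappa> * ((cmod (G l))\<^sup>2 / (f l + g l)) - (cmod (G l))\<^sup>2)"
      unfolding nrm_sq Vsq integral_mult_right_zero[symmetric]
      by (rule Bochner_Integration.integral_diff[symmetric])
         (intro integrable_mult_right i1 L2_integrable[OF L12D(2)[OF G]])+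
    also have "\<dots> = (LBINT l. \<tau>\<^sup>2 * (m l * (cmod (ft (indicator {0..1}) (\<tau> * (l - c))))\<^sup>2))"
      unfolding m_def G_def \<psi>_def ft_scaled_indicator[OF \<tau>]
      using \<tau> by (intro Bochner_Integration.integral_cong) (auto simp: norm_mult power_mult_distrib algebra_simps)
    finally show "0 \<le> (LBINT l. m l * (cmod (ft (indicator {0..1}) (\<tau> * (l - c))))\<^sup>2)"
      using \<tau> by (simp add: zero_le_mult_iff)
  qed
  then have "AE l in lborel. f l + g l \<le> 2 * pi * \<kappa>"
    using \<gamma>(3) fg_pos
  proof eventually_elim
    case (elim l)
    have "(cmod (\<gamma> l))\<^sup>2 * (f l + g l) \<le> (cmod (\<gamma> l))\<^sup>2 * (2 * pi * \<kappa>)"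
      using elim by (simp add: m_def field_simps)
    then show ?case using elim by simp
  qed
  then show ?thesis using that[of "2 * pi * \<kappa>"] \<kappa>(1) by simp
qed

end

section \<open>Stochastic integrals and closed spans\<close>

abbreviation mu :: "(real \<Rightarrow> real) \<Rightarrow> real measure" where
  "mu p \<equiv> density lborel (\<lambda>l. ennreal (p l))"

lemma mu_facts:
  assumes p: "integrable lborel p" "\<And>l. 0 \<le> p l"
  shows mu_L2_iff: "h \<in> borel_measurable borel \<Longrightarrow> h \<in> L2 (mu p) \<longleftrightarrow> integrable lborel (\<lambda>l. p l * (cmod (h l))\<^sup>2)"
    and mu_ip: "X \<in> borel_measurable borel \<Longrightarrow> Y \<in> borel_measurable borel \<Longrightarrow> ip (mu p) X Y = (LBINT l. of_real (p l) * (X l * cnj (Y l)))"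
    and mu_nrm: "X \<in> borel_measurable borel \<Longrightarrow> (nrm (mu p) X)\<^sup>2 = (LBINT l. p l * (cmod (X l))\<^sup>2)"
    and mu_L2_bounded: "h \<in> borel_measurable borel \<Longrightarrow> (\<And>l. cmod (h l) \<le> B) \<Longrightarrow> h \<in> L2 (mu p)"
proof -
  have [measurable]: "p \<in> borel_measurable borel" using p by auto
  show 1: "h \<in> L2 (mu p) \<longleftrightarrow> integrable lborel (\<lambda>l. p l * (cmod (h l))\<^sup>2)" if [measurable]: "h \<in> borel_measurable borel" for h
    unfolding L2_def using p by (simp add: integrable_density)
  show "ip (mu p) X Y = (LBINT l. of_real (p l) * (X l * cnj (Y l)))" 
    if [measurable]: "X \<in> borel_measurable borel" "Y \<in> borel_measurable borel"
    unfolding ip_def using p by (subst integral_density) (auto simp: scaleR_conv_of_real)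
  show "(nrm (mu p) X)\<^sup>2 = (LBINT l. p l * (cmod (X l))\<^sup>2)" if [measurable]: "X \<in> borel_measurable borel"
    unfolding nrm_sq using p by (subst integral_density) auto
  show "h \<in> L2 (mu p)" if [measurable]: "h \<in> borel_measurable borel" and B: "\<And>l. cmod (h l) \<le> B"
    unfolding 1[OF that(1)]
  proof (rule Bochner_Integration.integrable_bound)
    show "integrable lborel (\<lambda>l. B\<^sup>2 * p l)" using p by simp
    show "AE l in lborel. norm (p l * (cmod (h l))\<^sup>2) \<le> norm (B\<^sup>2 * p l)"
      using mult_left_mono[OF power_mono[OF B norm_ge_zero], of "p _" _ 2] p
      by (auto intro!: AE_I2 simp: abs_mult mult.commute)
  qed measurable
qed

lemma cis_mu_L2: "integrable lborel p \<Longrightarrow> (\<And>l. 0 \<le> p l) \<Longrightarrow> (\<lambda>l. cis (t * l)) \<in> L2 (mu p)"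
  by (rule mu_L2_bounded[of _ _ 1]) auto

lemma mu_mono:
  assumes "integrable lborel p" "\<And>l. 0 \<le> p l" "integrable lborel q" "\<And>l. 0 \<le> q l" "\<And>l. p l \<le> q l"
    and X: "X \<in> L2 (mu q)"
  shows "X \<in> L2 (mu p)" "nrm (mu p) X \<le> nrm (mu q) X"
proof -
  have [measurable]: "X \<in> borel_measurable borel" "p \<in> borel_measurable borel" using X assms by (auto simp: L2_def)
  have q: "integrable lborel (\<lambda>l. q l * (cmod (X l))\<^sup>2)" using X mu_L2_iff[OF assms(3,4), of X] by simp
  have p: "integrable lborel (\<lambda>l. p l * (cmod (X l))\<^sup>2)"
    by (rule Bochner_Integration.integrable_bound[OF q]) (use assms in \<open>auto simp: abs_mult intro!: mult_right_mono\<close>)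
  then show "X \<in> L2 (mu p)" using mu_L2_iff[OF assms(1,2), of X] by simp
  have "(nrm (mu p) X)\<^sup>2 \<le> (nrm (mu q) X)\<^sup>2"
    using mu_nrm[OF assms(1,2), of X] mu_nrm[OF assms(3,4), of X] assms(5)
    by simp (rule integral_mono[OF p q], auto intro!: mult_right_mono)
  then show "nrm (mu p) X \<le> nrm (mu q) X" by (rule power2_le_imp_le) (rule nrm_nonneg)
qed

lemma simple_function_finite_range: "simple_function borel (\<phi> :: real \<Rightarrow> complex) \<Longrightarrow> finite (range \<phi>)"
  using simple_functionD(1)[of borel \<phi>] by simp

lemma simple_function_L2:
  assumes "integrable lborel p" "\<And>l. 0 \<le> p l" "simple_function borel (\<phi> :: real \<Rightarrow> complex)"
  shows "\<phi> \<in> L2 (mu p)"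
proof (rule mu_L2_bounded[OF assms(1,2)])
  show "\<phi> \<in> borel_measurable borel" using assms(3) by (rule borel_measurable_simple_function)
  show "cmod (\<phi> l) \<le> Max (cmod ` range \<phi>)" for l
    using simple_function_finite_range[OF assms(3)] by (intro Max_ge) auto
qed

lemma simple_stoch_integral_L2:
  assumes "orthogonal_stochastic_measure P Z p" "simple_function borel (\<phi> :: real \<Rightarrow> complex)"
  shows "simple_stoch_integral Z \<phi> \<in> L2 P"
proof -
  have "\<phi> -` {y} \<in> sets borel" for y using simple_functionD(2)[OF assms(2), of "{y}"] by simp
  then show ?thesis
    unfolding simple_stoch_integral_def[abs_def]
    using assms(1) by (auto intro!: L2_sum L2_mult_left simp: orthogonal_stochastic_measure_def)
qed

text \<open>Both sides expand over the values of the two functions; the entries then agree by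
  orthogonality of the measure on level sets.\<close>

lemma simple_stoch_integral_ip:
  assumes p: "integrable lborel p" "\<And>l. 0 \<le> p l" and Z: "orthogonal_stochastic_measure P Z p"
    and \<phi>: "simple_function borel (\<phi> :: real \<Rightarrow> complex)" and \<psi>: "simple_function borel (\<psi> :: real \<Rightarrow> complex)"
  shows "ip P (simple_stoch_integral Z \<phi>) (simple_stoch_integral Z \<psi>) = of_real (1 / (2 * pi)) * ip (mu p) \<phi> \<psi>"
proof -
  have [measurable]: "p \<in> borel_measurable borel" using p by auto
  have s: "\<phi> -` {y} \<in> sets borel" "\<psi> -` {y} \<in> sets borel" for y
    using simple_functionD(2)[OF \<phi>, of "{y}"] simple_functionD(2)[OF \<psi>, of "{y}"] by simp_all
  have ZL: "Z D \<in> L2 P" if "D \<in> sets borel" for D using Z that by (simp add: orthogonal_stochastic_measure_def)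
  have rep: "F = (\<lambda>l. \<Sum>y\<in>range F. y * indicator (F -` {y}) l)" if "simple_function borel F" for F :: "real \<Rightarrow> complex"
  proof
    fix l
    have "(\<Sum>y\<in>range F. y * indicator (F -` {y}) l) = (\<Sum>y\<in>range F. if y = F l then F l else 0)"
      by (rule sum.cong) (auto split: split_indicator)
    then show "F l = (\<Sum>y\<in>range F. y * indicator (F -` {y}) l)"
      using simple_function_finite_range[OF that] by simp
  qed
  have IL: "indicator D \<in> L2 (mu p)" if "D \<in> sets borel" for D
    using that by (intro mu_L2_bounded[OF p, of _ 1]) (auto split: split_indicator)
  have ZZ: "ip P (Z D) (Z D') = of_real (1 / (2 * pi)) * ip (mu p) (indicator D) (indicator D')"
    if [measurable]: "D \<in> sets borel" "D' \<in> sets borel" for D D'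
  proof -
    have "ip (mu p) (indicator D) (indicator D') = (LBINT l. complex_of_real (indicator (D \<inter> D') l *\<^sub>R p l))"
      by (subst mu_ip[OF p]) (auto intro!: Bochner_Integration.integral_cong split: split_indicator)
    also have "\<dots> = of_real (LBINT l:D \<inter> D'. p l)" by (simp only: integral_complex_of_real set_lebesgue_integral_def)
    finally show ?thesis
      using Z that unfolding orthogonal_stochastic_measure_def ip_def by simp
  qed
  have "ip P (simple_stoch_integral Z \<phi>) (simple_stoch_integral Z \<psi>)
     = (\<Sum>y\<in>range \<phi>. y * (\<Sum>y'\<in>range \<psi>. cnj y' * ip P (Z (\<phi> -` {y})) (Z (\<psi> -` {y'}))))"
    unfolding simple_stoch_integral_def[abs_def]
    by (subst ip_sum_left) (auto intro!: ZL s L2_sum L2_mult_left sum.cong simp: ip_sum_right ZL s)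
  also have "\<dots> = of_real (1 / (2 * pi)) * (\<Sum>y\<in>range \<phi>. y * (\<Sum>y'\<in>range \<psi>. cnj y' * ip (mu p) (indicator (\<phi> -` {y})) (indicator (\<psi> -` {y'}))))"
    by (simp only: ZZ s sum_distrib_left mult_ac)
  also have "(\<Sum>y\<in>range \<phi>. y * (\<Sum>y'\<in>range \<psi>. cnj y' * ip (mu p) (indicator (\<phi> -` {y})) (indicator (\<psi> -` {y'})))) = ip (mu p) \<phi> \<psi>"
    by (subst (2) rep[OF \<phi>], subst (2) rep[OF \<psi>], subst ip_sum_left)
       (auto intro!: IL s L2_sum L2_mult_left sum.cong simp: ip_sum_right IL s)
  finally show ?thesis .
qed

lemma stationary_ip:
  assumes p: "integrable lborel p" "\<And>l. 0 \<le> p l"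
    and X: "stationary_process P X" "has_spectral_density P X p"
  shows "ip P (X t) (X u) = of_real (1 / (2 * pi)) * ip (mu p) (\<lambda>l. cis (t * l)) (\<lambda>l. cis (u * l))"
proof -
  have "ip P (X t) (X u) = (LINT w|P. X ((t - u) + u) w * cnj (X u w))" by (simp add: ip_def)
  also have "\<dots> = (LINT w|P. X (t - u) w * cnj (X 0 w))" using X(1) by (simp only: stationary_process_def)
  also have "\<dots> = (LBINT l. cis ((t - u) * l) * p l) / (2 * pi)" using X(2) by (simp add: has_spectral_density_def)
  also have "(LBINT l. cis ((t - u) * l) * p l) = ip (mu p) (\<lambda>l. cis (t * l)) (\<lambda>l. cis (u * l))"
    by (subst mu_ip[OF p]) (auto simp: cis_cnj cis_mult algebra_simps)
  finally show ?thesis by simp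
qed

lemma simple_function_mu: "simple_function (mu p) F \<longleftrightarrow> simple_function borel F"
  by (rule simple_function_cong_algebra) auto

text \<open>A simple stochastic integral and the process values form one family whose Gram matrix is
  \<open>1 / (2 * pi)\<close> times the one in \<open>mu p\<close>. The mixed entries come from
  approximating \<open>X t\<close> by simple stochastic integrals, as the spectral representation
  allows.\<close>

lemma stochastic_isometry:
  assumes p: "integrable lborel p" "\<And>l. 0 \<le> p l"
    and X: "stationary_process P X" "has_spectral_density P X p" "spectral_representation P X Z p"
    and \<phi>: "simple_function borel \<phi>" and J: "finite J"
  shows "nrm P (\<lambda>w. simple_stoch_integral Z \<phi> w - (\<Sum>t\<in>J. b t * X t w))
    = nrm (mu p) (\<lambda>l. \<phi> l - (\<Sum>t\<in>J. b t * cis (t * l))) / sqrt (2 * pi)"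
proof -
  have Z: "orthogonal_stochastic_measure P Z p" using X by (simp add: spectral_representation_def)
  have XL: "X t \<in> L2 P" for t using X by (simp add: stationary_process_def)
  note cL = cis_mu_L2[OF p]
  have IX: "ip P (simple_stoch_integral Z \<phi>) (X t) = of_real (1 / (2 * pi)) * ip (mu p) \<phi> (\<lambda>l. cis (t * l))" for t
  proof -
    have "has_stoch_integral P Z p (\<lambda>l. cis (t * l)) (X t)" using X by (simp add: spectral_representation_def)
    then obtain \<psi> where \<psi>: "\<And>n. simple_function borel (\<psi> n)" "L2_tendsto (mu p) \<psi> (\<lambda>l. cis (t * l))"
      "L2_tendsto P (\<lambda>n. simple_stoch_integral Z (\<psi> n)) (X t)"
      unfolding has_stoch_integral_def by blast
    have \<psi>L: "\<psi> n \<in> L2 (mu p)" "simple_stoch_integral Z (\<psi> n) \<in> L2 P" for n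
      by (rule simple_function_L2[OF p \<psi>(1)], rule simple_stoch_integral_L2[OF Z \<psi>(1)])
    have "(\<lambda>n. ip P (simple_stoch_integral Z (\<psi> n)) (simple_stoch_integral Z \<phi>)) \<longlonglongrightarrow> ip P (X t) (simple_stoch_integral Z \<phi>)"
      by (rule ip_tendsto[OF \<psi>L(2) XL _ simple_stoch_integral_L2[OF Z \<phi>]])
         (use \<psi>(3) in \<open>simp add: L2_tendsto_iff \<psi>L XL\<close>)
    moreover have "(\<lambda>n. of_real (1 / (2 * pi)) * ip (mu p) (\<psi> n) \<phi>) \<longlonglongrightarrow> of_real (1 / (2 * pi)) * ip (mu p) (\<lambda>l. cis (t * l)) \<phi>"
      by (intro tendsto_mult tendsto_const ip_tendsto[OF \<psi>L(1) cL _ simple_function_L2[OF p \<phi>]])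
         (use \<psi>(2) in \<open>simp add: L2_tendsto_iff \<psi>L cL\<close>)
    moreover have "ip P (simple_stoch_integral Z (\<psi> n)) (simple_stoch_integral Z \<phi>) = of_real (1 / (2 * pi)) * ip (mu p) (\<psi> n) \<phi>" for n
      by (rule simple_stoch_integral_ip[OF p Z \<psi>(1) \<phi>])
    ultimately have "ip P (X t) (simple_stoch_integral Z \<phi>) = of_real (1 / (2 * pi)) * ip (mu p) (\<lambda>l. cis (t * l)) \<phi>"
      using LIMSEQ_unique by (simp only:)
    then have "cnj (ip P (X t) (simple_stoch_integral Z \<phi>)) = cnj (of_real (1 / (2 * pi)) * ip (mu p) (\<lambda>l. cis (t * l)) \<phi>)"
      by (rule arg_cong)
    then show ?thesis by (simp only: ip_commute[symmetric] complex_cnj_mult complex_cnj_complex_of_real)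
  qed
  \<comment> \<open>\<open>None\<close> stands for the stochastic integral and \<open>Some t\<close>
    for the process at \<open>t\<close>. With coefficients 1 and \<open>- b t\<close>, one
    application of \<open>gram_isometry\<close> covers the whole difference.\<close>
  define u where "u i = (case i of None \<Rightarrow> simple_stoch_integral Z \<phi> | Some t \<Rightarrow> X t)" for i
  define v where "v i = (case i of None \<Rightarrow> \<phi> | Some t \<Rightarrow> (\<lambda>l. cis (t * l)))" for i
  define c where "c i = (case i of None \<Rightarrow> 1 | Some t \<Rightarrow> - b t)" for i
  let ?J = "insert None (Some ` J)"
  have "(nrm P (\<lambda>w. \<Sum>i\<in>?J. c i * u i w))\<^sup>2 = (1 / (2 * pi)) * (nrm (mu p) (\<lambda>l. \<Sum>i\<in>?J. c i * v i l))\<^sup>2"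
  proof (rule gram_isometry)
    show "u i \<in> L2 P" for i
      unfolding u_def using XL simple_stoch_integral_L2[OF Z \<phi>] by (auto split: option.split)
    show "v i \<in> L2 (mu p)" for i
      unfolding v_def using cL simple_function_L2[OF p \<phi>] by (auto split: option.split)
    show "ip P (u i) (u j) = of_real (1 / (2 * pi)) * ip (mu p) (v i) (v j)" for i j
    proof -
      have XI: "ip P (X t) (simple_stoch_integral Z \<phi>) = of_real (1 / (2 * pi)) * ip (mu p) (\<lambda>l. cis (t * l)) \<phi>" for t
        unfolding ip_commute[of P "X t"] IX by (simp flip: ip_commute)
      show ?thesis
        unfolding u_def v_def
        using IX XI simple_stoch_integral_ip[OF p Z \<phi> \<phi>] stationary_ip[OF p X(1,2)]
        by (cases i; cases j) (simp_all only: option.case)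
    qed
  qed
  moreover have "(\<Sum>i\<in>?J. c i * u i w) = simple_stoch_integral Z \<phi> w - (\<Sum>t\<in>J. b t * X t w)" for w
    using J by (simp add: sum.reindex c_def u_def sum_negf)
  moreover have "(\<Sum>i\<in>?J. c i * v i l) = \<phi> l - (\<Sum>t\<in>J. b t * cis (t * l))" for l
    using J by (simp add: sum.reindex c_def v_def sum_negf)
  ultimately have "(nrm P (\<lambda>w. simple_stoch_integral Z \<phi> w - (\<Sum>t\<in>J. b t * X t w)))\<^sup>2
    = (nrm (mu p) (\<lambda>l. \<phi> l - (\<Sum>t\<in>J. b t * cis (t * l))) / sqrt (2 * pi))\<^sup>2"
    by (simp add: power_divide)
  then show ?thesis by (rule power2_eq_imp_eq) (auto simp: nrm_nonneg)
qed

lemma closed_span_sequence: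
  assumes Y: "Y \<in> L2_closed_span M I X" and X: "\<And>t. X t \<in> L2 M"
  obtains J b where "\<And>n. finite (J n)" "\<And>n. J n \<subseteq> I"
    "(\<lambda>n. nrm M (\<lambda>w. (\<Sum>t\<in>J n. b n t * X t w) - Y w)) \<longlonglongrightarrow> 0"
proof -
  have YL: "Y \<in> L2 M" using Y by (simp add: L2_closed_span_def)
  have "\<forall>n. \<exists>J b. finite J \<and> J \<subseteq> I \<and> (\<integral>\<^sup>+w. ennreal ((cmod (Y w - (\<Sum>t\<in>J. b t * X t w)))\<^sup>2) \<partial>M) < ennreal (inverse (real (Suc n)))"
  proof
    fix n
    have "0 < inverse (real (Suc n))" by simp
    with Y show "\<exists>J b. finite J \<and> J \<subseteq> I \<and> (\<integral>\<^sup>+w. ennreal ((cmod (Y w - (\<Sum>t\<in>J. b t * X t w)))\<^sup>2) \<partial>M) < ennreal (inverse (real (Suc n)))"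
      unfolding L2_closed_span_def by blast
  qed
  from choice[OF this] obtain J where J: "\<forall>n. \<exists>b. finite (J n) \<and> J n \<subseteq> I \<and>
      (\<integral>\<^sup>+w. ennreal ((cmod (Y w - (\<Sum>t\<in>J n. b t * X t w)))\<^sup>2) \<partial>M) < ennreal (inverse (real (Suc n)))" ..
  from choice[OF this] obtain b where b: "\<forall>n. finite (J n) \<and> J n \<subseteq> I \<and>
      (\<integral>\<^sup>+w. ennreal ((cmod (Y w - (\<Sum>t\<in>J n. b n t * X t w)))\<^sup>2) \<partial>M) < ennreal (inverse (real (Suc n)))" ..
  have Jb: "\<And>n. finite (J n)" "\<And>n. J n \<subseteq> I"
    "\<And>n. (\<integral>\<^sup>+w. ennreal ((cmod (Y w - (\<Sum>t\<in>J n. b n t * X t w)))\<^sup>2) \<partial>M) < ennreal (inverse (real (Suc n)))"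
    using b by simp_all
  have S: "(\<lambda>w. \<Sum>t\<in>J n. b n t * X t w) \<in> L2 M" for n by (intro L2_sum L2_mult_left X)
  have le: "(nrm M (\<lambda>w. (\<Sum>t\<in>J n. b n t * X t w) - Y w))\<^sup>2 \<le> inverse (real (Suc n))" for n
    using Jb(3)[of n] unfolding nn_integral_nrm[OF L2_diff[OF YL S]] nrm_minus_commute[of M Y]
    by (simp add: ennreal_less_iff del: of_nat_Suc)
  have "(\<lambda>n. (nrm M (\<lambda>w. (\<Sum>t\<in>J n. b n t * X t w) - Y w))\<^sup>2) \<longlonglongrightarrow> 0"
    by (rule tendsto_sandwich[OF _ _ tendsto_const LIMSEQ_inverse_real_of_nat]) (use le in auto)
  then have "(\<lambda>n. nrm M (\<lambda>w. (\<Sum>t\<in>J n. b n t * X t w) - Y w)) \<longlonglongrightarrow> 0" by simp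
  with Jb show ?thesis using that by blast
qed

lemma closed_span_limit:
  assumes Y: "Y \<in> L2 M" and X: "\<And>t. X t \<in> L2 M" and J: "\<And>n. finite (J n)" "\<And>n. J n \<subseteq> I"
    and lim: "(\<lambda>n. nrm M (\<lambda>w. (\<Sum>t\<in>J n. b n t * X t w) - Y w)) \<longlonglongrightarrow> 0"
  shows "Y \<in> L2_closed_span M I X"
  unfolding L2_closed_span_def
proof (intro CollectI conjI allI impI Y)
  fix e :: real assume e: "0 < e"
  have S: "(\<lambda>w. \<Sum>t\<in>J n. b n t * X t w) \<in> L2 M" for n by (intro L2_sum L2_mult_left X)
  have "(\<lambda>n. (nrm M (\<lambda>w. (\<Sum>t\<in>J n. b n t * X t w) - Y w))\<^sup>2) \<longlonglongrightarrow> 0" using lim by simp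
  from order_tendstoD(2)[OF this e] obtain n where n: "(nrm M (\<lambda>w. (\<Sum>t\<in>J n. b n t * X t w) - Y w))\<^sup>2 < e"
    by (auto dest: eventually_happens)
  have "(\<integral>\<^sup>+w. ennreal ((cmod (Y w - (\<Sum>t\<in>J n. b n t * X t w)))\<^sup>2) \<partial>M) < ennreal e"
    unfolding nn_integral_nrm[OF L2_diff[OF Y S]] nrm_minus_commute[of M Y] using n e by (simp add: ennreal_less_iff)
  then show "\<exists>J b. finite J \<and> J \<subseteq> I \<and> (\<integral>\<^sup>+w. ennreal ((cmod (Y w - (\<Sum>t\<in>J. b t * X t w)))\<^sup>2) \<partial>M) < ennreal e"
    using J[of n] by blast
qed

lemma closed_span_generator: "t \<in> I \<Longrightarrow> X t \<in> L2 M \<Longrightarrow> X t \<in> L2_closed_span M I X"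
  unfolding L2_closed_span_def
  by (auto intro!: exI[of _ "{t}"] exI[of _ "\<lambda>_. 1"])

section \<open>Observed times in the frequency domain\<close>

context filtering
begin

lemma observed_complement: "observed s N K = - T"
  unfolding observed_def Tset_def by auto

lemma observed_open: "open (observed s N K)"
  unfolding observed_complement Tset_def gaps_def
  by (intro open_Compl closed_Un closed_UN) auto

text \<open>Counterpart of \<open>V\<close>: it maps \<open>L2 M\<close> isometrically into
  \<open>L2 lborel\<close>, and in the product of \<open>U X\<close> with the conjugate of
  \<open>V Z\<close> the weights cancel almost everywhere.\<close>

definition U :: "(real \<Rightarrow> complex) \<Rightarrow> real \<Rightarrow> complex" where
  "U X l = of_real (sqrt (f l + g l)) * X l"

abbreviation "M \<equiv> mu (\<lambda>l. f l + g l)"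

lemma fg_int: "integrable lborel (\<lambda>l. f l + g l)" using f_int g_int by simp
lemma fg_nonneg: "0 \<le> f l + g l" using f_nonneg g_nonneg by simp

lemma U_measurable [measurable]:
  assumes [measurable]: "X \<in> borel_measurable borel" shows "U X \<in> borel_measurable borel"
  unfolding U_def[abs_def] by measurable

lemma U_sq: "(cmod (U X l))\<^sup>2 = (f l + g l) * (cmod (X l))\<^sup>2"
  using fg_nonneg[of l] by (simp add: U_def norm_mult power_mult_distrib)

lemma M_L2_measurable: "X \<in> L2 M \<Longrightarrow> X \<in> borel_measurable borel" by (auto simp: L2_def)

lemma U_L2: "X \<in> L2 M \<Longrightarrow> U X \<in> L2 lborel"
  using mu_L2_iff[OF fg_int fg_nonneg M_L2_measurable]
  by (auto intro!: L2I simp: U_sq dest: M_L2_measurable)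

lemma M_nrm: "X \<in> L2 M \<Longrightarrow> nrm M X = nrm lborel (U X)"
  by (rule power2_eq_imp_eq) (auto simp: nrm_nonneg mu_nrm[OF fg_int fg_nonneg M_L2_measurable] nrm_sq[of lborel] U_sq)

lemma U_diff: "U (\<lambda>l. X l - Y l) = (\<lambda>l. U X l - U Y l)"
  by (simp add: U_def right_diff_distrib fun_eq_iff)

lemma cis_M: "(\<lambda>l. cis (t * l)) \<in> L2 M" by (rule cis_mu_L2[OF fg_int fg_nonneg])

text \<open>Cancellation of the weights makes evaluation of an inverse transform at \<open>t\<close>
  an inner product, so vanishing at observed times becomes orthogonality to the generators of the
  span.\<close>

lemma U_cis_V:
  assumes "integrable lborel Z"
  shows "ip lborel (U (\<lambda>l. cis (t * l))) (V Z) = cnj (2 * pi * ift Z t)"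
proof -
  have [measurable]: "Z \<in> borel_measurable borel" using assms by auto
  have "ip lborel (U (\<lambda>l. cis (t * l))) (V Z) = (LBINT l. cnj (Z l * cis (- (t * l))))"
    unfolding ip_def
  proof (rule integral_cong_AE)
    show "AE l in lborel. U (\<lambda>l. cis (t * l)) l * cnj (V Z l) = cnj (Z l * cis (- (t * l)))"
      using fg_pos by eventually_elim (simp add: U_def V_def cis_cnj mult.commute)
  qed measurable
  also have "\<dots> = cnj (LBINT l. Z l * cis (- (t * l)))" by (rule Bochner_Integration.integral_cnj)
  finally show ?thesis by (simp add: ift_def ft_def mult.commute)
qed

text \<open>Orthogonality to the generators, given by \<open>U_cis_V\<close>, passes to limits of
  their combinations because \<open>U\<close> is isometric.\<close>

lemma closed_span_orthogonal:
  assumes h: "h \<in> L2_closed_span M (observed s N K) (\<lambda>t l. cis (t * l))"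
    and Z: "integrable lborel Z" "V Z \<in> L2 lborel" "\<And>t. t \<in> observed s N K \<Longrightarrow> ift Z t = 0"
  shows "ip lborel (U h) (V Z) = 0"
proof -
  from closed_span_sequence[OF h cis_M] obtain J b where
    Jb: "\<And>n. finite (J n)" "\<And>n. J n \<subseteq> observed s N K"
    "(\<lambda>n. nrm M (\<lambda>w. (\<Sum>t\<in>J n. b n t * cis (t * w)) - h w)) \<longlonglongrightarrow> 0" by blast
  have hL: "h \<in> L2 M" using h by (simp add: L2_closed_span_def)
  have S: "(\<lambda>l. \<Sum>t\<in>J n. b n t * cis (t * l)) \<in> L2 M" for n by (intro L2_sum L2_mult_left cis_M)
  let ?p = "\<lambda>n l. \<Sum>t\<in>J n. b n t * cis (t * l)"
  have "(\<lambda>n. ip lborel (U (?p n)) (V Z)) \<longlonglongrightarrow> ip lborel (U h) (V Z)"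
    by (rule ip_tendsto[OF U_L2[OF S] U_L2[OF hL] _ Z(2)])
       (use Jb(3) in \<open>simp add: M_nrm[OF L2_diff[OF S hL]] U_diff\<close>)
  moreover have "ip lborel (U (?p n)) (V Z) = 0" for n
  proof -
    have "U (?p n) = (\<lambda>l. \<Sum>t\<in>J n. b n t * U (\<lambda>l. cis (t * l)) l)"
      by (simp add: U_def fun_eq_iff sum_distrib_left mult_ac)
    then have "ip lborel (U (?p n)) (V Z) = (\<Sum>t\<in>J n. b n t * ip lborel (U (\<lambda>l. cis (t * l))) (V Z))"
      by (simp add: ip_sum_left U_L2 cis_M Z)
    also have "\<dots> = 0"
      by (rule sum.neutral) (use Jb(2)[of n] Z in \<open>auto simp: U_cis_V\<close>)
    finally show ?thesis .
  qed
  ultimately show ?thesis by (simp add: LIMSEQ_const_iff)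
qed

text \<open>\<open>W z\<close> vanishes off \<open>T\<close> and agrees with \<open>ift Z\<close>
  almost everywhere; as \<open>ift Z\<close> is continuous and the observed set is open, no
  exceptional times remain.\<close>

lemma ift_observed_zero:
  assumes z: "z \<in> L2_T" "wFT (W z) Z" "V Z \<in> L2 lborel" and t: "t \<in> observed s N K"
  shows "ift Z t = 0"
proof -
  have ZL: "Z \<in> L2 lborel" using z by (simp add: wFT_def)
  then have Z: "integrable lborel Z" by (intro V_L2_imp_integrable z) (auto simp: L2_def)
  have "AE t in lborel. W z t = ift Z t"
    by (rule wFT_inject[OF z(2) wFT_ift]) (simp add: L12_def Z ZL)
  then have "AE t in lborel. t \<in> observed s N K \<longrightarrow> ift Z t = 0"
    by eventually_elim (auto simp: W_def observed_complement wt_outside)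
  then show "ift Z t = 0"
    by (rule continuous_AE_zero_imp_zero[OF ift_continuous[OF Z] observed_open _ t])
qed

text \<open>Converse of \<open>ift_observed_zero\<close>. The bound \<kappa> makes \<open>Z\<close>,
  which is \<open>V Z\<close> times the square root of \<open>f + g\<close>, square
  integrable.\<close>

lemma inverse_transform_in_L2T:
  assumes \<kappa>: "AE l in lborel. f l + g l \<le> \<kappa>" 
    and Z: "Z \<in> borel_measurable borel" "V Z \<in> L2 lborel" "\<And>t. t \<in> observed s N K \<Longrightarrow> ift Z t = 0"
  obtains z where "z \<in> L2_T" "wFT (W z) Z"
proof -
  note [measurable] = Z(1)
  have Zi: "integrable lborel Z" by (rule V_L2_imp_integrable[OF Z(1,2)])
  have ZL: "Z \<in> L2 lborel"
  proof (rule L2_bound[OF Z(2)])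
    show "AE l in lborel. cmod (Z l) \<le> sqrt \<kappa> * cmod (V Z l)"
      using \<kappa> fg_pos
    proof eventually_elim
      case (elim l)
      have "cmod (Z l) = sqrt (f l + g l) * cmod (V Z l)" using elim by (simp add: V_def norm_divide)
      also have "\<dots> \<le> sqrt \<kappa> * cmod (V Z l)" using elim by (intro mult_right_mono) auto
      finally show ?case .
    qed
  qed simp
  have L: "L12 Z" using Zi ZL by (simp add: L12_def)
  \<comment> \<open>On \<open>T\<close> the weight is at least 1. Off \<open>T\<close> it is 0 and
    the quotient takes the default value 0, where \<open>ift Z\<close> vanishes too; so
    \<open>W z = ift Z\<close> holds at every time.\<close>
  define z where "z t = ift Z t / of_real (wt t)" for t
  have Wz: "W z = ift Z"
  proof
    fix t show "W z t = ift Z t"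
      using wt_ge_1[of t] Z(3)[of t] by (cases "t \<in> T") (auto simp: W_def z_def observed_complement wt_outside)
  qed
  have iL: "ift Z \<in> L2 lborel" by (rule ift_L2_bound[OF L])
  have "z \<in> L2 lborel"
  proof (rule L2_bound[OF iL, of _ 1])
    show "z \<in> borel_measurable lborel" unfolding z_def[abs_def] by measurable
    have "cmod (z t) \<le> cmod (ift Z t)" for t
    proof (cases "t \<in> T")
      case True
      then have "cmod (ift Z t) / wt t \<le> cmod (ift Z t) / 1" using wt_ge_1[of t] by (intro divide_left_mono) auto
      then show ?thesis using wt_nonneg by (simp add: z_def norm_divide)
    qed (simp add: z_def wt_outside)
    then show "AE t in lborel. cmod (z t) \<le> 1 * cmod (ift Z t)" by simp
  qed
  then have "z \<in> L2_T" by (rule L2T_I)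
  moreover have "wFT (W z) Z" unfolding Wz by (rule wFT_ift[OF L])
  ultimately show ?thesis by (rule that)
qed

lemma wFT_of_T_fourier:
  assumes c: "c \<in> L2_T" and C: "T_fourier s N K c C"
  shows "wFT (W c) C"
proof -
  have CL: "C \<in> L2 lborel" and lim: "L2_tendsto lborel
       (\<lambda>n l. T_integral s N K (\<lambda>t. indicator {..real n} t * c t * cis (t * l))) C"
    using C by (auto simp: T_fourier_def)
  have WL: "W c \<in> L2 lborel" by (rule W_L2[OF c])
  have [measurable]: "W c \<in> borel_measurable borel" "cut c \<in> borel_measurable borel" using WL cut_L2[OF c] by (auto simp: L2_def)
  \<comment> \<open>\<open>T_fourier\<close> truncates from above only. Bounded gaps give the
    truncated functions bounded support, hence membership in \<open>L12\<close>.\<close>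
  have "bounded (gaps s N K)" unfolding gaps_def by (intro bounded_UN) auto
  then obtain B where B: "\<And>t. t \<in> gaps s N K \<Longrightarrow> \<bar>t\<bar> \<le> B" unfolding bounded_iff by auto
  have TB: "t \<in> {- \<bar>B\<bar>..real n}" if "t \<in> T" "t \<le> real n" for t n
    using that B[of t] unfolding Tset_def by force
  define x where "x n t = indicator {..real n} t * W c t" for n t
  have x_eq: "x n = (\<lambda>t. indicator {- \<bar>B\<bar>..real n} t * W c t)" for n
  proof
    fix t show "x n t = indicator {- \<bar>B\<bar>..real n} t * W c t"
      using TB[of t n] by (cases "t \<in> T") (auto simp: x_def W_def wt_outside split: split_indicator)
  qed
  have xL: "L12 (x n)" for n unfolding x_eq by (rule L12_truncate[OF WL])
  have eq: "T_integral s N K (\<lambda>t. indicator {..real n} t * c t * cis (t * l)) = ft (x n) l" for n l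
  proof -
    have "cut (\<lambda>t. indicator {..real n} t * c t * cis (t * l)) = (\<lambda>t. indicator {- \<bar>B\<bar>..real n} t * cut c t * cis (t * l))"
      using TB[of _ n] by (auto simp: cut_def fun_eq_iff split: split_indicator)
    moreover have "integrable lborel (\<lambda>t. indicator {- \<bar>B\<bar>..real n} t * cut c t * cis (t * l))"
      by (rule ft_integrable[OF L12D(1)[OF L12_truncate[OF cut_L2[OF c]]]])
    ultimately have "T_integral s N K (\<lambda>t. indicator {..real n} t * c t * cis (t * l))
      = (LBINT t. of_real (wt t) * (indicator {..real n} t * c t * cis (t * l)))"
      by (intro T_integral_wt) simp
    then show ?thesis by (simp add: ft_def x_def W_def mult_ac)
  qed
  have xlim: "L2_lim lborel x (W c)"
  proof (rule L2_dominated(3)[OF _ _ WL, of _ _ 1])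
    show "AE t in lborel. (\<lambda>n. x n t) \<longlonglongrightarrow> W c t"
    proof (rule AE_I2)
      fix t
      obtain n0 where n0: "t \<le> real n0" using real_arch_simple by blast
      have "\<forall>\<^sub>F n in sequentially. W c t = x n t"
        using eventually_ge_at_top[of n0] by eventually_elim (use n0 in \<open>auto simp: x_def split: split_indicator\<close>)
      then show "(\<lambda>n. x n t) \<longlonglongrightarrow> W c t" by (rule eventually_const_tendsto)
    qed
  qed (auto simp: x_def[abs_def] split: split_indicator)
  show ?thesis
    by (rule wFT_limit[OF wFT_ft[OF xL] WL CL xlim])
       (use lim in \<open>simp add: eq L2_tendsto_iff ft_L2_bound[OF xL] CL\<close>)
qed

end

section \<open>The spectral characteristic of the projection\<close>

lemma sum_union_diff:
  fixes b b' :: "'a \<Rightarrow> complex"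
  assumes "finite J" "finite J'"
  shows "(\<Sum>t\<in>J \<union> J'. ((if t \<in> J then b t else 0) - (if t \<in> J' then b' t else 0)) * x t)
    = (\<Sum>t\<in>J. b t * x t) - (\<Sum>t\<in>J'. b' t * x t)"
proof -
  have 1: "(\<Sum>t\<in>J \<union> J'. (if t \<in> J then b t else 0) * x t) = (\<Sum>t\<in>J. b t * x t)"
    using assms by (intro sum.mono_neutral_cong_right) auto
  have 2: "(\<Sum>t\<in>J \<union> J'. (if t \<in> J' then b' t else 0) * x t) = (\<Sum>t\<in>J'. b' t * x t)"
    using assms by (intro sum.mono_neutral_cong_right) auto
  show ?thesis by (simp add: left_diff_distrib sum_subtractf 1 2)
qed

lemma null_sequence_bound:
  fixes u x y z :: "nat \<Rightarrow> real"
  assumes "x \<longlonglongrightarrow> 0" "y \<longlonglongrightarrow> 0" "z \<longlonglongrightarrow> 0"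
    and "\<And>n. 0 \<le> u n" "\<And>n. u n \<le> c * (x n + y n) + z n"
  shows "u \<longlonglongrightarrow> 0"
proof (rule tendsto_sandwich[OF _ _ tendsto_const])
  show "(\<lambda>n. c * (x n + y n) + z n) \<longlonglongrightarrow> 0"
    using tendsto_add[OF tendsto_mult_left[OF tendsto_add[OF assms(1,2)], of c] assms(3)] by simp
qed (use assms(4,5) in auto)

text \<open>Arithmetic common to the two limit passages for stochastic integrals: the factor 2 is
  that of \<open>ZZ_simple\<close>, the other inequalities are triangle inequalities and symmetry of
  distances.\<close>

lemma approximation_chain:
  fixes x y y' z u v t t' :: real
  shows "x \<le> y + z \<Longrightarrow> y \<le> y' \<Longrightarrow> y' \<le> 2 * u \<Longrightarrow> u \<le> v + t \<Longrightarrow> t \<le> t' \<Longrightarrow> x \<le> 2 * (v + t') + z"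
  by argo

lemma nrm_diff_sq:
  assumes "X \<in> L2 M" "Y \<in> L2 M"
  shows "(nrm M (\<lambda>w. X w - Y w))\<^sup>2 = (nrm M X)\<^sup>2 - 2 * Re (ip M X Y) + (nrm M Y)\<^sup>2"
  using nrm_add_sq[OF assms(1) L2_uminus[OF assms(2)]] ip_mult_right[of M X "-1" Y] nrm_mult_left[of M "-1" Y]
  by simp

locale signal_noise = filtering s N K f g
  for s :: nat and N K :: "nat \<Rightarrow> real" and f g :: "real \<Rightarrow> real" +
  fixes P :: "'w measure" and \<xi> \<eta> :: "real \<Rightarrow> 'w \<Rightarrow> complex" and Z\<xi> Z\<eta> :: "real set \<Rightarrow> 'w \<Rightarrow> complex"
  assumes \<xi>: "stationary_process P \<xi>" "has_spectral_density P \<xi> f" "spectral_representation P \<xi> Z\<xi> f"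
    and \<eta>: "stationary_process P \<eta>" "has_spectral_density P \<eta> g" "spectral_representation P \<eta> Z\<eta> g"
    and uncorrelated: "uncorrelated_processes P \<xi> \<eta>"
begin

abbreviation "\<zeta> \<equiv> (\<lambda>t w. \<xi> t w + \<eta> t w)"
abbreviation "ZZ \<equiv> (\<lambda>D w. Z\<xi> D w + Z\<eta> D w)"
abbreviation "obs \<equiv> observed s N K"

abbreviation "spectral_char \<equiv> spectral_characteristic P s N K f g Z\<xi> Z\<eta>"

text \<open>Together with \<open>ts\<close>, the combination of \<open>\<xi> t + \<eta> t\<close>
  with the same coefficients, this is the pair matched by the isometry between the closed
  spans.\<close>

definition tp :: "real set \<Rightarrow> (real \<Rightarrow> complex) \<Rightarrow> real \<Rightarrow> complex" where
  "tp J b l = (\<Sum>t\<in>J. b t * cis (t * l))"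

definition ts :: "real set \<Rightarrow> (real \<Rightarrow> complex) \<Rightarrow> 'w \<Rightarrow> complex" where
  "ts J b w = (\<Sum>t\<in>J. b t * (\<xi> t w + \<eta> t w))"

lemma \<xi>_L2: "\<xi> t \<in> L2 P" and \<eta>_L2: "\<eta> t \<in> L2 P"
  using \<xi>(1) \<eta>(1) by (auto simp: stationary_process_def)

lemma \<zeta>_L2: "\<zeta> t \<in> L2 P" by (rule L2_add[OF \<xi>_L2 \<eta>_L2])

lemma ts_L2: "ts J b \<in> L2 P" unfolding ts_def[abs_def] by (intro L2_sum L2_mult_left \<zeta>_L2)
lemma tp_M: "tp J b \<in> L2 M" unfolding tp_def[abs_def] by (intro L2_sum L2_mult_left cis_M)

lemma \<xi>_\<eta>: "ip P (\<xi> t) (\<eta> u) = 0" using uncorrelated by (simp add: uncorrelated_processes_def ip_def)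
lemma \<eta>_\<xi>: "ip P (\<eta> t) (\<xi> u) = 0" using \<xi>_\<eta>[of u t] ip_commute[of P "\<eta> t" "\<xi> u"] by simp

text \<open>The mixed covariances vanish, so the spectral densities add.\<close>

lemma \<zeta>_ip: "ip P (\<zeta> t) (\<zeta> u) = of_real (1 / (2 * pi)) * ip M (\<lambda>l. cis (t * l)) (\<lambda>l. cis (u * l))"
proof -
  have i: "integrable lborel (\<lambda>l. complex_of_real (p l) * (cis (t * l) * cnj (cis (u * l))))" if "integrable lborel p" for p
    by (rule integrable_mult_bounded[where B=1]) (use that in \<open>auto simp: norm_mult\<close>)
  have "ip P (\<zeta> t) (\<zeta> u) = ip P (\<xi> t) (\<xi> u) + ip P (\<eta> t) (\<eta> u)"
    by (simp add: ip_add_left ip_add_right \<xi>_L2 \<eta>_L2 \<zeta>_L2 \<xi>_\<eta> \<eta>_\<xi>)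
  also have "\<dots> = of_real (1 / (2 * pi)) * (ip (mu f) (\<lambda>l. cis (t * l)) (\<lambda>l. cis (u * l)) + ip (mu g) (\<lambda>l. cis (t * l)) (\<lambda>l. cis (u * l)))"
    unfolding stationary_ip[OF f_int f_nonneg \<xi>(1,2)] stationary_ip[OF g_int g_nonneg \<eta>(1,2)] by (simp add: distrib_left)
  also have "ip (mu f) (\<lambda>l. cis (t * l)) (\<lambda>l. cis (u * l)) + ip (mu g) (\<lambda>l. cis (t * l)) (\<lambda>l. cis (u * l)) = ip M (\<lambda>l. cis (t * l)) (\<lambda>l. cis (u * l))"
    using i[OF f_int] i[OF g_int]
    by (subst (1) mu_ip[OF f_int f_nonneg], simp, simp, subst mu_ip[OF g_int g_nonneg], simp, simp, subst mu_ip[OF fg_int fg_nonneg])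
       (simp_all add: distrib_right)
  finally show ?thesis .
qed

lemma trigonometric_isometry:
  assumes "finite J" "finite J'"
  shows "nrm P (\<lambda>w. ts J b w - ts J' b' w) = nrm M (\<lambda>l. tp J b l - tp J' b' l) / sqrt (2 * pi)"
proof -
  let ?d = "\<lambda>t. (if t \<in> J then b t else 0) - (if t \<in> J' then b' t else 0)"
  have "(nrm P (\<lambda>w. \<Sum>t\<in>J \<union> J'. ?d t * \<zeta> t w))\<^sup>2 = (1 / (2 * pi)) * (nrm M (\<lambda>l. \<Sum>t\<in>J \<union> J'. ?d t * cis (t * l)))\<^sup>2"
    by (rule gram_isometry[OF \<zeta>_L2 cis_M \<zeta>_ip])
  then have "(nrm P (\<lambda>w. ts J b w - ts J' b' w))\<^sup>2 = (nrm M (\<lambda>l. tp J b l - tp J' b' l) / sqrt (2 * pi))\<^sup>2"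
    unfolding sum_union_diff[OF assms] by (simp add: ts_def tp_def power_divide)
  then show ?thesis by (rule power2_eq_imp_eq) (auto simp: nrm_nonneg)
qed

lemma ts_ip: "ip P (ts J b) (\<zeta> u) = of_real (1 / (2 * pi)) * ip M (tp J b) (\<lambda>l. cis (u * l))"
proof -
  have "ip P (ts J b) (\<zeta> u) = (\<Sum>t\<in>J. b t * ip P (\<zeta> t) (\<zeta> u))"
    unfolding ts_def[abs_def] by (rule ip_sum_left[OF \<zeta>_L2 \<zeta>_L2])
  also have "\<dots> = of_real (1 / (2 * pi)) * (\<Sum>t\<in>J. b t * ip M (\<lambda>l. cis (t * l)) (\<lambda>l. cis (u * l)))"
    unfolding \<zeta>_ip by (simp only: sum_distrib_left mult_ac)
  also have "(\<Sum>t\<in>J. b t * ip M (\<lambda>l. cis (t * l)) (\<lambda>l. cis (u * l))) = ip M (tp J b) (\<lambda>l. cis (u * l))"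
    unfolding tp_def[abs_def] by (rule ip_sum_left[OF cis_M cis_M, symmetric])
  finally show ?thesis .
qed

text \<open>Uncorrelatedness is a statement about the processes and is not carried over to the two
  stochastic measures. Each measure is compared with its own process instead, and the triangle
  inequality yields a bound in place of an isometry; the constant 2 is harmless in limits.\<close>

lemma ZZ_simple:
  assumes \<phi>: "simple_function borel \<phi>"
  shows "simple_stoch_integral ZZ \<phi> \<in> L2 P"
    "finite J \<Longrightarrow> nrm P (\<lambda>w. simple_stoch_integral ZZ \<phi> w - ts J b w) \<le> 2 * nrm M (\<lambda>l. \<phi> l - tp J b l)"
proof -
  have Z: "orthogonal_stochastic_measure P Z\<xi> f" "orthogonal_stochastic_measure P Z\<eta> g"
    using \<xi>(3) \<eta>(3) by (auto simp: spectral_representation_def)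
  have I: "simple_stoch_integral ZZ \<phi> = (\<lambda>w. simple_stoch_integral Z\<xi> \<phi> w + simple_stoch_integral Z\<eta> \<phi> w)"
    by (auto simp: simple_stoch_integral_def fun_eq_iff distrib_left sum.distrib)
  note IL = simple_stoch_integral_L2[OF Z(1) \<phi>] simple_stoch_integral_L2[OF Z(2) \<phi>]
  show "simple_stoch_integral ZZ \<phi> \<in> L2 P" unfolding I by (rule L2_add[OF IL])
  assume J: "finite J"
  have SL: "(\<lambda>w. \<Sum>t\<in>J. b t * \<xi> t w) \<in> L2 P" "(\<lambda>w. \<Sum>t\<in>J. b t * \<eta> t w) \<in> L2 P"
    by (intro L2_sum L2_mult_left \<xi>_L2 \<eta>_L2)+
  have D: "(\<lambda>l. \<phi> l - tp J b l) \<in> L2 M" by (rule L2_diff[OF simple_function_L2[OF fg_int fg_nonneg \<phi>] tp_M])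
  have "nrm P (\<lambda>w. simple_stoch_integral ZZ \<phi> w - ts J b w) =
    nrm P (\<lambda>w. (simple_stoch_integral Z\<xi> \<phi> w - (\<Sum>t\<in>J. b t * \<xi> t w)) + (simple_stoch_integral Z\<eta> \<phi> w - (\<Sum>t\<in>J. b t * \<eta> t w)))"
    unfolding I ts_def by (simp add: distrib_left sum.distrib algebra_simps)
  also have "\<dots> \<le> nrm P (\<lambda>w. simple_stoch_integral Z\<xi> \<phi> w - (\<Sum>t\<in>J. b t * \<xi> t w)) + nrm P (\<lambda>w. simple_stoch_integral Z\<eta> \<phi> w - (\<Sum>t\<in>J. b t * \<eta> t w))"
    by (rule nrm_triangle[OF L2_diff[OF IL(1) SL(1)] L2_diff[OF IL(2) SL(2)]])
  also have "\<dots> = (nrm (mu f) (\<lambda>l. \<phi> l - tp J b l) + nrm (mu g) (\<lambda>l. \<phi> l - tp J b l)) / sqrt (2 * pi)"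
    unfolding stochastic_isometry[OF f_int f_nonneg \<xi> \<phi> J] stochastic_isometry[OF g_int g_nonneg \<eta> \<phi> J] tp_def
    by (simp add: add_divide_distrib)
  also have "\<dots> \<le> (2 * nrm M (\<lambda>l. \<phi> l - tp J b l)) / 1"
  proof (rule frac_le)
    have "nrm (mu f) (\<lambda>l. \<phi> l - tp J b l) \<le> nrm M (\<lambda>l. \<phi> l - tp J b l)"
      by (rule mu_mono[OF f_int f_nonneg fg_int fg_nonneg _ D]) (simp add: g_nonneg)
    moreover have "nrm (mu g) (\<lambda>l. \<phi> l - tp J b l) \<le> nrm M (\<lambda>l. \<phi> l - tp J b l)"
      by (rule mu_mono[OF g_int g_nonneg fg_int fg_nonneg _ D]) (simp add: f_nonneg)
    ultimately show "nrm (mu f) (\<lambda>l. \<phi> l - tp J b l) + nrm (mu g) (\<lambda>l. \<phi> l - tp J b l) \<le> 2 * nrm M (\<lambda>l. \<phi> l - tp J b l)"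
      by linarith
  qed (use pi_gt3 in \<open>auto simp: nrm_nonneg\<close>)
  finally show "nrm P (\<lambda>w. simple_stoch_integral ZZ \<phi> w - ts J b w) \<le> 2 * nrm M (\<lambda>l. \<phi> l - tp J b l)" by simp
qed

text \<open>Simple functions tending to \<open>h\<close> become close in \<open>M\<close> to the
  trigonometric sums; by \<open>ZZ_simple\<close> their stochastic integrals become close to the
  sums \<open>ts\<close>, which tend to \<open>Y\<close>.\<close>

lemma has_stoch_integral_of_limit:
  assumes J: "\<And>n. finite (J n)" and h: "h \<in> L2 M" "L2_lim M (\<lambda>n. tp (J n) (b n)) h"
    and Y: "Y \<in> L2 P" "L2_lim P (\<lambda>n. ts (J n) (b n)) Y"
  shows "has_stoch_integral P ZZ (\<lambda>l. f l + g l) h Y"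
proof -
  obtain \<phi> where \<phi>: "\<And>n. simple_function M (\<phi> n)" "\<And>n. \<phi> n \<in> L2 M" "L2_lim M \<phi> h"
    by (rule L2_simple_approximation[OF h(1)], rule that)
  have s: "simple_function borel (\<phi> n)" for n by (rule iffD1[OF simple_function_mu \<phi>(1)])
  have "L2_lim P (\<lambda>n. simple_stoch_integral ZZ (\<phi> n)) Y"
  proof (rule null_sequence_bound[OF \<phi>(3) h(2) Y(2) nrm_nonneg])
    show "nrm P (\<lambda>w. simple_stoch_integral ZZ (\<phi> n) w - Y w)
      \<le> 2 * (nrm M (\<lambda>w. \<phi> n w - h w) + nrm M (\<lambda>l. tp (J n) (b n) l - h l)) + nrm P (\<lambda>w. ts (J n) (b n) w - Y w)" for n
      by (rule approximation_chain[OF nrm_triangle_diff[OF ZZ_simple(1)[OF s] ts_L2 Y(1)] order_refl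
            ZZ_simple(2)[OF s J] nrm_triangle_diff[OF \<phi>(2) h(1) tp_M] eq_refl[OF nrm_minus_commute]])
  qed
  then show ?thesis
    unfolding has_stoch_integral_def
    using \<phi> s h(1) Y(1) by (auto simp: L2_tendsto_iff ZZ_simple(1)[OF s] intro!: exI[of _ \<phi>])
qed

lemma limit_of_has_stoch_integral:
  assumes J: "\<And>n. finite (J n)" and h: "h \<in> L2 M" "L2_lim M (\<lambda>n. tp (J n) (b n)) h"
    and Y: "has_stoch_integral P ZZ (\<lambda>l. f l + g l) h Y"
  shows "L2_lim P (\<lambda>n. ts (J n) (b n)) Y"
proof -
  obtain \<phi> where s: "\<And>n. simple_function borel (\<phi> n)" and 1: "L2_tendsto M \<phi> h"
    "L2_tendsto P (\<lambda>n. simple_stoch_integral ZZ (\<phi> n)) Y" and YL: "Y \<in> L2 P"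
    using Y unfolding has_stoch_integral_def by blast
  have \<phi>: "\<phi> n \<in> L2 M" for n by (rule simple_function_L2[OF fg_int fg_nonneg s])
  have lim: "L2_lim M \<phi> h" "L2_lim P (\<lambda>n. simple_stoch_integral ZZ (\<phi> n)) Y"
    using 1 by (simp_all add: L2_tendsto_iff \<phi> h(1) YL ZZ_simple(1)[OF s])
  show ?thesis
  proof (rule null_sequence_bound[OF lim(1) h(2) lim(2) nrm_nonneg])
    show "nrm P (\<lambda>w. ts (J n) (b n) w - Y w)
      \<le> 2 * (nrm M (\<lambda>w. \<phi> n w - h w) + nrm M (\<lambda>l. tp (J n) (b n) l - h l)) + nrm P (\<lambda>w. simple_stoch_integral ZZ (\<phi> n) w - Y w)" for n
      by (rule approximation_chain[OF nrm_triangle_diff[OF ts_L2 ZZ_simple(1)[OF s] YL]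
            eq_refl[OF nrm_minus_commute] ZZ_simple(2)[OF s J] nrm_triangle_diff[OF \<phi> h(1) tp_M] eq_refl[OF nrm_minus_commute]])
  qed
qed

text \<open>Approximating sums of both characteristics have random counterparts tending to the same
  \<open>Y\<close>, and \<open>trigonometric_isometry\<close> carries this closeness back to
  \<open>M\<close>. Positivity of \<open>f + g\<close> then makes null sets of \<open>M\<close> null
  for Lebesgue measure.\<close>

lemma spectral_characteristic_unique:
  assumes h: "spectral_char Y h" and h': "spectral_char Y h'"
  shows "AE l in lborel. h l = h' l"
proof -
  have c: "h \<in> L2_closed_span M obs (\<lambda>t l. cis (t * l))" "h' \<in> L2_closed_span M obs (\<lambda>t l. cis (t * l))"
    and i: "has_stoch_integral P ZZ (\<lambda>l. f l + g l) h Y" "has_stoch_integral P ZZ (\<lambda>l. f l + g l) h' Y"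
    using h h' by (auto simp: spectral_characteristic_def)
  have L: "h \<in> L2 M" "h' \<in> L2 M" "Y \<in> L2 P" using i by (auto simp: has_stoch_integral_def)
  obtain J b where J: "\<And>n. finite (J n)" "L2_lim M (\<lambda>n. tp (J n) (b n)) h"
    by (rule closed_span_sequence[OF c(1) cis_M], rule that, assumption, unfold tp_def, assumption)
  obtain J' b' where J': "\<And>n. finite (J' n)" "L2_lim M (\<lambda>n. tp (J' n) (b' n)) h'"
    by (rule closed_span_sequence[OF c(2) cis_M], rule that, assumption, unfold tp_def, assumption)
  note S = limit_of_has_stoch_integral[OF J(1) L(1) J(2) i(1)] limit_of_has_stoch_integral[OF J'(1) L(2) J'(2) i(2)]
  have "L2_lim M (\<lambda>n. tp (J n) (b n)) h'"
  proof (rule null_sequence_bound[OF S J'(2) nrm_nonneg])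
    fix n
    have "nrm M (\<lambda>l. tp (J n) (b n) l - tp (J' n) (b' n) l) = sqrt (2 * pi) * nrm P (\<lambda>w. ts (J n) (b n) w - ts (J' n) (b' n) w)"
      unfolding trigonometric_isometry[OF J(1) J'(1)] by simp
    also have "\<dots> \<le> sqrt (2 * pi) * (nrm P (\<lambda>w. ts (J n) (b n) w - Y w) + nrm P (\<lambda>w. ts (J' n) (b' n) w - Y w))"
      using nrm_triangle_diff[OF ts_L2 L(3) ts_L2, of "J n" "b n" "J' n" "b' n"] nrm_minus_commute[of P Y]
      by (intro mult_left_mono) auto
    finally show "nrm M (\<lambda>l. tp (J n) (b n) l - h' l) \<le> sqrt (2 * pi) *
        (nrm P (\<lambda>w. ts (J n) (b n) w - Y w) + nrm P (\<lambda>w. ts (J' n) (b' n) w - Y w)) + nrm M (\<lambda>l. tp (J' n) (b' n) l - h' l)"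
      using nrm_triangle_diff[OF tp_M tp_M L(2), of "J n" "b n" "J' n" "b' n"] by linarith
  qed
  then have "AE l in M. h l = h' l" by (rule L2_lim_unique[OF tp_M L(1,2) J(2)])
  then have "AE l in lborel. 0 < ennreal (f l + g l) \<longrightarrow> h l = h' l" by (subst (asm) AE_density) auto
  then show ?thesis using fg_pos by eventually_elim auto
qed

lemma spectral_characteristic_cong:
  assumes h: "spectral_char Y h"
    and m: "h' \<in> borel_measurable borel" and eq: "AE l in lborel. h l = h' l"
  shows "spectral_char Y h'"
proof -
  have AEM: "AE l in M. h l = h' l" using eq by (subst AE_density) (auto elim: eventually_mono)
  have nn: "(\<integral>\<^sup>+l. ennreal ((cmod (h l - u l))\<^sup>2) \<partial>M) = (\<integral>\<^sup>+l. ennreal ((cmod (h' l - u l))\<^sup>2) \<partial>M)"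
    "(\<integral>\<^sup>+l. ennreal ((cmod (u l - h l))\<^sup>2) \<partial>M) = (\<integral>\<^sup>+l. ennreal ((cmod (u l - h' l))\<^sup>2) \<partial>M)" for u
    using AEM by (auto intro!: nn_integral_cong_AE elim!: eventually_mono)
  have hL: "h \<in> L2 M" using h by (auto simp: spectral_characteristic_def has_stoch_integral_def)
  have "h' \<in> L2 M" by (rule L2_cong_AE[OF hL _ AEM]) (use m in simp)
  then show ?thesis
    using h unfolding spectral_characteristic_def has_stoch_integral_def L2_closed_span_def L2_tendsto_def
    by (simp add: nn)
qed

text \<open>Sums \<open>ts\<close> tending to \<open>Y\<close> are Cauchy; by isometry so are the
  sums \<open>tp\<close>, and completeness supplies \<open>h\<close>. Covariances and norms hold for
  the sums and pass to the limit.\<close>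

lemma spectral_characteristic_exists:
  assumes Y: "Y \<in> L2_closed_span P obs \<zeta>"
  obtains h where "spectral_char Y h"
    "\<And>u. ip P Y (\<zeta> u) = of_real (1 / (2 * pi)) * ip M h (\<lambda>l. cis (u * l))"
    "(nrm P Y)\<^sup>2 = (nrm M h)\<^sup>2 / (2 * pi)"
proof -
  have YL: "Y \<in> L2 P" using Y by (simp add: L2_closed_span_def)
  obtain J b where J: "\<And>n. finite (J n)" "\<And>n. J n \<subseteq> obs" "L2_lim P (\<lambda>n. ts (J n) (b n)) Y"
    by (rule closed_span_sequence[OF Y \<zeta>_L2], rule that, assumption, assumption, unfold ts_def, assumption)
  obtain h where h: "h \<in> L2 M" "L2_lim M (\<lambda>n. tp (J n) (b n)) h"
  proof (rule L2_complete[of "\<lambda>n. tp (J n) (b n)" M])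
    fix e :: real assume "0 < e"
    then have "0 < e / sqrt (2 * pi)" by simp
    from Cauchy_of_convergent[OF ts_L2 YL J(3) this] obtain n0 where
      n0: "\<And>m n. m \<ge> n0 \<Longrightarrow> n \<ge> n0 \<Longrightarrow> nrm P (\<lambda>w. ts (J m) (b m) w - ts (J n) (b n) w) < e / sqrt (2 * pi)" by blast
    then show "\<exists>N. \<forall>m\<ge>N. \<forall>n\<ge>N. nrm M (\<lambda>w. tp (J m) (b m) w - tp (J n) (b n) w) < e"
      unfolding trigonometric_isometry[OF J(1) J(1)] by (auto simp: divide_less_cancel)
  qed (rule tp_M)
  have "h \<in> L2_closed_span M obs (\<lambda>t l. cis (t * l))"
    by (rule closed_span_limit[OF h(1) cis_M J(1,2)]) (use h(2) in \<open>simp add: tp_def\<close>)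
  then have "spectral_char Y h"
    using has_stoch_integral_of_limit[OF J(1) h YL J(3)] by (simp add: spectral_characteristic_def)
  moreover have "ip P Y (\<zeta> u) = of_real (1 / (2 * pi)) * ip M h (\<lambda>l. cis (u * l))" for u
  proof (rule LIMSEQ_unique)
    show "(\<lambda>n. ip P (ts (J n) (b n)) (\<zeta> u)) \<longlonglongrightarrow> ip P Y (\<zeta> u)" by (rule ip_tendsto[OF ts_L2 YL J(3) \<zeta>_L2])
    show "(\<lambda>n. ip P (ts (J n) (b n)) (\<zeta> u)) \<longlonglongrightarrow> of_real (1 / (2 * pi)) * ip M h (\<lambda>l. cis (u * l))"
      unfolding ts_ip by (intro tendsto_mult tendsto_const ip_tendsto[OF tp_M h cis_M])
  qed
  moreover have "(nrm P Y)\<^sup>2 = (nrm M h)\<^sup>2 / (2 * pi)"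
  proof (rule LIMSEQ_unique)
    show "(\<lambda>n. (nrm P (ts (J n) (b n)))\<^sup>2) \<longlonglongrightarrow> (nrm P Y)\<^sup>2" by (intro tendsto_power nrm_tendsto[OF ts_L2 YL J(3)])
    have "nrm P (ts (J n) (b n)) = nrm M (tp (J n) (b n)) / sqrt (2 * pi)" for n
      using trigonometric_isometry[OF J(1) finite.emptyI, of n "b n"] by (simp add: ts_def[abs_def] tp_def[abs_def])
    then have "(nrm P (ts (J n) (b n)))\<^sup>2 = (nrm M (tp (J n) (b n)))\<^sup>2 / (2 * pi)" for n by (simp add: power_divide)
    then show "(\<lambda>n. (nrm P (ts (J n) (b n)))\<^sup>2) \<longlonglongrightarrow> (nrm M h)\<^sup>2 / (2 * pi)"
      by (simp only:) (intro tendsto_divide tendsto_const tendsto_power nrm_tendsto[OF tp_M h], simp)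
  qed
  ultimately show ?thesis by (rule that)
qed

end

section \<open>The operators \<open>R\<close> and \<open>Q\<close>\<close>

context filtering
begin

lemma T_integral_half_line:
  assumes \<phi>: "integrable lborel \<phi>" and 0: "\<And>t. t < 0 \<Longrightarrow> \<phi> t = 0"
  shows "T_integral s N K \<phi> = (LBINT t. \<phi> t)"
proof -
  have [measurable]: "\<phi> \<in> borel_measurable borel" using \<phi> by auto
  have "cut \<phi> = \<phi>"
    using 0 by (force simp: cut_def fun_eq_iff Tset_def split: split_indicator)
  then have "T_integral s N K \<phi> = (LBINT t. of_real (wt t) * \<phi> t)" by (subst T_integral_wt) (auto simp: \<phi>)
  also have "\<dots> = (LBINT t. \<phi> t)"
  proof (rule integral_cong_AE)
    show "AE t in lborel. of_real (wt t) * \<phi> t = \<phi> t"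
      using AE_lborel_singleton[of 0]
    proof eventually_elim
      case (elim t)
      then show ?case using 0[of t] wt_positive[of t] by (cases "t < 0") auto
    qed
  qed measurable
  finally show ?thesis .
qed

text \<open>The kernel depends on \<open>u + t\<close>, so the transform enters reflected, at
  \<open>- l\<close>; for the zero extension of \<open>a\<close> this is the function
  \<open>A\<close>. As \<open>x\<close> is integrable and lives on the half line, Fubini suffices
  and the weight disappears.\<close>

lemma R_trunc_ift:
  assumes x: "integrable lborel x" and 0: "\<And>t. t < 0 \<Longrightarrow> x t = 0"
  shows "R_trunc s N K f g n x = ift (\<lambda>l. indicator (tr n) l * (ft x (- l) * of_real (f l) / of_real (f l + g l)))"
proof
  fix t
  have [measurable]: "x \<in> borel_measurable borel" using x by auto
  obtain B where B: "\<And>l. cmod (indicator (tr n) l / of_real (f l + g l)) \<le> B" using tr_inverse_bounded by blast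
  define k where "k l = indicator (tr n) l * cis (- (l * t)) * of_real (f l / (f l + g l))" for l
  have k: "integrable lborel k"
  proof -
    have "integrable lborel (\<lambda>l. complex_of_real (f l) * (indicator (tr n) l / of_real (f l + g l) * cis (- (l * t))))"
      by (rule integrable_mult_bounded[where B=B]) (use f_int B in \<open>simp_all add: norm_mult norm_divide\<close>)
    then show ?thesis by (simp add: k_def[abs_def] mult_ac)
  qed
  then have [measurable]: "k \<in> borel_measurable borel" by auto
  have e: "(LBINT l:tr n. cis (- (l * (u + t))) * of_real (f l / (f l + g l))) = (LBINT l. k l * cis (- (u * l)))" for u
    unfolding set_lebesgue_integral_def k_def
    by (rule Bochner_Integration.integral_cong) (auto simp: cis_mult algebra_simps split: split_indicator)
  have "(LBINT l. k l * cis (- (u * l))) = ft k (- u)" for u by (simp add: ft_def mult.commute)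
  then have "integrable lborel (\<lambda>u. x u * (LBINT l. k l * cis (- (u * l))))"
    using integrable_mult_bounded[OF x, of "\<lambda>u. ft k (- u)" "LBINT l. cmod (k l)"] by (simp add: ft_bound k)
  then have "T_integral s N K (\<lambda>u. x u * (LBINT l. k l * cis (- (u * l)))) = (LBINT u. x u * (LBINT l. k l * cis (- (u * l))))"
    by (rule T_integral_half_line) (simp add: 0)
  also have "\<dots> = (LBINT l. k l * (LBINT u. x u * cis (- (u * l))))"
    by (rule fubini_bounded_kernel(1)[OF x k, where C=1]) auto
  also have "\<dots> = ft (\<lambda>l. indicator (tr n) l * (ft x (- l) * of_real (f l) / of_real (f l + g l))) (- t)"
    unfolding ft_def[of _ "- t"] ft_def[of x] k_def
    by (rule Bochner_Integration.integral_cong) (auto simp: mult_ac)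
  finally show "R_trunc s N K f g n x t = ift (\<lambda>l. indicator (tr n) l * (ft x (- l) * of_real (f l) / of_real (f l + g l))) t"
    unfolding R_trunc_def e ift_def by simp
qed

text \<open>Since \<open>f\<^sup>2 / (f + g) \<le> f\<close>, a bounded amplitude gives finite
  energy for the weight \<open>1 / (f + g)\<close>.\<close>

lemma V_signal_L2:
  assumes [measurable]: "A \<in> borel_measurable borel" and A: "\<And>l. cmod (A l) \<le> B"
  shows "V (\<lambda>l. A l * of_real (f l)) \<in> L2 lborel"
    and "(nrm lborel (V (\<lambda>l. A l * of_real (f l))))\<^sup>2 = (LBINT l. (cmod (A l))\<^sup>2 * (f l)\<^sup>2 / (f l + g l))"
    and "integrable lborel (\<lambda>l. (cmod (A l))\<^sup>2 * (f l)\<^sup>2 / (f l + g l))"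
proof -
  have sq: "(cmod (V (\<lambda>l. A l * of_real (f l)) l))\<^sup>2 = (cmod (A l))\<^sup>2 * (f l)\<^sup>2 / (f l + g l)" for l
    using fg_nonneg[of l] by (simp add: V_def norm_mult norm_divide power_mult_distrib power_divide)
  have le: "(cmod (A l))\<^sup>2 * (f l)\<^sup>2 / (f l + g l) \<le> B\<^sup>2 * f l" for l
  proof (cases "f l + g l = 0")
    case True
    then show ?thesis using f_nonneg[of l] by (auto intro!: mult_nonneg_nonneg)
  next
    case False
    then have p: "0 < f l + g l" using fg_nonneg[of l] by simp
    have "(cmod (A l))\<^sup>2 * (f l * f l) \<le> B\<^sup>2 * (f l * (f l + g l))"
      using A f_nonneg[of l] g_nonneg[of l] by (intro mult_mono power_mono mult_left_mono) auto
    then show ?thesis using p by (simp add: pos_divide_le_eq power2_eq_square[of "f l"] mult_ac)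
  qed
  show int: "integrable lborel (\<lambda>l. (cmod (A l))\<^sup>2 * (f l)\<^sup>2 / (f l + g l))"
  proof (rule Bochner_Integration.integrable_bound)
    show "integrable lborel (\<lambda>l. B\<^sup>2 * f l)" using f_int by simp
    show "AE l in lborel. norm ((cmod (A l))\<^sup>2 * (f l)\<^sup>2 / (f l + g l)) \<le> norm (B\<^sup>2 * f l)"
      using le fg_nonneg f_nonneg by (auto intro!: AE_I2 simp: abs_mult)
  qed measurable
  show "V (\<lambda>l. A l * of_real (f l)) \<in> L2 lborel" by (rule L2I) (auto simp: sq int)
  show "(nrm lborel (V (\<lambda>l. A l * of_real (f l))))\<^sup>2 = (LBINT l. (cmod (A l))\<^sup>2 * (f l)\<^sup>2 / (f l + g l))"
    unfolding nrm_sq sq ..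
qed

text \<open>The limit in \<open>R_op\<close> is evaluated against elements of finite energy. The
  result has the shape of the weak equation in \<open>B_op_iff\<close>, so \<open>R a\<close> and
  \<open>B\<close> can be compared directly.\<close>

lemma T_inner_R_op:
  assumes x: "integrable lborel x" and 0: "\<And>t. t < 0 \<Longrightarrow> x t = 0" and R: "R_op s N K f g x r"
    and z: "z \<in> L2_T" "wFT (W z) Z" "V Z \<in> L2 lborel"
  shows "inner_T r z = ip lborel (V (\<lambda>l. ft x (- l) * of_real (f l))) (V Z) / (2 * pi)"
proof (rule LIMSEQ_unique)
  have [measurable]: "x \<in> borel_measurable borel" using x by auto
  let ?G = "\<lambda>n l. indicator (tr n) l * (ft x (- l) * of_real (f l) / of_real (f l + g l))"
  define B where "B = (LBINT t. cmod (x t))"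
  have a: "V (\<lambda>l. ft x (- l) * of_real (f l)) \<in> L2 lborel"
    by (rule V_signal_L2[of _ B]) (auto simp: B_def ft_bound x)
  have G: "L12 (?G n)" for n
  proof -
    have "cmod (indicator (tr n) l * (ft x (- l) * of_real (f l / (f l + g l)))) \<le> B * 1" for l
    proof -
      have "\<bar>f l / (f l + g l)\<bar> \<le> 1" using f_nonneg[of l] g_nonneg[of l] by (auto simp: divide_le_eq_1)
      then have "cmod (ft x (- l)) * \<bar>f l / (f l + g l)\<bar> \<le> B * 1"
        unfolding B_def by (intro mult_mono ft_bound x) (auto intro: integral_nonneg_AE)
      moreover have "0 \<le> B * 1" unfolding B_def by (auto intro: integral_nonneg_AE)
      ultimately show ?thesis by (simp add: norm_mult del: of_real_divide split: split_indicator)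
    qed
    then have "L12 (\<lambda>l. indicator {- real n..real n} l * (indicator (tr n) l * (ft x (- l) * of_real (f l / (f l + g l)))))"
      by (intro L12_mult_bounded[OF L12_indicator]) auto
    then show ?thesis by (subst tr_interval) (simp add: mult_ac)
  qed
  have RG: "R_trunc s N K f g n x = ift (?G n)" for n by (rule R_trunc_ift[OF x 0])
  have L: "R_trunc s N K f g n x \<in> L2 lborel" for n
    unfolding RG by (rule ift_L2_bound[OF G])
  show "(\<lambda>n. inner_T (R_trunc s N K f g n x) z) \<longlonglongrightarrow> inner_T r z"
    by (rule T_inner_tendsto[OF L2T_I[OF L] _ z(1)]) (use R in \<open>auto simp: R_op_def\<close>)
  have "inner_T (R_trunc s N K f g n x) z = ip lborel (\<lambda>l. indicator (tr n) l * V (\<lambda>l. ft x (- l) * of_real (f l)) l) (V Z) / (2 * pi)" for n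
  proof -
    have "inner_T (R_trunc s N K f g n x) z = ip lborel (ift (?G n)) (W z)"
      using T_inner_ip'[OF L z(1), of n] unfolding RG .
    also have "\<dots> = (LBINT l. ?G n l * cnj (Z l)) / (2 * pi)"
      unfolding ip_def by (rule ift_multiplication[OF G z(2)])
    also have "(LBINT l. ?G n l * cnj (Z l)) = ip lborel (\<lambda>l. indicator (tr n) l * V (\<lambda>l. ft x (- l) * of_real (f l)) l) (V Z)"
      unfolding ip_def mult.assoc[of "indicator _ _"] V_mult by (rule Bochner_Integration.integral_cong) auto
    finally show ?thesis .
  qed
  moreover have "(\<lambda>n. ip lborel (\<lambda>l. indicator (tr n) l * V (\<lambda>l. ft x (- l) * of_real (f l)) l) (V Z) / (2 * pi))
      \<longlonglongrightarrow> ip lborel (V (\<lambda>l. ft x (- l) * of_real (f l))) (V Z) / (2 * pi)"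
    by (intro tendsto_divide tendsto_const ip_tendsto[OF tr_L2_tendsto(1)[OF a] a tr_L2_tendsto(2)[OF a] z(3)]) simp
  ultimately show "(\<lambda>n. inner_T (R_trunc s N K f g n x) z) \<longlonglongrightarrow> ip lborel (V (\<lambda>l. ft x (- l) * of_real (f l))) (V Z) / (2 * pi)"
    by simp
qed

lemma Q_symbol: "integrable lborel (\<lambda>l. f l * g l / (f l + g l))" "0 \<le> f l * g l / (f l + g l)"
proof -
  show nn: "0 \<le> f l * g l / (f l + g l)" for l
    using f_nonneg g_nonneg by (intro divide_nonneg_nonneg mult_nonneg_nonneg add_nonneg_nonneg) auto
  show "integrable lborel (\<lambda>l. f l * g l / (f l + g l))"
  proof (rule Bochner_Integration.integrable_bound[OF f_int])
    have "f l * g l / (f l + g l) \<le> f l" for l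
    proof (cases "f l + g l = 0")
      case False
      then have "0 < f l + g l" using fg_nonneg[of l] by simp
      then show ?thesis using f_nonneg[of l] by (simp add: pos_divide_le_eq mult_left_mono)
    qed (use f_nonneg in simp)
    then show "AE l in lborel. norm (f l * g l / (f l + g l)) \<le> norm (f l)"
      by (intro AE_I2) (simp only: real_norm_def abs_of_nonneg[OF nn] abs_of_nonneg[OF f_nonneg])
  qed measurable
qed

text \<open>The kernel contains \<open>u - t\<close>, so the transform of \<open>x\<close> appears
  at \<open>l\<close>, not at \<open>- l\<close> as for \<open>R\<close>. This mismatch is what puts
  the conjugate of \<open>a\<close> into the error formula.\<close>

lemma T_inner_Q_op:
  assumes x: "integrable lborel x" and 0: "\<And>t. t < 0 \<Longrightarrow> x t = 0"
  shows "inner_T (Q_op s N K f g x) x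
    = of_real ((LBINT l. f l * g l / (f l + g l) * (cmod (ft x l))\<^sup>2) / (2 * pi))"
proof -
  have [measurable]: "x \<in> borel_measurable borel" using x by auto
  define q where "q l = complex_of_real (f l * g l / (f l + g l))" for l
  have q: "integrable lborel q" unfolding q_def[abs_def] complex_of_real_integrable_eq by (rule Q_symbol)
  define H where "H l = q l * ft x l" for l
  have H: "integrable lborel H" unfolding H_def
    by (rule integrable_mult_bounded[OF q, of _ "LBINT t. cmod (x t)"]) (auto simp: ft_bound x)
  then have [measurable]: "H \<in> borel_measurable borel" by auto
  have Q: "Q_op s N K f g x = ift H"
  proof
    fix t
    define k where "k l = q l * cis (- (t * l))" for l
    have k: "integrable lborel k" unfolding k_def by (rule integrable_mult_bounded[OF q, of _ 1]) auto
    have e: "(LBINT l. cis (l * (u - t)) * of_real (f l * g l / (f l + g l))) = (LBINT l. k l * cis (u * l))" for u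
      by (rule Bochner_Integration.integral_cong) (auto simp: k_def q_def cis_mult algebra_simps)
    have "(LBINT l. k l * cis (u * l)) = ft k u" for u by (simp add: ft_def mult.commute)
    then have "integrable lborel (\<lambda>u. x u * (LBINT l. k l * cis (u * l)))"
      using integrable_mult_bounded[OF x, of "ft k" "LBINT l. cmod (k l)"] k by (simp add: ft_bound)
    then have "T_integral s N K (\<lambda>u. x u * (LBINT l. k l * cis (u * l))) = (LBINT u. x u * (LBINT l. k l * cis (u * l)))"
      by (rule T_integral_half_line) (simp add: 0)
    also have "\<dots> = (LBINT l. k l * (LBINT u. x u * cis (u * l)))"
      by (rule fubini_bounded_kernel(1)[OF x k, where C=1]) auto
    also have "\<dots> = ft H (- t)"
      unfolding ft_def[of H] H_def unfolding ft_def[of x] k_def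
      by (rule Bochner_Integration.integral_cong) (auto simp: mult_ac)
    finally show "Q_op s N K f g x t = ift H t" unfolding Q_op_def e ift_def by simp
  qed
  have i: "integrable lborel (\<lambda>t. cnj (x t) * ift H t)"
    by (rule integrable_mult_bounded[of _ _ "(LBINT t. cmod (H t)) / (2 * pi)"]) (auto simp: x ift_bound H)
  have "inner_T (Q_op s N K f g x) x = (LBINT t. ift H t * cnj (x t))"
    unfolding T_inner_def Q by (rule T_integral_half_line) (use i in \<open>simp_all add: 0 mult.commute\<close>)
  also have "\<dots> = (LBINT t. cnj (x t) * (LBINT l. H l * cis (- (t * l)))) / (2 * pi)"
    unfolding ift_def ft_def by (simp add: mult.commute[of "_::complex"] mult.commute[of "_::real"])
  also have "(LBINT t. cnj (x t) * (LBINT l. H l * cis (- (t * l)))) = (LBINT l. H l * (LBINT t. cnj (x t) * cis (- (t * l))))"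
    by (rule fubini_bounded_kernel(1)[OF _ H, where C=1]) (use x in auto)
  also have "\<dots> = (LBINT l. complex_of_real (f l * g l / (f l + g l) * (cmod (ft x l))\<^sup>2))"
  proof (rule Bochner_Integration.integral_cong[OF refl])
    fix l
    have "(LBINT t. cnj (x t) * cis (- (t * l))) = cnj (ft x l)" by (simp add: cnj_ft) (simp add: ft_def)
    then show "H l * (LBINT t. cnj (x t) * cis (- (t * l))) = complex_of_real (f l * g l / (f l + g l) * (cmod (ft x l))\<^sup>2)"
      unfolding H_def q_def of_real_mult[of _ "(cmod (ft x l))\<^sup>2"] complex_norm_square by simp
  qed
  finally show ?thesis unfolding integral_complex_of_real by simp
qed

end

section \<open>The optimal estimate\<close>

locale estimation_problem = signal_noise s N K f g P \<xi> \<eta> Z\<xi> Z\<eta>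
  for s :: nat and N K :: "nat \<Rightarrow> real" and f g :: "real \<Rightarrow> real"
    and P :: "'w measure" and \<xi> \<eta> :: "real \<Rightarrow> 'w \<Rightarrow> complex" and Z\<xi> Z\<eta> :: "real set \<Rightarrow> 'w \<Rightarrow> complex" +
  fixes a :: "real \<Rightarrow> complex" and A\<xi> Ahat :: "'w \<Rightarrow> complex"
  assumes a_int: "set_integrable lborel (Rset s N K) a"
    and functional: "has_mean_square_integral P (Rset s N K) (\<lambda>t w. a t * \<xi> (- t) w) A\<xi>"
    and optimal: "optimal_estimate P s N K \<xi> \<eta> A\<xi> Ahat"
begin

abbreviation "a0 \<equiv> extend_zero s N K a"
abbreviation "A \<equiv> A_fun s N K a"

lemma a0_eq: "a0 = (\<lambda>t. indicator (Rset s N K) t *\<^sub>R a t)"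
  by (auto simp: extend_zero_def fun_eq_iff split: split_indicator)

lemma a0_integrable: "integrable lborel a0"
  using a_int unfolding a0_eq set_integrable_def .

lemma a0_measurable [measurable]: "a0 \<in> borel_measurable borel"
  using a0_integrable by auto

lemma a0_negative: "t < 0 \<Longrightarrow> a0 t = 0"
  by (auto simp: extend_zero_def Rset_def)

lemma A_ft: "A l = ft a0 (- l)"
  unfolding A_fun_def set_lebesgue_integral_def ft_def a0_eq by simp

lemma A_measurable [measurable]: "A \<in> borel_measurable borel"
  unfolding A_ft[abs_def] by measurable

lemma A_bound: "cmod (A l) \<le> (LBINT t. cmod (a0 t))"
  unfolding A_ft by (rule ft_bound[OF a0_integrable])

lemma A_L2: "A \<in> L2 (mu f)" "A \<in> L2 M"
  by (rule mu_L2_bounded[OF f_int f_nonneg _ A_bound], simp, rule mu_L2_bounded[OF fg_int fg_nonneg _ A_bound], simp)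

lemma A\<xi>_L2: "A\<xi> \<in> L2 P" using functional by (simp add: has_mean_square_integral_def)

lemma functional_ip:
  assumes "Y \<in> L2 P"
  shows "ip P A\<xi> Y = (LBINT t. a0 t * ip P (\<xi> (- t)) Y)"
proof -
  have "ip P A\<xi> Y = (LBINT t:Rset s N K. LINT w|P. a t * \<xi> (- t) w * cnj (Y w))"
    using functional assms by (simp add: has_mean_square_integral_def ip_def)
  also have "\<dots> = (LBINT t. a0 t * ip P (\<xi> (- t)) Y)"
    unfolding set_lebesgue_integral_def a0_eq ip_def
    by (rule Bochner_Integration.integral_cong) (auto simp: mult.assoc)
  finally show ?thesis .
qed

lemma A_integral: "(LBINT t. a0 t * cis (- (t * l))) = A l"
  by (simp add: A_ft ft_def)

text \<open>The mean-square integral is known through its inner products only, so the exchange of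
  integrals is between the real variables \<open>t\<close> and \<open>l\<close>, after the
  covariance has been written spectrally.\<close>

lemma functional_\<xi>: "ip P A\<xi> (\<xi> u) = of_real (1 / (2 * pi)) * ip (mu f) A (\<lambda>l. cis (u * l))"
proof -
  have fi: "integrable lborel (\<lambda>l. complex_of_real (f l) * cnj (cis (u * l)))"
    by (rule integrable_mult_bounded[where B=1]) (use f_int in auto)
  have "ip P A\<xi> (\<xi> u) = (LBINT t. a0 t * (of_real (1 / (2 * pi)) * ip (mu f) (\<lambda>l. cis (- t * l)) (\<lambda>l. cis (u * l))))"
    unfolding functional_ip[OF \<xi>_L2] stationary_ip[OF f_int f_nonneg \<xi>(1,2)] ..
  also have "\<dots> = of_real (1 / (2 * pi)) * (LBINT t. a0 t * (LBINT l. (of_real (f l) * cnj (cis (u * l))) * cis (- (t * l))))"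
    by (subst mu_ip[OF f_int f_nonneg], simp, simp) (simp add: mult_ac flip: integral_mult_right_zero)
  also have "(LBINT t. a0 t * (LBINT l. (of_real (f l) * cnj (cis (u * l))) * cis (- (t * l))))
      = (LBINT l. (of_real (f l) * cnj (cis (u * l))) * (LBINT t. a0 t * cis (- (t * l))))"
    by (rule fubini_bounded_kernel(1)[OF a0_integrable fi, where C=1]) auto
  also have "\<dots> = ip (mu f) A (\<lambda>l. cis (u * l))"
    unfolding A_integral by (subst mu_ip[OF f_int f_nonneg]) (auto intro!: Bochner_Integration.integral_cong)
  finally show ?thesis .
qed

lemma functional_\<eta>: "ip P A\<xi> (\<eta> u) = 0"
  unfolding functional_ip[OF \<eta>_L2] \<xi>_\<eta> by simp

lemma functional_\<zeta>: "ip P A\<xi> (\<zeta> u) = of_real (1 / (2 * pi)) * ip (mu f) A (\<lambda>l. cis (u * l))"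
  by (simp add: ip_add_right \<xi>_L2 \<eta>_L2 A\<xi>_L2 functional_\<xi> functional_\<eta>)

text \<open>\<open>functional_ip\<close> is used twice: with \<open>A\<xi>\<close> itself, and
  inside the integral, through \<open>functional_\<xi>\<close>, with the values
  \<open>\<xi> (- t)\<close>.\<close>

lemma functional_nrm: "(nrm P A\<xi>)\<^sup>2 = (nrm (mu f) A)\<^sup>2 / (2 * pi)"
proof -
  have fA: "integrable lborel (\<lambda>l. complex_of_real (f l) * cnj (A l))"
    by (rule integrable_mult_bounded[where B="LBINT t. cmod (a0 t)"]) (use f_int A_bound in auto)
  have "ip P A\<xi> A\<xi> = (LBINT t. a0 t * cnj (ip P A\<xi> (\<xi> (- t))))"
    unfolding functional_ip[OF A\<xi>_L2] by (simp flip: ip_commute)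
  also have "\<dots> = (LBINT t. of_real (1 / (2 * pi)) * (a0 t * (LBINT l. (of_real (f l) * cnj (A l)) * cis (- (t * l)))))"
  proof (rule Bochner_Integration.integral_cong[OF refl])
    fix t
    have "cnj (ip (mu f) A (\<lambda>l. cis (- t * l))) = (LBINT l. (of_real (f l) * cnj (A l)) * cis (- (t * l)))"
      by (subst mu_ip[OF f_int f_nonneg], simp, simp, subst Bochner_Integration.integral_cnj[symmetric]) (simp add: mult_ac)
    then show "a0 t * cnj (ip P A\<xi> (\<xi> (- t))) = of_real (1 / (2 * pi)) * (a0 t * (LBINT l. (of_real (f l) * cnj (A l)) * cis (- (t * l))))"
      unfolding functional_\<xi> by simp
  qed
  also have "\<dots> = of_real (1 / (2 * pi)) * (LBINT t. a0 t * (LBINT l. (of_real (f l) * cnj (A l)) * cis (- (t * l))))"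
    by (rule integral_mult_right_zero)
  also have "(LBINT t. a0 t * (LBINT l. (of_real (f l) * cnj (A l)) * cis (- (t * l))))
     = (LBINT l. (of_real (f l) * cnj (A l)) * (LBINT t. a0 t * cis (- (t * l))))"
    by (rule fubini_bounded_kernel(1)[OF a0_integrable fA, where C=1]) auto
  also have "\<dots> = ip (mu f) A A"
    unfolding A_integral by (subst mu_ip[OF f_int f_nonneg]) (auto intro!: Bochner_Integration.integral_cong simp: mult_ac)
  finally have "complex_of_real ((nrm P A\<xi>)\<^sup>2) = of_real ((nrm (mu f) A)\<^sup>2 / (2 * pi))"
    unfolding ip_self by simp
  then show ?thesis by (simp only: of_real_eq_iff)
qed

lemma Ahat_span: "Ahat \<in> L2_closed_span P obs \<zeta>"
  using optimal by (simp add: optimal_estimate_def orthogonal_projection_def)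

lemma Ahat_L2: "Ahat \<in> L2 P" using Ahat_span by (simp add: L2_closed_span_def)

lemma projection: "Y \<in> L2_closed_span P obs \<zeta> \<Longrightarrow> ip P A\<xi> Y = ip P Ahat Y"
proof -
  assume Y: "Y \<in> L2_closed_span P obs \<zeta>"
  then have "ip P (\<lambda>w. A\<xi> w - Ahat w) Y = 0"
    using optimal by (simp add: optimal_estimate_def orthogonal_projection_def ip_def)
  moreover have "Y \<in> L2 P" using Y by (simp add: L2_closed_span_def)
  ultimately show ?thesis by (simp add: ip_diff_left A\<xi>_L2 Ahat_L2)
qed

lemma error_nrm: "(nrm P (\<lambda>w. A\<xi> w - Ahat w))\<^sup>2 = (nrm P A\<xi>)\<^sup>2 - (nrm P Ahat)\<^sup>2"
  by (simp add: nrm_diff_sq A\<xi>_L2 Ahat_L2 projection[OF Ahat_span] ip_self del: of_real_power)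

lemma estimate_formula:
  assumes minimality: "minimality_condition f g" and invertible: "B_invertible s N K f g"
    and R: "R_op s N K f g a0 ra" and B: "B_op s N K f g c ra" and C: "T_fourier s N K c C"
  obtains h where "spectral_char Ahat h"
    "AE l in lborel. C l = A l * of_real (f l) - of_real (f l + g l) * h l"
    "(nrm P (\<lambda>w. A\<xi> w - Ahat w))\<^sup>2 = ((nrm (mu f) A)\<^sup>2 - (nrm M h)\<^sup>2) / (2 * pi)"
    "ip (mu f) A h = of_real ((nrm M h)\<^sup>2)"
    "inner_T ra c = of_real (((LBINT l. (cmod (A l))\<^sup>2 * (f l)\<^sup>2 / (f l + g l)) - (nrm M h)\<^sup>2) / (2 * pi))"
proof -
  obtain \<kappa> where \<kappa>: "AE l in lborel. f l + g l \<le> \<kappa>" using density_bounded[OF invertible minimality] by blast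
  obtain h where h: "spectral_char Ahat h"
    "\<And>u. ip P Ahat (\<zeta> u) = of_real (1 / (2 * pi)) * ip M h (\<lambda>l. cis (u * l))"
    "(nrm P Ahat)\<^sup>2 = (nrm M h)\<^sup>2 / (2 * pi)"
    by (rule spectral_characteristic_exists[OF Ahat_span], rule that)
  have hspan: "h \<in> L2_closed_span M obs (\<lambda>t l. cis (t * l))" using h(1) by (simp add: spectral_characteristic_def)
  then have hL: "h \<in> L2 M" by (simp add: L2_closed_span_def)
  have hm [measurable]: "h \<in> borel_measurable borel" by (rule M_L2_measurable[OF hL])
  define S where "S l = A l * of_real (f l)" for l
  have Sm [measurable]: "S \<in> borel_measurable borel" unfolding S_def[abs_def] by measurable
  have VS: "V S \<in> L2 lborel" "(nrm lborel (V S))\<^sup>2 = (LBINT l. (cmod (A l))\<^sup>2 * (f l)\<^sup>2 / (f l + g l))"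
    unfolding S_def[abs_def] by (rule V_signal_L2[OF A_measurable A_bound])+
  have Uh: "U h \<in> L2 lborel" by (rule U_L2[OF hL])
  \<comment> \<open>Since \<open>V \<Phi>\<close> is the difference of \<open>V S\<close> and
    \<open>U h\<close>, both in \<open>L2 lborel\<close>, \<Phi> has finite energy before it is
    known to be square integrable.\<close>
  define \<Phi> where "\<Phi> l = S l - of_real (f l + g l) * h l" for l
  have \<Phi>m [measurable]: "\<Phi> \<in> borel_measurable borel" unfolding \<Phi>_def[abs_def] by measurable
  have V\<Phi>: "V \<Phi> = (\<lambda>l. V S l - U h l)"
  proof
    fix l
    have "complex_of_real (f l + g l) / of_real (sqrt (f l + g l)) = of_real (sqrt (f l + g l))"
      unfolding of_real_divide[symmetric] real_div_sqrt[OF fg_nonneg] ..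
    then show "V \<Phi> l = V S l - U h l"
      unfolding V_def U_def \<Phi>_def diff_divide_distrib times_divide_eq_left[symmetric] by simp
  qed
  have V\<Phi>L: "V \<Phi> \<in> L2 lborel" unfolding V\<Phi> by (rule L2_diff[OF VS(1) Uh])
  have \<Phi>i: "integrable lborel \<Phi>" by (rule V_L2_imp_integrable[OF \<Phi>m V\<Phi>L])
  have zero: "ift \<Phi> u = 0" if u: "u \<in> obs" for u
  proof -
    have "ip P A\<xi> (\<zeta> u) = ip P Ahat (\<zeta> u)"
      by (rule projection, rule closed_span_generator[OF u \<zeta>_L2])
    then have eq: "ip (mu f) A (\<lambda>l. cis (u * l)) = ip M h (\<lambda>l. cis (u * l))"
      unfolding functional_\<zeta> h(2) by simp
    have i1: "integrable lborel (\<lambda>l. S l * cis (- (u * l)))"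
    proof -
      have "integrable lborel (\<lambda>l. complex_of_real (f l) * (A l * cis (- (u * l))))"
        by (rule integrable_mult_bounded[where B = "LBINT t. cmod (a0 t)"]) (use f_int A_bound in \<open>auto simp: norm_mult\<close>)
      then show ?thesis by (simp add: S_def mult_ac)
    qed
    have i2: "integrable lborel (\<lambda>l. \<Phi> l * cis (- (u * l)))"
      by (rule integrable_mult_bounded[OF \<Phi>i, of _ 1]) auto
    have i3: "integrable lborel (\<lambda>l. of_real (f l + g l) * h l * cis (- (u * l)))"
      using Bochner_Integration.integrable_diff[OF i1 i2] by (simp add: \<Phi>_def left_diff_distrib)
    have "ip (mu f) A (\<lambda>l. cis (u * l)) = (LBINT l. S l * cis (- (u * l)))"
      by (subst mu_ip[OF f_int f_nonneg]) (auto simp: S_def cis_cnj mult_ac)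
    moreover have "ip M h (\<lambda>l. cis (u * l)) = (LBINT l. of_real (f l + g l) * h l * cis (- (u * l)))"
      by (subst mu_ip[OF fg_int fg_nonneg]) (auto simp: cis_cnj mult.assoc)
    ultimately have "(LBINT l. \<Phi> l * cis (- (u * l))) = 0"
      using eq i1 i3 by (simp add: \<Phi>_def left_diff_distrib)
    then show ?thesis by (simp add: ift_def ft_def mult.commute)
  qed
  \<comment> \<open>This makes \<open>V S = U h + V \<Phi>\<close> an orthogonal decomposition, so
    the inner product of \<open>V S\<close> with \<open>U h\<close> is the squared norm of
    \<open>h\<close>; both error formulas rest on it.\<close>
  have orth: "ip lborel (U h) (V \<Phi>) = 0" by (rule closed_span_orthogonal[OF hspan \<Phi>i V\<Phi>L zero])
  then have "ip lborel (U h) (V S) = ip lborel (U h) (U h)"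
    unfolding V\<Phi> by (simp add: ip_diff_right VS Uh)
  then have UhVS: "ip lborel (U h) (V S) = of_real ((nrm M h)\<^sup>2)" by (simp add: ip_self M_nrm[OF hL])
  then have VSUh: "ip lborel (V S) (U h) = of_real ((nrm M h)\<^sup>2)"
    unfolding ip_commute[of lborel "V S"] by simp
  obtain c1 where c1: "c1 \<in> L2_T" "wFT (W c1) \<Phi>"
    using inverse_transform_in_L2T[OF \<kappa> \<Phi>m V\<Phi>L zero] by blast
  have RA: "inner_T ra z = ip lborel (V S) (V Z) / (2 * pi)"
    if "z \<in> L2_T" "wFT (W z) Z" "V Z \<in> L2 lborel" for z Z
    using T_inner_R_op[OF a0_integrable a0_negative R that] unfolding S_def[abs_def] A_ft .
  have raL: "ra \<in> L2_T" using R by (simp add: R_op_def)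
  have "B_op s N K f g c1 ra"
    unfolding B_op_iff[OF c1 V\<Phi>L raL]
  proof (intro allI impI)
    fix z Z assume "z \<in> L2_T \<and> wFT (W z) Z \<and> V Z \<in> L2 lborel"
    then have z: "z \<in> L2_T" "wFT (W z) Z" "V Z \<in> L2 lborel" by auto
    have Zi: "integrable lborel Z"
      by (rule V_L2_imp_integrable[OF _ z(3)]) (use z(2) in \<open>auto simp: wFT_def L2_def\<close>)
    \<comment> \<open>\<open>U h\<close> is invisible to all finite-energy elements on
      \<open>T\<close>, so \<open>V \<Phi>\<close> and \<open>V S\<close> pair equally with
      \<open>V Z\<close>; the pairing with \<open>V S\<close> represents \<open>R a\<close>.\<close>
    have "ip lborel (U h) (V Z) = 0"
      by (rule closed_span_orthogonal[OF hspan Zi z(3) ift_observed_zero[OF z]])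
    then show "ip lborel (V \<Phi>) (V Z) / (2 * pi) = inner_T ra z"
      unfolding RA[OF z] V\<Phi> by (simp add: ip_diff_left VS Uh z)
  qed
  then have "AE t in restrict_space lborel T. c1 t = c t"
    using invertible B unfolding B_invertible_def by blast
  then have ae: "AE t in lborel. t \<in> T \<longrightarrow> c1 t = c t"
    by (subst (asm) AE_restrict_space_iff) auto
  have "AE t in lborel. W c1 t = W c t"
    using ae by eventually_elim (auto simp: W_def wt_outside)
  have cL: "c \<in> L2_T" using B by (simp add: B_op_def B_form_domain_def)
  have wC: "wFT (W c) C" by (rule wFT_of_T_fourier[OF cL C])
  have ae\<Phi>: "AE l in lborel. \<Phi> l = C l"
    by (rule wFT_unique[OF c1(2) wC \<open>AE t in lborel. W c1 t = W c t\<close>])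
  have [measurable]: "C \<in> borel_measurable borel" using wC by (auto simp: wFT_def L2_def)
  have VC: "V C \<in> L2 lborel"
    by (rule L2_cong_AE[OF V\<Phi>L]) (use ae\<Phi> in \<open>auto simp: V_def elim: eventually_mono\<close>)
  \<comment> \<open>\<open>R a\<close> is tested against \<open>c\<close> itself, whose transform is
    \<Phi> almost everywhere; the orthogonal decomposition then evaluates the pairing.\<close>
  have "inner_T ra c = ip lborel (V S) (V C) / (2 * pi)" by (rule RA[OF cL wC VC])
  also have "ip lborel (V S) (V C) = ip lborel (V S) (V \<Phi>)"
    unfolding ip_def by (rule integral_cong_AE) (use ae\<Phi> in \<open>auto simp: V_def elim: eventually_mono\<close>)
  also have "\<dots> = of_real ((nrm lborel (V S))\<^sup>2) - of_real ((nrm M h)\<^sup>2)"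
    unfolding V\<Phi> by (simp add: ip_diff_right VS Uh VSUh ip_self del: of_real_power)
  finally have 5: "inner_T ra c = of_real (((LBINT l. (cmod (A l))\<^sup>2 * (f l)\<^sup>2 / (f l + g l)) - (nrm M h)\<^sup>2) / (2 * pi))"
    unfolding VS(2) by simp
  have "ip (mu f) A h = ip lborel (V S) (U h)"
    unfolding mu_ip[OF f_int f_nonneg A_measurable hm] unfolding ip_def
  proof (rule integral_cong_AE)
    show "AE l in lborel. of_real (f l) * (A l * cnj (h l)) = V S l * cnj (U h l)"
      using fg_pos by eventually_elim (simp add: V_def U_def S_def)
  qed measurable
  then have 4: "ip (mu f) A h = of_real ((nrm M h)\<^sup>2)" using VSUh by simp
  have 3: "(nrm P (\<lambda>w. A\<xi> w - Ahat w))\<^sup>2 = ((nrm (mu f) A)\<^sup>2 - (nrm M h)\<^sup>2) / (2 * pi)"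
    unfolding error_nrm functional_nrm h(3) by (simp add: diff_divide_distrib)
  have 2: "AE l in lborel. C l = A l * of_real (f l) - of_real (f l + g l) * h l"
    using ae\<Phi> by eventually_elim (simp add: \<Phi>_def S_def)
  show ?thesis by (rule that[OF h(1) 2 3 4 5])
qed

text \<open>\<open>A g + C = (f + g) (A - h)\<close> and \<open>A f - C = (f + g) h\<close>. The
  first integral is the signal distorted by the filter and the second the noise passed by it;
  expanding the square, \<open>ip\<close> collapses their sum to a difference of norms.\<close>

lemma error_integrals:
  assumes h: "h \<in> L2 M" and C: "AE l in lborel. C l = A l * of_real (f l) - of_real (f l + g l) * h l"
    and ip: "ip (mu f) A h = of_real ((nrm M h)\<^sup>2)" and [measurable]: "C \<in> borel_measurable borel"
  shows "(LBINT l. (cmod (A l * of_real (g l) + C l))\<^sup>2 / (f l + g l)\<^sup>2 * f l) + 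
      (LBINT l. (cmod (A l * of_real (f l) - C l))\<^sup>2 / (f l + g l)\<^sup>2 * g l) = (nrm (mu f) A)\<^sup>2 - (nrm M h)\<^sup>2"
proof -
  have [measurable]: "h \<in> borel_measurable borel" by (rule M_L2_measurable[OF h])
  have hf: "h \<in> L2 (mu f)" and hg: "h \<in> L2 (mu g)"
    by (rule mu_mono[OF f_int f_nonneg fg_int fg_nonneg _ h], simp add: g_nonneg)
       (rule mu_mono[OF g_int g_nonneg fg_int fg_nonneg _ h], simp add: f_nonneg)
  have 1: "(LBINT l. (cmod (A l * of_real (g l) + C l))\<^sup>2 / (f l + g l)\<^sup>2 * f l) = (nrm (mu f) (\<lambda>l. A l - h l))\<^sup>2"
    unfolding mu_nrm[OF f_int f_nonneg borel_measurable_diff[OF A_measurable \<open>h \<in> borel_measurable borel\<close>]]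
  proof (rule integral_cong_AE)
    show "AE l in lborel. (cmod (A l * of_real (g l) + C l))\<^sup>2 / (f l + g l)\<^sup>2 * f l = f l * (cmod (A l - h l))\<^sup>2"
      using C fg_pos
    proof eventually_elim
      case (elim l)
      have "A l * of_real (g l) + C l = of_real (f l + g l) * (A l - h l)"
        unfolding elim(1) by (simp add: algebra_simps)
      then have "cmod (A l * of_real (g l) + C l) = (f l + g l) * cmod (A l - h l)"
        using elim(2) by (simp only: norm_mult norm_of_real abs_of_pos)
      then show ?case using elim(2) by (simp add: power_mult_distrib)
    qed
  qed measurable
  have 2: "(LBINT l. (cmod (A l * of_real (f l) - C l))\<^sup>2 / (f l + g l)\<^sup>2 * g l) = (nrm (mu g) h)\<^sup>2"
    unfolding mu_nrm[OF g_int g_nonneg \<open>h \<in> borel_measurable borel\<close>]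
  proof (rule integral_cong_AE)
    show "AE l in lborel. (cmod (A l * of_real (f l) - C l))\<^sup>2 / (f l + g l)\<^sup>2 * g l = g l * (cmod (h l))\<^sup>2"
      using C fg_pos
    proof eventually_elim
      case (elim l)
      have "A l * of_real (f l) - C l = of_real (f l + g l) * h l"
        unfolding elim(1) by simp
      then have "cmod (A l * of_real (f l) - C l) = (f l + g l) * cmod (h l)"
        using elim(2) by (simp only: norm_mult norm_of_real abs_of_pos)
      then show ?case using elim(2) by (simp add: power_mult_distrib)
    qed
  qed measurable
  have "(nrm (mu f) h)\<^sup>2 + (nrm (mu g) h)\<^sup>2 = (nrm M h)\<^sup>2"
    using hf hg unfolding mu_nrm[OF f_int f_nonneg \<open>h \<in> borel_measurable borel\<close>] mu_nrm[OF g_int g_nonneg \<open>h \<in> borel_measurable borel\<close>]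
      mu_nrm[OF fg_int fg_nonneg \<open>h \<in> borel_measurable borel\<close>]
      mu_L2_iff[OF f_int f_nonneg \<open>h \<in> borel_measurable borel\<close>] mu_L2_iff[OF g_int g_nonneg \<open>h \<in> borel_measurable borel\<close>]
    by (simp add: distrib_right)
  then show ?thesis
    unfolding 1 2 nrm_diff_sq[OF A_L2(1) hf] ip by simp
qed

text \<open>The symbols add up: \<open>f\<^sup>2 / (f + g) + f g / (f + g) = f\<close>. The
  reflection between \<open>ft x\<close> and \<open>A\<close> is absorbed either by conjugation,
  which preserves the modulus pointwise, or by the substitution of \<open>- l\<close> for
  \<open>l\<close> when the densities are even.\<close>

lemma error_operator_form:
  assumes x: "x = (\<lambda>t. cnj (a0 t)) \<or> (x = a0 \<and> (\<forall>l. f (- l) = f l \<and> g (- l) = g l))"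
    and ra: "inner_T ra c = of_real (((LBINT l. (cmod (A l))\<^sup>2 * (f l)\<^sup>2 / (f l + g l)) - r) / (2 * pi))"
  shows "inner_T ra c + inner_T (Q_op s N K f g x) x = of_real (((nrm (mu f) A)\<^sup>2 - r) / (2 * pi))"
proof -
  define q where "q l = f l * g l / (f l + g l)" for l
  have xi: "integrable lborel x" using x a0_integrable by auto
  have x0: "x t = 0" if "t < 0" for t using x a0_negative[OF that] by auto
  have qi: "(LBINT l. q l * (cmod (ft x l))\<^sup>2) = (LBINT l. q l * (cmod (A l))\<^sup>2)"
    using x
  proof
    assume x: "x = (\<lambda>t. cnj (a0 t))"
    have "cmod (ft x l) = cmod (A l)" for l
      using arg_cong[OF cnj_ft[of a0 "- l"], of cmod] unfolding x A_ft by simp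
    then show ?thesis by simp
  next
    assume x: "x = a0 \<and> (\<forall>l. f (- l) = f l \<and> g (- l) = g l)"
    have "(LBINT l. q l * (cmod (ft x l))\<^sup>2) = (LBINT l. q (0 + -1 * l) * (cmod (ft x (0 + -1 * l)))\<^sup>2)"
      by (subst lborel_integral_real_affine[of "-1" _ 0]) simp_all
    then show ?thesis using x by (simp add: A_ft q_def)
  qed
  have i1: "integrable lborel (\<lambda>l. q l * (cmod (A l))\<^sup>2)"
  proof (rule Bochner_Integration.integrable_bound)
    define B where "B = (LBINT t. cmod (a0 t))"
    show "integrable lborel (\<lambda>l. B\<^sup>2 * q l)" unfolding q_def by (intro integrable_mult_right Q_symbol)
    have "q l * (cmod (A l))\<^sup>2 \<le> B\<^sup>2 * q l" for l
      using mult_left_mono[OF power_mono[OF A_bound norm_ge_zero], of "q l" l 2] Q_symbol(2)[of l]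
      by (simp add: B_def q_def mult.commute)
    then show "AE l in lborel. norm (q l * (cmod (A l))\<^sup>2) \<le> norm (B\<^sup>2 * q l)"
      using Q_symbol(2) unfolding q_def[symmetric] by (auto intro!: AE_I2 simp: abs_mult)
    show "(\<lambda>l. q l * (cmod (A l))\<^sup>2) \<in> borel_measurable lborel" unfolding q_def by measurable
  qed
  have "(LBINT l. (cmod (A l))\<^sup>2 * (f l)\<^sup>2 / (f l + g l)) + (LBINT l. q l * (cmod (A l))\<^sup>2)
    = (LBINT l. (cmod (A l))\<^sup>2 * (f l)\<^sup>2 / (f l + g l) + q l * (cmod (A l))\<^sup>2)"
    by (rule Bochner_Integration.integral_add[symmetric, OF V_signal_L2(3)[OF A_measurable A_bound] i1])
  also have "\<dots> = (nrm (mu f) A)\<^sup>2"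
    unfolding mu_nrm[OF f_int f_nonneg A_measurable]
  proof (rule integral_cong_AE)
    show "AE l in lborel. (cmod (A l))\<^sup>2 * (f l)\<^sup>2 / (f l + g l) + q l * (cmod (A l))\<^sup>2 = f l * (cmod (A l))\<^sup>2"
      using fg_pos
    proof eventually_elim
      case (elim l)
      have "(cmod (A l))\<^sup>2 * (f l)\<^sup>2 + f l * g l * (cmod (A l))\<^sup>2 = f l * (cmod (A l))\<^sup>2 * (f l + g l)"
        by (simp add: algebra_simps power2_eq_square)
      then show ?case using elim by (simp add: q_def divide_simps)
    qed
    show "(\<lambda>l. (cmod (A l))\<^sup>2 * (f l)\<^sup>2 / (f l + g l) + q l * (cmod (A l))\<^sup>2) \<in> borel_measurable lborel"
      unfolding q_def by measurable
  qed measurable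
  finally have sum: "(LBINT l. (cmod (A l))\<^sup>2 * (f l)\<^sup>2 / (f l + g l)) + (LBINT l. q l * (cmod (A l))\<^sup>2) = (nrm (mu f) A)\<^sup>2" .
  have "inner_T ra c + inner_T (Q_op s N K f g x) x
     = of_real (((LBINT l. (cmod (A l))\<^sup>2 * (f l)\<^sup>2 / (f l + g l)) - r) / (2 * pi) + (LBINT l. q l * (cmod (A l))\<^sup>2) / (2 * pi))"
  proof -
    have "inner_T (Q_op s N K f g x) x = of_real ((LBINT l. f l * g l / (f l + g l) * (cmod (ft x l))\<^sup>2) / (2 * pi))"
      by (rule T_inner_Q_op[OF xi x0])
    then show ?thesis unfolding ra qi[unfolded q_def] unfolding q_def by (simp only: of_real_add)
  qed
  also have "\<dots> = of_real (((nrm (mu f) A)\<^sup>2 - r) / (2 * pi))"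
    unfolding sum[symmetric] by (simp only: add_divide_distrib[symmetric]) (simp add: algebra_simps)
  finally show ?thesis .
qed

end

text \<open>The operators, the projection and the transform are relations, so \<open>ra\<close>,
  \<open>c\<close>, \<open>C\<close> and \<open>Ahat\<close> are arbitrary versions of the objects
  of the formulas. Accordingly the characteristic is described up to null sets, as an equivalence
  covering all its Borel versions.\<close>

theorem theorem2p1:
  fixes P :: "'w measure"
    and \<xi> \<eta> :: "real \<Rightarrow> 'w \<Rightarrow> complex"
    and Z\<xi> Z\<eta> :: "real set \<Rightarrow> 'w \<Rightarrow> complex"
    and f g :: "real \<Rightarrow> real"
    and s :: nat and N K :: "nat \<Rightarrow> real"
    and a ra c C :: "real \<Rightarrow> complex"
    and A\<xi> Ahat :: "'w \<Rightarrow> complex"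
  assumes "prob_space P"
    and "N 0 = 0" and "K 0 = 0" and "\<forall>k\<in>{1..s}. 0 \<le> N k \<and> 0 \<le> K k"
    and "stationary_process P \<xi>" and "stationary_process P \<eta>"
    and "uncorrelated_processes P \<xi> \<eta>"
    and "has_spectral_density P \<xi> f" and "has_spectral_density P \<eta> g"
    and "spectral_representation P \<xi> Z\<xi> f" and "spectral_representation P \<eta> Z\<eta> g"
    and "minimality_condition f g"
    and "B_invertible s N K f g"
    and "set_integrable lborel (Rset s N K) a"
    and "set_integrable lborel (Rset s N K) (\<lambda>t. t * (cmod (a t))\<^sup>2)"
    and "has_mean_square_integral P (Rset s N K) (\<lambda>t w. a t * \<xi> (- t) w) A\<xi>"
    and "optimal_estimate P s N K \<xi> \<eta> A\<xi> Ahat"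
    and "R_op s N K f g (extend_zero s N K a) ra"
    and "B_op s N K f g c ra"
    and "T_fourier s N K c C"
  shows "(\<forall>h. spectral_characteristic P s N K f g Z\<xi> Z\<eta> Ahat h \<longleftrightarrow>
            h \<in> borel_measurable borel \<and>
            (AE l in lborel.
               h l = A_fun s N K a l * of_real (f l / (f l + g l)) - C l / of_real (f l + g l)))
    \<and> (LINT w|P. (cmod (A\<xi> w - Ahat w))\<^sup>2) =
        (LBINT l. (cmod (A_fun s N K a l * of_real (g l) + C l))\<^sup>2 / (f l + g l)\<^sup>2 * f l) / (2 * pi)
        + (LBINT l. (cmod (A_fun s N K a l * of_real (f l) - C l))\<^sup>2 / (f l + g l)\<^sup>2 * g l) / (2 * pi)
    \<and> of_real (LINT w|P. (cmod (A\<xi> w - Ahat w))\<^sup>2) =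
        T_inner s N K ra c
        + T_inner s N K (Q_op s N K f g (\<lambda>t. cnj (extend_zero s N K a t)))
            (\<lambda>t. cnj (extend_zero s N K a t))
    \<and> ((\<forall>t\<in>Rset s N K. a t \<in> \<real>) \<or> (\<forall>l. f (- l) = f l \<and> g (- l) = g l) \<longrightarrow>
        of_real (LINT w|P. (cmod (A\<xi> w - Ahat w))\<^sup>2) =
          T_inner s N K ra c
          + T_inner s N K (Q_op s N K f g (extend_zero s N K a)) (extend_zero s N K a))"
proof -
  have nn: "\<And>l. 0 \<le> f l" "\<And>l. 0 \<le> g l" and fi: "integrable lborel f" "integrable lborel g"
    using assms(8,9) by (auto simp: has_spectral_density_def)
  \<comment> \<open>Minimality is used already here: the locale presupposes that
    \<open>f + g\<close> is positive almost everywhere.\<close>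
  have pos: "AE l in lborel. 0 < f l + g l"
    using minimality_function[OF assms(12) fi nn] by blast
  interpret estimation_problem s N K f g P \<xi> \<eta> Z\<xi> Z\<eta> a A\<xi> Ahat
    by unfold_locales (use assms nn fi pos in auto)
  obtain h where h: "spectral_characteristic P s N K f g Z\<xi> Z\<eta> Ahat h"
    "AE l in lborel. C l = A l * of_real (f l) - of_real (f l + g l) * h l"
    "(nrm P (\<lambda>w. A\<xi> w - Ahat w))\<^sup>2 = ((nrm (mu f) A)\<^sup>2 - (nrm M h)\<^sup>2) / (2 * pi)"
    "ip (mu f) A h = of_real ((nrm M h)\<^sup>2)"
    "T_inner s N K ra c = of_real (((LBINT l. (cmod (A l))\<^sup>2 * (f l)\<^sup>2 / (f l + g l)) - (nrm M h)\<^sup>2) / (2 * pi))"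
    by (rule estimate_formula[OF assms(12,13,18,19,20)], rule that)
  have Cm: "C \<in> borel_measurable borel" using assms(20) by (auto simp: T_fourier_def L2_def)
  have hL: "h \<in> L2 M" using h(1) by (simp add: spectral_characteristic_def has_stoch_integral_def)
  have heq: "AE l in lborel. h l = A l * of_real (f l / (f l + g l)) - C l / of_real (f l + g l)"
    using h(2) fg_pos
  proof eventually_elim
    case (elim l)
    then have "complex_of_real (f l + g l) \<noteq> 0" by (simp only: of_real_eq_0_iff)
    then show ?case unfolding elim(1) by (simp add: diff_divide_distrib del: of_real_add)
  qed
  have E: "(LINT w|P. (cmod (A\<xi> w - Ahat w))\<^sup>2) = ((nrm (mu f) A)\<^sup>2 - (nrm M h)\<^sup>2) / (2 * pi)"
    using h(3) unfolding nrm_sq[of P] .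
  have 1: "\<forall>h'. spectral_characteristic P s N K f g Z\<xi> Z\<eta> Ahat h' \<longleftrightarrow>
            h' \<in> borel_measurable borel \<and>
            (AE l in lborel. h' l = A l * of_real (f l / (f l + g l)) - C l / of_real (f l + g l))"
  proof (intro allI iffI conjI)
    fix h' assume h': "spectral_characteristic P s N K f g Z\<xi> Z\<eta> Ahat h'"
    then show "h' \<in> borel_measurable borel"
      by (intro M_L2_measurable) (simp add: spectral_characteristic_def has_stoch_integral_def)
    show "AE l in lborel. h' l = A l * of_real (f l / (f l + g l)) - C l / of_real (f l + g l)"
      using spectral_characteristic_unique[OF h' h(1)] heq by eventually_elim simp
  next
    fix h' assume "h' \<in> borel_measurable borel \<and>
            (AE l in lborel. h' l = A l * of_real (f l / (f l + g l)) - C l / of_real (f l + g l))"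
    then have h': "h' \<in> borel_measurable borel"
      "AE l in lborel. h' l = A l * of_real (f l / (f l + g l)) - C l / of_real (f l + g l)" by auto
    have "AE l in lborel. h l = h' l" using h'(2) heq by eventually_elim simp
    then show "spectral_characteristic P s N K f g Z\<xi> Z\<eta> Ahat h'"
      by (rule spectral_characteristic_cong[OF h(1) h'(1)])
  qed
  have 2: "(LINT w|P. (cmod (A\<xi> w - Ahat w))\<^sup>2) =
        (LBINT l. (cmod (A l * of_real (g l) + C l))\<^sup>2 / (f l + g l)\<^sup>2 * f l) / (2 * pi)
        + (LBINT l. (cmod (A l * of_real (f l) - C l))\<^sup>2 / (f l + g l)\<^sup>2 * g l) / (2 * pi)"
    unfolding E add_divide_distrib[symmetric] error_integrals[OF hL h(2,4) Cm] ..
  have 3: "of_real (LINT w|P. (cmod (A\<xi> w - Ahat w))\<^sup>2) =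
        T_inner s N K ra c + T_inner s N K (Q_op s N K f g (\<lambda>t. cnj (a0 t))) (\<lambda>t. cnj (a0 t))"
    unfolding E by (rule error_operator_form[OF _ h(5), symmetric]) simp
  have 4: "of_real (LINT w|P. (cmod (A\<xi> w - Ahat w))\<^sup>2) = T_inner s N K ra c + T_inner s N K (Q_op s N K f g a0) a0"
    if "(\<forall>t\<in>Rset s N K. a t \<in> \<real>) \<or> (\<forall>l. f (- l) = f l \<and> g (- l) = g l)"
    using that
  proof
    assume "\<forall>t\<in>Rset s N K. a t \<in> \<real>"
    then have "(\<lambda>t. cnj (a0 t)) = a0"
      by (auto simp: extend_zero_def fun_eq_iff Reals_cnj_iff)
    then show ?thesis using 3 by simp
  next
    assume "\<forall>l. f (- l) = f l \<and> g (- l) = g l"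
    then show ?thesis unfolding E by (intro error_operator_form[OF _ h(5), symmetric]) simp
  qed
  from 1 2 3 4 show ?thesis by blast
qed

end
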